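(* For all (external) natural numbers $h,k$, the theory $\mathsf{RCA}^*_0+\mathrm{Tot}(F_h)$ proves that the following are equivalent: $\mathrm{WPH}^{h,2}_k$, $k\text{-}\mathrm{HCT}^h_b$, and $k\text{-}\mathrm{TT}^h_b$.
   Context: $\mathsf{RCA}^*_0$ is second-order arithmetic with exponentiation, $\Delta^0_0$-induction and $\Delta^0_1$-comprehension. $F_0(x)=x+1$, $F_{n+1}(x)=F_n^{(x+1)}(x)$; $\mathrm{Tot}(F_h)$ states that $F_h$ is total. A finite set $X$ is $1$-large if $\min X<|X|$. For $P:[X]^2\to k$, $Y=\{y_0<y_1<\cdots\}\subseteq X$ is weakly homogeneous if $P(\{y_n,y_{n+1}\})$ is constant in $n$. A bound for a relation $Q$ on $S$ is $g:S\to\mathbb{N}$ such that every finite $Q$-decreasing sequence $\langle a_0,\dots,a_{l-1}\rangle$ ($a_{i+1}\,Q\,a_i$) has $l\le g(a_0)$. $\mathrm{WPH}^{h,2}_k$: for every $f:\mathbb{N}\to\mathbb{N}$ with $f(n+1)<F_h(f(n))$ for all $n$, and every $P:[\mathrm{rng}(f)]^2\to k$, there is a $1$-large weakly homogeneous set for $P$. $k\text{-}\mathrm{HCT}^h_b$: if $R_0,\dots,R_{k-1}$ are binary relations with bounds $f_i$ satisfying $f_i(n)<F_h(n)$ for all $n$, then every transitive $(R_0\cup\dots\cup R_{k-1})$-decreasing sequence $f:\mathbb{N}\to\mathbb{N}$ (i.e. $f(m)\,(R_0\cup\dots\cup R_{k-1})\,f(n)$ for $n<m$) with $f(n+1)<F_h(f(n))$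 for all $n$ is finite. $k\text{-}\mathrm{TT}^h_b$: let $R$ be a deterministic binary relation whose transition function $f:\mathbb{N}\to\mathbb{N}$ satisfies $f(n+1)<F_h(f(n))$ for all $n$; if there exist relations $R_0,\dots,R_{k-1}$ with bounds $f_i$ satisfying $f_i(n)<F_h(n)$ for all $n$ and $R_0\cup\dots\cup R_{k-1}\supseteq R^+$, then $R$ is well-founded.
   Formalization: In WPH, f is required to be strictly increasing (a constant f refutes it as stated). In HCT and TT the relations and bounds live on a common set S and "for all n" means n in S (F_h(0)=1 excludes 0). In TT, f lists successive states: R = {(f(n+1), f(n))}. *)

theory Defs
  imports Main
begin

section \<open>Second-order arithmetic with exponentiation: syntax and derivability\<close>

text \<open>
  Two-sorted classical logic. Number variables and set variables are de Bruijn indices in two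
  separate index spaces; \<open>AllN\<close> binds a number variable, \<open>AllS\<close> a set variable. As usual for
  second-order arithmetic, equality is primitive for numbers only.
\<close>

datatype tm = Var nat | Zero | One | Add tm tm | Mul tm tm | Exp tm tm

datatype fm = Eq tm tm | Less tm tm | Mem tm nat | Bot | Imp fm fm | AllN fm | AllS fm

definition Neg :: "fm \<Rightarrow> fm" where "Neg p = Imp p Bot"
definition And :: "fm \<Rightarrow> fm \<Rightarrow> fm" where "And p q = Neg (Imp p (Neg q))"
definition Or :: "fm \<Rightarrow> fm \<Rightarrow> fm" where "Or p q = Imp (Neg p) q"
definition Iff :: "fm \<Rightarrow> fm \<Rightarrow> fm" where "Iff p q = And (Imp p q) (Imp q p)"
definition ExN :: "fm \<Rightarrow> fm" where "ExN p = Neg (AllN (Neg p))"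
definition ExS :: "fm \<Rightarrow> fm" where "ExS p = Neg (AllS (Neg p))"

primrec substT :: "(nat \<Rightarrow> tm) \<Rightarrow> tm \<Rightarrow> tm" where
  "substT \<sigma> (Var i) = \<sigma> i"
| "substT \<sigma> Zero = Zero"
| "substT \<sigma> One = One"
| "substT \<sigma> (Add s t) = Add (substT \<sigma> s) (substT \<sigma> t)"
| "substT \<sigma> (Mul s t) = Mul (substT \<sigma> s) (substT \<sigma> t)"
| "substT \<sigma> (Exp s t) = Exp (substT \<sigma> s) (substT \<sigma> t)"

definition liftT :: "tm \<Rightarrow> tm" where "liftT = substT (\<lambda>i. Var (Suc i))"

text \<open>Simultaneous substitution: terms for number variables (\<open>\<sigma>\<close>), set variables for set
  variables (\<open>\<rho>\<close>).\<close>

primrec subst :: "(nat \<Rightarrow> tm) \<Rightarrow> (nat \<Rightarrow> nat) \<Rightarrow> fm \<Rightarrow> fm" where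
  "subst \<sigma> \<rho> (Eq s t) = Eq (substT \<sigma> s) (substT \<sigma> t)"
| "subst \<sigma> \<rho> (Less s t) = Less (substT \<sigma> s) (substT \<sigma> t)"
| "subst \<sigma> \<rho> (Mem t X) = Mem (substT \<sigma> t) (\<rho> X)"
| "subst \<sigma> \<rho> Bot = Bot"
| "subst \<sigma> \<rho> (Imp p q) = Imp (subst \<sigma> \<rho> p) (subst \<sigma> \<rho> q)"
| "subst \<sigma> \<rho> (AllN p) = AllN (subst (case_nat (Var 0) (\<lambda>i. liftT (\<sigma> i))) \<rho> p)"
| "subst \<sigma> \<rho> (AllS p) = AllS (subst \<sigma> (case_nat 0 (\<lambda>i. Suc (\<rho> i))) p)"

definition liftN :: "fm \<Rightarrow> fm" where "liftN = subst (\<lambda>i. Var (Suc i)) (\<lambda>X. X)"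
definition liftS :: "fm \<Rightarrow> fm" where "liftS = subst Var Suc"
definition instN :: "tm \<Rightarrow> fm \<Rightarrow> fm" where "instN t = subst (case_nat t Var) (\<lambda>X. X)"
definition instS :: "nat \<Rightarrow> fm \<Rightarrow> fm" where "instS X = subst Var (case_nat X (\<lambda>Y. Y))"

text \<open>Natural deduction for classical two-sorted logic. Lifting the hypotheses in the
  generalisation rules is the eigenvariable condition.\<close>

inductive derives :: "fm set \<Rightarrow> fm \<Rightarrow> bool" (infix "\<turnstile>" 40) where
  assm: "p \<in> \<Gamma> \<Longrightarrow> \<Gamma> \<turnstile> p"
| impI: "insert p \<Gamma> \<turnstile> q \<Longrightarrow> \<Gamma> \<turnstile> Imp p q"
| impE: "\<Gamma> \<turnstile> Imp p q \<Longrightarrow> \<Gamma> \<turnstile> p \<Longrightarrow> \<Gamma> \<turnstile> q"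
| raa: "insert (Neg p) \<Gamma> \<turnstile> Bot \<Longrightarrow> \<Gamma> \<turnstile> p"
| allNI: "liftN ` \<Gamma> \<turnstile> p \<Longrightarrow> \<Gamma> \<turnstile> AllN p"
| allNE: "\<Gamma> \<turnstile> AllN p \<Longrightarrow> \<Gamma> \<turnstile> instN t p"
| allSI: "liftS ` \<Gamma> \<turnstile> p \<Longrightarrow> \<Gamma> \<turnstile> AllS p"
| allSE: "\<Gamma> \<turnstile> AllS p \<Longrightarrow> \<Gamma> \<turnstile> instS X p"
| eqI: "\<Gamma> \<turnstile> Eq t t"
| eqE: "\<Gamma> \<turnstile> Eq s t \<Longrightarrow> \<Gamma> \<turnstile> instN s p \<Longrightarrow> \<Gamma> \<turnstile> instN t p"


section \<open>Named notation for formulas\<close>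

text \<open>
  Concrete formulas are written with bound variables of the metalogic. An \<open>ntm\<close> (\<open>svar\<close>, \<open>frm\<close>)
  is a term (set variable, formula) as a function of the number of number (and set) quantifiers
  above it: a variable bound at level \<open>n\<close> is the de Bruijn index \<open>n' - Suc n\<close> at depth \<open>n'\<close>.
  A sentence is obtained at depth \<open>0\<close>.
\<close>

type_synonym ntm = "nat \<Rightarrow> tm"
type_synonym svar = "nat \<Rightarrow> nat"
type_synonym frm = "nat \<Rightarrow> nat \<Rightarrow> fm"

definition sentence :: "frm \<Rightarrow> fm" where "sentence F = F 0 0"

definition nZero :: ntm ("\<^bold>0") where "\<^bold>0 = (\<lambda>n. Zero)"
definition nOne :: ntm ("\<^bold>1") where "\<^bold>1 = (\<lambda>n. One)"
definition nAdd :: "ntm \<Rightarrow> ntm \<Rightarrow> ntm" (infixl "\<^bold>+" 65) where "s \<^bold>+ t = (\<lambda>n. Add (s n) (t n))"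
definition nMul :: "ntm \<Rightarrow> ntm \<Rightarrow> ntm" (infixl "\<^bold>*" 70) where "s \<^bold>* t = (\<lambda>n. Mul (s n) (t n))"
definition nPow :: "ntm \<Rightarrow> ntm \<Rightarrow> ntm" (infixr "\<^bold>^" 80) where "s \<^bold>^ t = (\<lambda>n. Exp (s n) (t n))"

definition fEq :: "ntm \<Rightarrow> ntm \<Rightarrow> frm" (infix "\<^bold>=" 50) where
  "(s \<^bold>= t) = (\<lambda>n m. Eq (s n) (t n))"
definition fLess :: "ntm \<Rightarrow> ntm \<Rightarrow> frm" (infix "\<^bold><" 50) where
  "(s \<^bold>< t) = (\<lambda>n m. Less (s n) (t n))"
definition fMem :: "ntm \<Rightarrow> svar \<Rightarrow> frm" (infix "\<^bold>\<in>" 50) where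
  "(t \<^bold>\<in> X) = (\<lambda>n m. Mem (t n) (X m))"
definition fBot :: frm ("\<^bold>\<bottom>") where "\<^bold>\<bottom> = (\<lambda>n m. Bot)"
definition fNeg :: "frm \<Rightarrow> frm" ("\<^bold>\<not> _" [40] 40) where
  "(\<^bold>\<not> F) = (\<lambda>n m. Neg (F n m))"
definition fAnd :: "frm \<Rightarrow> frm \<Rightarrow> frm" (infixr "\<^bold>\<and>" 35) where
  "(F \<^bold>\<and> G) = (\<lambda>n m. And (F n m) (G n m))"
definition fOr :: "frm \<Rightarrow> frm \<Rightarrow> frm" (infixr "\<^bold>\<or>" 30) where
  "(F \<^bold>\<or> G) = (\<lambda>n m. Or (F n m) (G n m))"
definition fImp :: "frm \<Rightarrow> frm \<Rightarrow> frm" (infixr "\<^bold>\<longrightarrow>" 25) where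
  "(F \<^bold>\<longrightarrow> G) = (\<lambda>n m. Imp (F n m) (G n m))"
definition fIff :: "frm \<Rightarrow> frm \<Rightarrow> frm" (infix "\<^bold>\<longleftrightarrow>" 25) where
  "(F \<^bold>\<longleftrightarrow> G) = (\<lambda>n m. Iff (F n m) (G n m))"
definition fAllN :: "(ntm \<Rightarrow> frm) \<Rightarrow> frm" (binder "\<^bold>\<forall>" 10) where
  "fAllN F = (\<lambda>n m. AllN (F (\<lambda>n'. Var (n' - Suc n)) (Suc n) m))"
definition fExN :: "(ntm \<Rightarrow> frm) \<Rightarrow> frm" (binder "\<^bold>\<exists>" 10) where
  "fExN F = (\<lambda>n m. ExN (F (\<lambda>n'. Var (n' - Suc n)) (Suc n) m))"
definition fAllS :: "(svar \<Rightarrow> frm) \<Rightarrow> frm" (binder "\<^bold>\<forall>\<^sub>S" 10) where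
  "fAllS F = (\<lambda>n m. AllS (F (\<lambda>m'. m' - Suc m) n (Suc m)))"
definition fExS :: "(svar \<Rightarrow> frm) \<Rightarrow> frm" (binder "\<^bold>\<exists>\<^sub>S" 10) where
  "fExS F = (\<lambda>n m. ExS (F (\<lambda>m'. m' - Suc m) n (Suc m)))"

abbreviation fTop :: frm ("\<^bold>\<top>") where "\<^bold>\<top> \<equiv> \<^bold>\<not> \<^bold>\<bottom>"
abbreviation fLe :: "ntm \<Rightarrow> ntm \<Rightarrow> frm" (infix "\<^bold>\<le>" 50) where "s \<^bold>\<le> t \<equiv> s \<^bold>< t \<^bold>\<or> s \<^bold>= t"

definition Conj :: "frm list \<Rightarrow> frm" where "Conj Fs = foldr (\<lambda>F G. F \<^bold>\<and> G) Fs \<^bold>\<top>"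
definition Disj :: "frm list \<Rightarrow> frm" where "Disj Fs = foldr (\<lambda>F G. F \<^bold>\<or> G) Fs \<^bold>\<bottom>"

text \<open>Blocks of \<open>k\<close> set quantifiers, binding a list of \<open>k\<close> set variables.\<close>

primrec AllSs :: "nat \<Rightarrow> (svar list \<Rightarrow> frm) \<Rightarrow> frm" where
  "AllSs 0 F = F []"
| "AllSs (Suc k) F = (\<^bold>\<forall>\<^sub>S X. AllSs k (\<lambda>Xs. F (X # Xs)))"

primrec ExSs :: "nat \<Rightarrow> (svar list \<Rightarrow> frm) \<Rightarrow> frm" where
  "ExSs 0 F = F []"
| "ExSs (Suc k) F = (\<^bold>\<exists>\<^sub>S X. ExSs k (\<lambda>Xs. F (X # Xs)))"

primrec num :: "nat \<Rightarrow> ntm" where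
  "num 0 = \<^bold>0"
| "num (Suc k) = num k \<^bold>+ \<^bold>1"


section \<open>The theory \<open>RCA\<^sup>*\<^sub>0\<close>\<close>

definition basic_axioms :: "frm set" where
  "basic_axioms = {
    (\<^bold>\<forall>x. \<^bold>\<not> x \<^bold>+ \<^bold>1 \<^bold>= \<^bold>0),
    (\<^bold>\<forall>x. \<^bold>\<forall>y. x \<^bold>+ \<^bold>1 \<^bold>= y \<^bold>+ \<^bold>1 \<^bold>\<longrightarrow> x \<^bold>= y),
    (\<^bold>\<forall>x. x \<^bold>+ \<^bold>0 \<^bold>= x),
    (\<^bold>\<forall>x. \<^bold>\<forall>y. x \<^bold>+ (y \<^bold>+ \<^bold>1) \<^bold>= (x \<^bold>+ y) \<^bold>+ \<^bold>1),
    (\<^bold>\<forall>x. x \<^bold>* \<^bold>0 \<^bold>= \<^bold>0),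
    (\<^bold>\<forall>x. \<^bold>\<forall>y. x \<^bold>* (y \<^bold>+ \<^bold>1) \<^bold>= (x \<^bold>* y) \<^bold>+ x),
    (\<^bold>\<forall>x. \<^bold>\<not> x \<^bold>< \<^bold>0),
    (\<^bold>\<forall>x. \<^bold>\<forall>y. x \<^bold>< y \<^bold>+ \<^bold>1 \<^bold>\<longleftrightarrow> (x \<^bold>< y \<^bold>\<or> x \<^bold>= y)),
    (\<^bold>\<forall>x. x \<^bold>^ \<^bold>0 \<^bold>= \<^bold>1),
    (\<^bold>\<forall>x. \<^bold>\<forall>y. x \<^bold>^ (y \<^bold>+ \<^bold>1) \<^bold>= (x \<^bold>^ y) \<^bold>* x)}"

text \<open>Bounded formulas; set parameters are allowed. The lifting makes the bound independent of the
  quantified variable.\<close>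

inductive delta00 :: "fm \<Rightarrow> bool" where
  "delta00 (Eq s t)"
| "delta00 (Less s t)"
| "delta00 (Mem t X)"
| "delta00 Bot"
| "delta00 p \<Longrightarrow> delta00 q \<Longrightarrow> delta00 (Imp p q)"
| "delta00 p \<Longrightarrow> delta00 (AllN (Imp (Less (Var 0) (liftT t)) p))"

definition sigma01 :: "fm \<Rightarrow> bool" where "sigma01 p \<longleftrightarrow> (\<exists>q. delta00 q \<and> p = ExN q)"
definition pi01 :: "fm \<Rightarrow> bool" where "pi01 p \<longleftrightarrow> (\<exists>q. delta00 q \<and> p = AllN q)"

text \<open>In the schemes below the distinguished variable of \<open>p\<close> and \<open>q\<close> is \<open>Var 0\<close>; all other
  variables are parameters.\<close>

definition induction_fm :: "fm \<Rightarrow> fm" where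
  "induction_fm p =
    Imp (And (instN Zero p)
             (AllN (Imp p (subst (case_nat (Add (Var 0) One) (\<lambda>i. Var (Suc i))) (\<lambda>X. X) p))))
        (AllN p)"

definition comprehension_fm :: "fm \<Rightarrow> fm \<Rightarrow> fm" where
  "comprehension_fm p q =
    Imp (AllN (Iff p q)) (ExS (AllN (Iff (Mem (Var 0) 0) (liftS p))))"

primrec closedT :: "nat \<Rightarrow> tm \<Rightarrow> bool" where
  "closedT n (Var i) \<longleftrightarrow> i < n"
| "closedT n Zero \<longleftrightarrow> True"
| "closedT n One \<longleftrightarrow> True"
| "closedT n (Add s t) \<longleftrightarrow> closedT n s \<and> closedT n t"
| "closedT n (Mul s t) \<longleftrightarrow> closedT n s \<and> closedT n t"
| "closedT n (Exp s t) \<longleftrightarrow> closedT n s \<and> closedT n t"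

text \<open>\<open>closedF n m p\<close>: the free number (set) variables of \<open>p\<close> are below \<open>n\<close> (\<open>m\<close>).\<close>

primrec closedF :: "nat \<Rightarrow> nat \<Rightarrow> fm \<Rightarrow> bool" where
  "closedF n m (Eq s t) \<longleftrightarrow> closedT n s \<and> closedT n t"
| "closedF n m (Less s t) \<longleftrightarrow> closedT n s \<and> closedT n t"
| "closedF n m (Mem t X) \<longleftrightarrow> closedT n t \<and> X < m"
| "closedF n m Bot \<longleftrightarrow> True"
| "closedF n m (Imp p q) \<longleftrightarrow> closedF n m p \<and> closedF n m q"
| "closedF n m (AllN p) \<longleftrightarrow> closedF (Suc n) m p"
| "closedF n m (AllS p) \<longleftrightarrow> closedF n (Suc m) p"

definition closures :: "fm \<Rightarrow> fm set" where
  "closures p = {(AllS ^^ m) ((AllN ^^ n) p) | n m. closedF n m p}"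

definition RCA0_star :: "fm set" where
  "RCA0_star =
    sentence ` basic_axioms
    \<union> (\<Union>p \<in> {p. delta00 p}. closures (induction_fm p))
    \<union> (\<Union>p \<in> {p. sigma01 p}. \<Union>q \<in> {q. pi01 q}. closures (comprehension_fm p q))"


section \<open>Pairs, functions, finite sets and finite sequences\<close>

definition pair :: "ntm \<Rightarrow> ntm \<Rightarrow> ntm" ("\<^bold>\<langle>_,/ _\<^bold>\<rangle>") where
  "\<^bold>\<langle>x, y\<^bold>\<rangle> = (x \<^bold>+ y) \<^bold>* (x \<^bold>+ y) \<^bold>+ x"

definition ExUnique :: "(ntm \<Rightarrow> frm) \<Rightarrow> frm" (binder "\<^bold>\<exists>\<^bold>!" 10) where
  "ExUnique F = (\<^bold>\<exists>x. F x \<^bold>\<and> (\<^bold>\<forall>y. F y \<^bold>\<longrightarrow> y \<^bold>= x))"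

text \<open>\<open>f\<close> is a function from the class \<open>A\<close> to the class \<open>B\<close>; \<open>App f x y\<close> means \<open>f(x) = y\<close>.\<close>

definition App :: "svar \<Rightarrow> ntm \<Rightarrow> ntm \<Rightarrow> frm" where "App f x y = (\<^bold>\<langle>x, y\<^bold>\<rangle> \<^bold>\<in> f)"

definition Func :: "svar \<Rightarrow> (ntm \<Rightarrow> frm) \<Rightarrow> (ntm \<Rightarrow> frm) \<Rightarrow> frm" where
  "Func f A B =
    ((\<^bold>\<forall>z. z \<^bold>\<in> f \<^bold>\<longrightarrow> (\<^bold>\<exists>x. \<^bold>\<exists>y. A x \<^bold>\<and> B y \<^bold>\<and> z \<^bold>= \<^bold>\<langle>x, y\<^bold>\<rangle>)) \<^bold>\<and>
     (\<^bold>\<forall>x. A x \<^bold>\<longrightarrow> (\<^bold>\<exists>\<^bold>!y. App f x y)))"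

definition Nats :: "ntm \<Rightarrow> frm" where "Nats x = \<^bold>\<top>"
definition Elem :: "svar \<Rightarrow> ntm \<Rightarrow> frm" where "Elem S x = (x \<^bold>\<in> S)"
definition Below :: "nat \<Rightarrow> ntm \<Rightarrow> frm" where "Below k x = (x \<^bold>< num k)"
definition Rng :: "svar \<Rightarrow> ntm \<Rightarrow> frm" where "Rng f y = (\<^bold>\<exists>x. App f x y)"

text \<open>\<open>[A]\<^sup>2\<close>, the two-element set \<open>{x < y}\<close> being represented by the ordered pair.\<close>

definition Pairs :: "(ntm \<Rightarrow> frm) \<Rightarrow> ntm \<Rightarrow> frm" where
  "Pairs A z = (\<^bold>\<exists>x. \<^bold>\<exists>y. A x \<^bold>\<and> A y \<^bold>\<and> x \<^bold>< y \<^bold>\<and> z \<^bold>= \<^bold>\<langle>x, y\<^bold>\<rangle>)"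

text \<open>Finite sets are coded by numbers (Ackermann coding): \<open>i\<close> belongs to the finite set with code
  \<open>c\<close> if the \<open>i\<close>-th binary digit of \<open>c\<close> is \<open>1\<close>.\<close>

definition CMem :: "ntm \<Rightarrow> ntm \<Rightarrow> frm" (infix "\<^bold>\<in>\<^sub>c" 50) where
  "(i \<^bold>\<in>\<^sub>c c) =
    (\<^bold>\<exists>q. \<^bold>\<exists>r. r \<^bold>< num 2 \<^bold>^ i \<^bold>\<and> c \<^bold>= (num 2 \<^bold>* q \<^bold>+ \<^bold>1) \<^bold>* num 2 \<^bold>^ i \<^bold>+ r)"

text \<open>A finite sequence of length \<open>l\<close> is a finite function with domain \<open>{i. i < l}\<close>;
  \<open>Nth s i a\<close> means \<open>s\<^sub>i = a\<close>.\<close>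

definition Nth :: "ntm \<Rightarrow> ntm \<Rightarrow> ntm \<Rightarrow> frm" where "Nth s i a = (\<^bold>\<langle>i, a\<^bold>\<rangle> \<^bold>\<in>\<^sub>c s)"

definition FinSeq :: "ntm \<Rightarrow> ntm \<Rightarrow> frm" where
  "FinSeq s l =
    ((\<^bold>\<forall>z. z \<^bold>\<in>\<^sub>c s \<^bold>\<longrightarrow> (\<^bold>\<exists>i. \<^bold>\<exists>a. i \<^bold>< l \<^bold>\<and> z \<^bold>= \<^bold>\<langle>i, a\<^bold>\<rangle>)) \<^bold>\<and>
     (\<^bold>\<forall>i. i \<^bold>< l \<^bold>\<longrightarrow> (\<^bold>\<exists>\<^bold>!a. Nth s i a)))"

text \<open>\<open>s\<close> is the increasing enumeration of the finite set \<open>Y\<close>, and \<open>l\<close> its length.\<close>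

definition Enumerates :: "ntm \<Rightarrow> ntm \<Rightarrow> ntm \<Rightarrow> frm" where
  "Enumerates s l Y =
    (FinSeq s l \<^bold>\<and>
     (\<^bold>\<forall>i. \<^bold>\<forall>j. \<^bold>\<forall>a. \<^bold>\<forall>b. Nth s i a \<^bold>\<and> Nth s j b \<^bold>\<and> i \<^bold>< j \<^bold>\<longrightarrow> a \<^bold>< b) \<^bold>\<and>
     (\<^bold>\<forall>y. y \<^bold>\<in>\<^sub>c Y \<^bold>\<longleftrightarrow> (\<^bold>\<exists>i. Nth s i y)))"

definition IsCard :: "ntm \<Rightarrow> ntm \<Rightarrow> frm" where
  "IsCard Y l = (\<^bold>\<exists>s. Enumerates s l Y)"

definition IsMin :: "ntm \<Rightarrow> ntm \<Rightarrow> frm" where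
  "IsMin Y a = (a \<^bold>\<in>\<^sub>c Y \<^bold>\<and> (\<^bold>\<forall>y. y \<^bold>\<in>\<^sub>c Y \<^bold>\<longrightarrow> a \<^bold>\<le> y))"

definition OneLarge :: "ntm \<Rightarrow> frm" where
  "OneLarge Y = (\<^bold>\<exists>a. \<^bold>\<exists>l. IsMin Y a \<^bold>\<and> IsCard Y l \<^bold>\<and> a \<^bold>< l)"

definition WeaklyHomogeneous :: "svar \<Rightarrow> ntm \<Rightarrow> frm" where
  "WeaklyHomogeneous P Y =
    (\<^bold>\<exists>s. \<^bold>\<exists>l. Enumerates s l Y \<^bold>\<and>
      (\<^bold>\<exists>c. \<^bold>\<forall>n. \<^bold>\<forall>a. \<^bold>\<forall>b. Nth s n a \<^bold>\<and> Nth s (n \<^bold>+ \<^bold>1) b \<^bold>\<longrightarrow> App P \<^bold>\<langle>a, b\<^bold>\<rangle> c))"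


section \<open>The fast growing functions\<close>

text \<open>\<open>FG h x y\<close> is the formula \<open>F\<^sub>h(x) = y\<close>; \<open>F\<^sub>h\<^sub>+\<^sub>1(x)\<close> is computed by a sequence of length
  \<open>x + 2\<close> that starts with \<open>x\<close> and applies \<open>F\<^sub>h\<close> exactly \<open>x + 1\<close> times.\<close>

primrec FG :: "nat \<Rightarrow> ntm \<Rightarrow> ntm \<Rightarrow> frm" where
  "FG 0 x y = (y \<^bold>= x \<^bold>+ \<^bold>1)"
| "FG (Suc h) x y =
    (\<^bold>\<exists>s. FinSeq s (x \<^bold>+ num 2) \<^bold>\<and> Nth s \<^bold>0 x \<^bold>\<and> Nth s (x \<^bold>+ \<^bold>1) y \<^bold>\<and>
      (\<^bold>\<forall>i. \<^bold>\<forall>a. \<^bold>\<forall>b. i \<^bold>< x \<^bold>+ \<^bold>1 \<^bold>\<and> Nth s i a \<^bold>\<and> Nth s (i \<^bold>+ \<^bold>1) b \<^bold>\<longrightarrow> FG h a b))"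

definition Tot :: "nat \<Rightarrow> frm" where
  "Tot h = (\<^bold>\<forall>x. \<^bold>\<exists>y. FG h x y)"

definition LessF :: "nat \<Rightarrow> ntm \<Rightarrow> ntm \<Rightarrow> frm" where
  \<comment> \<open>\<open>y < F\<^sub>h(x)\<close>\<close>
  "LessF h y x = (\<^bold>\<exists>z. FG h x z \<^bold>\<and> y \<^bold>< z)"

text \<open>\<open>f(n+1) < F\<^sub>h(f(n))\<close> for all \<open>n\<close>\<close>

definition GrowthBelow :: "nat \<Rightarrow> svar \<Rightarrow> frm" where
  "GrowthBelow h f =
    (\<^bold>\<forall>n. \<^bold>\<forall>a. \<^bold>\<forall>b. App f n a \<^bold>\<and> App f (n \<^bold>+ \<^bold>1) b \<^bold>\<longrightarrow> LessF h b a)"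


section \<open>Binary relations and bounds\<close>

text \<open>A relation is a set of pairs, and \<open>Rel R a b\<close> means \<open>a R b\<close>. \<open>RelOn R S\<close> says that \<open>R\<close>
  is a binary relation on \<open>S\<close>.\<close>

definition Rel :: "svar \<Rightarrow> ntm \<Rightarrow> ntm \<Rightarrow> frm" where "Rel R a b = (\<^bold>\<langle>a, b\<^bold>\<rangle> \<^bold>\<in> R)"

definition RelOn :: "svar \<Rightarrow> svar \<Rightarrow> frm" where
  "RelOn R S = (\<^bold>\<forall>z. z \<^bold>\<in> R \<^bold>\<longrightarrow> (\<^bold>\<exists>a. \<^bold>\<exists>b. a \<^bold>\<in> S \<^bold>\<and> b \<^bold>\<in> S \<^bold>\<and> z \<^bold>= \<^bold>\<langle>a, b\<^bold>\<rangle>))"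

definition RelUnion :: "svar list \<Rightarrow> ntm \<Rightarrow> ntm \<Rightarrow> frm" where
  "RelUnion Rs a b = Disj (map (\<lambda>R. Rel R a b) Rs)"

definition DecSeq :: "svar \<Rightarrow> ntm \<Rightarrow> ntm \<Rightarrow> frm" where
  "DecSeq Q s l =
    (FinSeq s l \<^bold>\<and> (\<^bold>\<forall>i. \<^bold>\<forall>a. \<^bold>\<forall>b. Nth s i a \<^bold>\<and> Nth s (i \<^bold>+ \<^bold>1) b \<^bold>\<longrightarrow> Rel Q b a))"

text \<open>\<open>g : S \<rightarrow> \<nat>\<close> is a bound for the relation \<open>Q\<close> on \<open>S\<close>. One-element sequences in \<open>S\<close> count,
  so a bound is positive on \<open>S\<close>.\<close>

definition IsBound :: "svar \<Rightarrow> svar \<Rightarrow> svar \<Rightarrow> frm" where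
  "IsBound g Q S =
    (Func g (Elem S) Nats \<^bold>\<and>
     (\<^bold>\<forall>s. \<^bold>\<forall>l. \<^bold>\<forall>a. \<^bold>\<forall>u.
       DecSeq Q s l \<^bold>\<and> (\<^bold>\<forall>i. \<^bold>\<forall>b. Nth s i b \<^bold>\<longrightarrow> b \<^bold>\<in> S) \<^bold>\<and> Nth s \<^bold>0 a \<^bold>\<and> App g a u \<^bold>\<longrightarrow> l \<^bold>\<le> u))"

text \<open>\<open>R\<close> is a relation on \<open>S\<close> with bound \<open>g\<close> such that \<open>g(n) < F\<^sub>h(n)\<close> for all \<open>n\<close> (in the domain
  \<open>S\<close> of \<open>g\<close>). As \<open>F\<^sub>h(0) = 1\<close>, this forces \<open>0\<close> to lie outside \<open>S\<close>, which is why \<open>S\<close> cannot be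
  taken to be all of \<open>\<nat>\<close>.\<close>

definition FBounded :: "nat \<Rightarrow> svar \<Rightarrow> svar \<Rightarrow> svar \<Rightarrow> frm" where
  "FBounded h S R g =
    (RelOn R S \<^bold>\<and> IsBound g R S \<^bold>\<and> (\<^bold>\<forall>n. \<^bold>\<forall>u. n \<^bold>\<in> S \<^bold>\<and> App g n u \<^bold>\<longrightarrow> LessF h u n))"

definition AllFBounded :: "nat \<Rightarrow> svar \<Rightarrow> svar list \<Rightarrow> svar list \<Rightarrow> frm" where
  "AllFBounded h S Rs gs = Conj (map2 (FBounded h S) Rs gs)"

text \<open>The transitive closure \<open>R\<^sup>+\<close>: \<open>b R\<^sup>+ a\<close> if some \<open>R\<close>-decreasing sequence of length at
  least \<open>2\<close> leads from \<open>a\<close> to \<open>b\<close>.\<close>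

definition TransCl :: "svar \<Rightarrow> ntm \<Rightarrow> ntm \<Rightarrow> frm" where
  "TransCl R b a =
    (\<^bold>\<exists>s. \<^bold>\<exists>j. DecSeq R s (j \<^bold>+ num 2) \<^bold>\<and> Nth s \<^bold>0 a \<^bold>\<and> Nth s (j \<^bold>+ \<^bold>1) b)"

definition WellFounded :: "svar \<Rightarrow> frm" where
  "WellFounded R =
    (\<^bold>\<not> (\<^bold>\<exists>\<^sub>S g. Func g Nats Nats \<^bold>\<and>
      (\<^bold>\<forall>n. \<^bold>\<forall>a. \<^bold>\<forall>b. App g n a \<^bold>\<and> App g (n \<^bold>+ \<^bold>1) b \<^bold>\<longrightarrow> Rel R b a)))"

definition Deterministic :: "svar \<Rightarrow> frm" where
  "Deterministic R = (\<^bold>\<forall>a. \<^bold>\<forall>b. \<^bold>\<forall>c. Rel R b a \<^bold>\<and> Rel R c a \<^bold>\<longrightarrow> b \<^bold>= c)"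

text \<open>\<open>f\<close> is the transition function of \<open>R\<close>: it lists the successive states, so that the
  transitions of \<open>R\<close> are exactly those from \<open>f(n)\<close> to \<open>f(n+1)\<close>.\<close>

definition TransitionFunction :: "svar \<Rightarrow> svar \<Rightarrow> frm" where
  "TransitionFunction f R =
    (Func f Nats Nats \<^bold>\<and>
     (\<^bold>\<forall>z. z \<^bold>\<in> R \<^bold>\<longleftrightarrow> (\<^bold>\<exists>n. \<^bold>\<exists>a. \<^bold>\<exists>b. App f n a \<^bold>\<and> App f (n \<^bold>+ \<^bold>1) b \<^bold>\<and> z \<^bold>= \<^bold>\<langle>b, a\<^bold>\<rangle>)))"


section \<open>The three principles\<close>

text \<open>In \<open>WPH\<close> the function \<open>f\<close> enumerates its range increasingly. Without this requirement a
  constant function with positive value, whose range has no 1-large subset, refutes it.\<close>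

definition Increasing :: "svar \<Rightarrow> frm" where
  "Increasing f = (\<^bold>\<forall>n. \<^bold>\<forall>a. \<^bold>\<forall>b. App f n a \<^bold>\<and> App f (n \<^bold>+ \<^bold>1) b \<^bold>\<longrightarrow> a \<^bold>< b)"

definition WPH :: "nat \<Rightarrow> nat \<Rightarrow> frm" where
  "WPH h k =
    (\<^bold>\<forall>\<^sub>S f. Func f Nats Nats \<^bold>\<and> Increasing f \<^bold>\<and> GrowthBelow h f \<^bold>\<longrightarrow>
      (\<^bold>\<forall>\<^sub>S P. Func P (Pairs (Rng f)) (Below k) \<^bold>\<longrightarrow>
        (\<^bold>\<exists>Y. (\<^bold>\<forall>y. y \<^bold>\<in>\<^sub>c Y \<^bold>\<longrightarrow> Rng f y) \<^bold>\<and> OneLarge Y \<^bold>\<and> WeaklyHomogeneous P Y)))"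

definition TransitiveDecreasing :: "svar list \<Rightarrow> svar \<Rightarrow> frm" where
  "TransitiveDecreasing Rs f =
    (\<^bold>\<forall>n. \<^bold>\<forall>m. \<^bold>\<forall>a. \<^bold>\<forall>b. n \<^bold>< m \<^bold>\<and> App f n a \<^bold>\<and> App f m b \<^bold>\<longrightarrow> RelUnion Rs b a)"

text \<open>That every such sequence is finite means that there is none defined on all of \<open>\<nat>\<close>.\<close>

definition HCT :: "nat \<Rightarrow> nat \<Rightarrow> frm" where
  "HCT h k =
    (\<^bold>\<forall>\<^sub>S S. AllSs k (\<lambda>Rs. AllSs k (\<lambda>gs.
      AllFBounded h S Rs gs \<^bold>\<longrightarrow>
      \<^bold>\<not> (\<^bold>\<exists>\<^sub>S f. Func f Nats Nats \<^bold>\<and> TransitiveDecreasing Rs f \<^bold>\<and> GrowthBelow h f))))"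

definition TT :: "nat \<Rightarrow> nat \<Rightarrow> frm" where
  "TT h k =
    (\<^bold>\<forall>\<^sub>S R. Deterministic R \<^bold>\<and> (\<^bold>\<exists>\<^sub>S f. TransitionFunction f R \<^bold>\<and> GrowthBelow h f) \<^bold>\<longrightarrow>
      (\<^bold>\<exists>\<^sub>S S. ExSs k (\<lambda>Rs. ExSs k (\<lambda>gs.
        AllFBounded h S Rs gs \<^bold>\<and> (\<^bold>\<forall>a. \<^bold>\<forall>b. TransCl R b a \<^bold>\<longrightarrow> RelUnion Rs b a)))) \<^bold>\<longrightarrow>
      WellFounded R)"

end

theory Submission
  imports Defs "HOL-Library.Countable"
begin

text \<open>
  By completeness of two-sorted logic it suffices to prove the equivalences in every model of
  \<open>RCA\<^sup>*\<^sub>0\<close>.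

  \<open>HCT\<close> implies \<open>TT\<close>: the transition function \<open>f\<close> of \<open>R\<close> is itself an infinite \<open>R\<close>-descending
  sequence, and \<open>R\<^sup>+ \<subseteq> R\<^sub>0 \<union> \<dots>\<close> makes it transitively decreasing once \<open>f(n), \<dots>, f(m)\<close> is coded as
  a finite sequence. This needs \<open>\<Sigma>\<^sup>0\<^sub>1\<close>-bounding, which follows from \<open>\<Delta>\<^sup>0\<^sub>1\<close>-comprehension by Slaman's
  argument. \<open>TT\<close> implies \<open>WPH\<close>: if \<open>P\<close> has no large weakly homogeneous set, then the steps
  \<open>f(n) \<mapsto> f(n+1)\<close> form a relation whose transitive closure is covered by the colour classes
  of \<open>P\<close>, and the identity bounds every colour class. \<open>WPH\<close> implies \<open>HCT\<close>: for
  \<open>g(n) = F\<^sub>h(max\<^sub>i\<^sub>\<le>\<^sub>n f(i)) + n\<close> colour \<open>{g(n), g(m)}\<close> by the index of a relation between \<open>f(m)\<close> and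
  \<open>f(n)\<close>; a 1-large weakly homogeneous set gives a decreasing sequence that is longer than
  the bound at its first element. For \<open>h = 0\<close> growth forces \<open>f\<close> to be strictly decreasing.
\<close>

section \<open>Substitution and derivability\<close>

text \<open>The obstacle throughout is that induction is available for bounded formulas only.
  Inductions in a model therefore carry explicit bounds on their witnesses, and the graphs of the
  functions involved, in particular of F_h, have to be shown definable by bounded formulas. A finite
  part of a function of the model has a code only once its values are bounded, which is why
  \<open>bounding\<close> stands behind both the sequence f(n), ..., f(m) and the maximum of f on an
  initial segment. The function g has to meet three demands. The summand F_h(max) makes a 1-large
  set with minimum g(n) longer than the bound at f(n); the summand n makes g strictly increasing
  while the maximum stays the same; and g must itself grow slowly enough for \<open>WPH\<close>. The
  last point uses that for h > 0 the function F_h gains at least 2 whenever its argument gains 1, so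
  that F_h(z + n) outruns F_h(m) + n for m < z. F_0 gains only 1, hence the separate treatment of h
  = 0.\<close>

abbreviation upN :: "(nat \<Rightarrow> tm) \<Rightarrow> nat \<Rightarrow> tm" where
  "upN \<sigma> \<equiv> case_nat (Var 0) (\<lambda>i. liftT (\<sigma> i))"

abbreviation upS :: "(nat \<Rightarrow> nat) \<Rightarrow> nat \<Rightarrow> nat" where
  "upS \<rho> \<equiv> case_nat 0 (\<lambda>i. Suc (\<rho> i))"

lemma substT_substT: "substT \<sigma> (substT \<tau> t) = substT (\<lambda>i. substT \<sigma> (\<tau> i)) t"
  by (induction t) auto

lemma substT_Var [simp]: "substT Var t = t"
  by (induction t) auto

lemma upN_Var [simp]: "upN Var = Var"
  by (auto simp: fun_eq_iff liftT_def split: nat.split)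

lemma upS_id [simp]: "upS (\<lambda>X. X) = (\<lambda>X. X)"
  by (auto simp: fun_eq_iff split: nat.split)

lemma subst_Var [simp]: "subst Var (\<lambda>X. X) p = p"
  by (induction p) auto

lemma subst_subst:
  "subst \<sigma> \<rho> (subst \<tau> \<pi> p) = subst (\<lambda>i. substT \<sigma> (\<tau> i)) (\<lambda>X. \<rho> (\<pi> X)) p"
proof (induction p arbitrary: \<sigma> \<rho> \<tau> \<pi>)
  case (AllN p)
  have "(\<lambda>i. substT (upN \<sigma>) (upN \<tau> i)) = upN (\<lambda>i. substT \<sigma> (\<tau> i))"
    by (auto simp: fun_eq_iff liftT_def substT_substT split: nat.split)
  then show ?case by (simp add: AllN)
next
  case (AllS p)
  have "(\<lambda>X. upS \<rho> (upS \<pi> X)) = upS (\<lambda>X. \<rho> (\<pi> X))"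
    by (auto simp: fun_eq_iff split: nat.split)
  then show ?case by (simp add: AllS)
qed (simp_all add: substT_substT)

lemma subst_Neg [simp]: "subst \<sigma> \<rho> (Neg p) = Neg (subst \<sigma> \<rho> p)"
  by (simp add: Neg_def)

lemma subst_liftN: "subst (upN \<sigma>) \<rho> (liftN p) = liftN (subst \<sigma> \<rho> p)"
  by (simp add: liftN_def subst_subst liftT_def)

lemma subst_liftS: "subst \<sigma> (upS \<rho>) (liftS p) = liftS (subst \<sigma> \<rho> p)"
  by (simp add: liftS_def subst_subst)

lemma instN_upN: "instN t (subst (upN \<sigma>) \<rho> p) = subst (case_nat t \<sigma>) \<rho> p"
proof -
  have "(\<lambda>i. substT (case_nat t Var) (upN \<sigma> i)) = case_nat t \<sigma>"
    by (auto simp: fun_eq_iff liftT_def substT_substT split: nat.split)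
  then show ?thesis by (simp add: instN_def subst_subst)
qed

lemma instS_upS: "instS X (subst \<sigma> (upS \<rho>) p) = subst \<sigma> (case_nat X \<rho>) p"
proof -
  have "(\<lambda>i. case_nat X (\<lambda>Y. Y) (upS \<rho> i)) = case_nat X \<rho>"
    by (auto simp: fun_eq_iff split: nat.split)
  then show ?thesis by (simp add: instS_def subst_subst)
qed

lemma subst_instN: "subst \<sigma> \<rho> (instN t p) = instN (substT \<sigma> t) (subst (upN \<sigma>) \<rho> p)"
proof -
  have "(\<lambda>i. substT \<sigma> (case_nat t Var i)) = case_nat (substT \<sigma> t) \<sigma>"
    by (auto simp: fun_eq_iff split: nat.split)
  then show ?thesis by (simp add: instN_upN) (simp add: instN_def subst_subst)
qed

lemma subst_instS: "subst \<sigma> \<rho> (instS X p) = instS (\<rho> X) (subst \<sigma> (upS \<rho>) p)"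
proof -
  have "(\<lambda>i. \<rho> (case_nat X (\<lambda>Y. Y) i)) = case_nat (\<rho> X) \<rho>"
    by (auto simp: fun_eq_iff split: nat.split)
  then show ?thesis by (simp add: instS_upS) (simp add: instS_def subst_subst)
qed

lemma derives_subst: "\<Gamma> \<turnstile> p \<Longrightarrow> subst \<sigma> \<rho> ` \<Gamma> \<turnstile> subst \<sigma> \<rho> p"
proof (induction arbitrary: \<sigma> \<rho> rule: derives.induct)
  case (allNI \<Gamma> p)
  have "subst (upN \<sigma>) \<rho> ` liftN ` \<Gamma> = liftN ` subst \<sigma> \<rho> ` \<Gamma>"
    by (simp add: image_image subst_liftN)
  then show ?case using allNI.IH[of "upN \<sigma>" \<rho>] by (auto intro: derives.allNI)
next
  case (allSI \<Gamma> p)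
  have "subst \<sigma> (upS \<rho>) ` liftS ` \<Gamma> = liftS ` subst \<sigma> \<rho> ` \<Gamma>"
    by (simp add: image_image subst_liftS)
  then show ?case using allSI.IH[of \<sigma> "upS \<rho>"] by (auto intro: derives.allSI)
next
  case (allNE \<Gamma> p t)
  then show ?case by (simp add: subst_instN derives.allNE)
next
  case (allSE \<Gamma> p X)
  then show ?case by (simp add: subst_instS derives.allSE)
next
  case (eqE \<Gamma> s t p)
  then show ?case by (simp add: subst_instN) (metis derives.eqE)
next
  case (impE \<Gamma> p q)
  then show ?case by (metis derives.impE subst.simps(5))
qed (auto intro: derives.assm derives.impI derives.raa derives.eqI)

lemma derives_mono: "\<Gamma> \<turnstile> p \<Longrightarrow> \<Gamma> \<subseteq> \<Delta> \<Longrightarrow> \<Delta> \<turnstile> p"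
proof (induction arbitrary: \<Delta> rule: derives.induct)
  case (impI p \<Gamma> q)
  then show ?case by (meson derives.impI insert_mono)
next
  case (raa p \<Gamma>)
  then show ?case by (meson derives.raa insert_mono)
next
  case (allNI \<Gamma> p)
  then show ?case by (meson derives.allNI image_mono)
next
  case (allSI \<Gamma> p)
  then show ?case by (meson derives.allSI image_mono)
next
  case (eqE \<Gamma> s t p)
  then show ?case by (meson derives.eqE)
qed (meson derives.assm derives.impE derives.eqI derives.allNE derives.allSE subsetD)+

text \<open>Compactness; it brings an inconsistency of the union of the chain in
  \<open>ex_henkin\<close> down to a single stage.\<close>

lemma derives_finite: "\<Gamma> \<turnstile> p \<Longrightarrow> \<exists>\<Delta>. finite \<Delta> \<and> \<Delta> \<subseteq> \<Gamma> \<and> \<Delta> \<turnstile> p"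
proof (induction rule: derives.induct)
  case (assm p \<Gamma>)
  then show ?case by (intro exI[of _ "{p}"]) (auto intro: derives.assm)
next
  case (impI p \<Gamma> q)
  then obtain \<Delta> where \<Delta>: "finite \<Delta>" "\<Delta> \<subseteq> insert p \<Gamma>" "\<Delta> \<turnstile> q" by blast
  then have "insert p (\<Delta> - {p}) \<turnstile> q" by (auto intro: derives_mono)
  then show ?case using \<Delta> by (intro exI[of _ "\<Delta> - {p}"]) (auto intro: derives.impI)
next
  case (impE \<Gamma> p q)
  then obtain \<Delta> \<Delta>' where "finite \<Delta>" "\<Delta> \<subseteq> \<Gamma>" "\<Delta> \<turnstile> Imp p q"
    and "finite \<Delta>'" "\<Delta>' \<subseteq> \<Gamma>" "\<Delta>' \<turnstile> p" by blast
  then show ?case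
    by (intro exI[of _ "\<Delta> \<union> \<Delta>'"])
      (auto intro!: derives.impE[of _ p q] elim: derives_mono)
next
  case (raa p \<Gamma>)
  then obtain \<Delta> where \<Delta>: "finite \<Delta>" "\<Delta> \<subseteq> insert (Neg p) \<Gamma>" "\<Delta> \<turnstile> Bot" by blast
  then have "insert (Neg p) (\<Delta> - {Neg p}) \<turnstile> Bot" by (auto intro: derives_mono)
  then show ?case using \<Delta> by (intro exI[of _ "\<Delta> - {Neg p}"]) (auto intro: derives.raa)
next
  case (allNI \<Gamma> p)
  then obtain \<Delta> where "finite \<Delta>" "\<Delta> \<subseteq> liftN ` \<Gamma>" "\<Delta> \<turnstile> p" by blast
  then obtain \<Delta>' where "finite \<Delta>'" "\<Delta>' \<subseteq> \<Gamma>" "\<Delta> = liftN ` \<Delta>'"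
    by (meson finite_subset_image)
  then show ?case using \<open>\<Delta> \<turnstile> p\<close> by (auto intro: derives.allNI)
next
  case (allSI \<Gamma> p)
  then obtain \<Delta> where "finite \<Delta>" "\<Delta> \<subseteq> liftS ` \<Gamma>" "\<Delta> \<turnstile> p" by blast
  then obtain \<Delta>' where "finite \<Delta>'" "\<Delta>' \<subseteq> \<Gamma>" "\<Delta> = liftS ` \<Delta>'"
    by (meson finite_subset_image)
  then show ?case using \<open>\<Delta> \<turnstile> p\<close> by (auto intro: derives.allSI)
next
  case (eqI \<Gamma> t)
  show ?case by (intro exI[of _ "{}"]) (auto intro: derives.eqI)
next
  case (eqE \<Gamma> s t p)
  then obtain \<Delta> \<Delta>' where "finite \<Delta>" "\<Delta> \<subseteq> \<Gamma>" "\<Delta> \<turnstile> Eq s t"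
    and "finite \<Delta>'" "\<Delta>' \<subseteq> \<Gamma>" "\<Delta>' \<turnstile> instN s p" by blast
  then show ?case
    by (intro exI[of _ "\<Delta> \<union> \<Delta>'"])
      (auto intro!: derives.eqE[of _ s t p] elim: derives_mono)
qed (metis derives.allNE derives.allSE)+

lemma substT_cong_closed: "closedT n t \<Longrightarrow> (\<And>i. i < n \<Longrightarrow> \<sigma> i = \<tau> i) \<Longrightarrow> substT \<sigma> t = substT \<tau> t"
  by (induction t) auto

lemma subst_cong_closed:
  "closedF n m p \<Longrightarrow> (\<And>i. i < n \<Longrightarrow> \<sigma> i = \<tau> i) \<Longrightarrow> (\<And>X. X < m \<Longrightarrow> \<rho> X = \<pi> X) \<Longrightarrow>
    subst \<sigma> \<rho> p = subst \<tau> \<pi> p"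
proof (induction p arbitrary: n m \<sigma> \<tau> \<rho> \<pi>)
  case (AllN p)
  have "subst (upN \<sigma>) \<rho> p = subst (upN \<tau>) \<pi> p"
    using AllN.prems by (intro AllN.IH[of "Suc n" m]) (auto split: nat.split)
  then show ?case by simp
next
  case (AllS p)
  have "subst \<sigma> (upS \<rho>) p = subst \<tau> (upS \<pi>) p"
    using AllS.prems by (intro AllS.IH[of n "Suc m"]) (auto split: nat.split)
  then show ?case by simp
next
  case (Imp p q)
  then show ?case using Imp.IH[of n m \<sigma> \<tau> \<rho> \<pi>] by simp
next
  case (Eq s t)
  then show ?case using substT_cong_closed[of n _ \<sigma> \<tau>] by simp
next
  case (Less s t)
  then show ?case using substT_cong_closed[of n _ \<sigma> \<tau>] by simp
next
  case (Mem t X)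
  then show ?case using substT_cong_closed[of n _ \<sigma> \<tau>] by simp
qed simp

lemma closedT_mono: "closedT n t \<Longrightarrow> n \<le> n' \<Longrightarrow> closedT n' t"
  by (induction t) auto

lemma closedF_mono: "closedF n m p \<Longrightarrow> n \<le> n' \<Longrightarrow> m \<le> m' \<Longrightarrow> closedF n' m' p"
proof (induction p arbitrary: n m n' m')
  case (AllN p)
  then show ?case using AllN.IH[of "Suc n" m "Suc n'" m'] by simp
next
  case (AllS p)
  then show ?case using AllS.IH[of n "Suc m" n' "Suc m'"] by simp
next
  case (Imp p q)
  then show ?case using Imp.IH[of n m n' m'] by simp
qed (auto dest: closedT_mono)

lemma ex_closedT: "\<exists>n. closedT n t"
proof (induction t)
  case (Var i) show ?case by (auto intro: exI[of _ "Suc i"])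
next
  case (Add s t)
  then obtain a b where "closedT a s" "closedT b t" by blast
  then show ?case by (auto intro!: exI[of _ "max a b"] elim: closedT_mono)
next
  case (Mul s t)
  then obtain a b where "closedT a s" "closedT b t" by blast
  then show ?case by (auto intro!: exI[of _ "max a b"] elim: closedT_mono)
next
  case (Exp s t)
  then obtain a b where "closedT a s" "closedT b t" by blast
  then show ?case by (auto intro!: exI[of _ "max a b"] elim: closedT_mono)
qed auto

lemma ex_closedF: "\<exists>n m. closedF n m p"
proof (induction p)
  case (Eq s t)
  obtain a b where "closedT a s" "closedT b t" using ex_closedT by blast
  then show ?case by (auto intro!: exI[of _ "max a b"] elim: closedT_mono)
next
  case (Less s t)
  obtain a b where "closedT a s" "closedT b t" using ex_closedT by blast
  then show ?case by (auto intro!: exI[of _ "max a b"] elim: closedT_mono)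
next
  case (Mem t X)
  obtain a where "closedT a t" using ex_closedT by blast
  then show ?case by (intro exI[of _ a] exI[of _ "Suc X"]) simp
next
  case (Imp p q)
  then obtain a b c d where "closedF a b p" "closedF c d q" by blast
  then show ?case by (intro exI[of _ "max a c"] exI[of _ "max b d"]) (auto elim!: closedF_mono)
next
  case (AllN p)
  then obtain a b where "closedF a b p" by blast
  then have "closedF (Suc a) b p" by (auto elim: closedF_mono)
  then show ?case by auto
next
  case (AllS p)
  then obtain a b where "closedF a b p" by blast
  then have "closedF a (Suc b) p" by (auto elim: closedF_mono)
  then show ?case by auto
qed auto

lemma ex_closedF_diag: "\<exists>b. closedF b b p"
proof -
  obtain n m where "closedF n m p" using ex_closedF by blast
  then show ?thesis by (auto intro!: exI[of _ "max n m"] elim: closedF_mono)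
qed

text \<open>Henkin's argument yields a proof about a fresh free variable, whereas
  \<open>allNI\<close> wants lifted hypotheses. The renaming that sends \<open>c\<close> to 0 and
  shifts everything else turns one into the other: below \<open>c\<close> it is the lift, and it
  undoes the instantiation by \<open>Var c\<close>.\<close>

lemma derives_AllN_fresh:
  assumes "\<forall>q \<in> \<Gamma>. closedF c c q" and p: "closedF (Suc c) c p" and d: "\<Gamma> \<turnstile> instN (Var c) p"
  shows "\<Gamma> \<turnstile> AllN p"
proof (rule allNI)
  define \<sigma> where "\<sigma> = (\<lambda>i. Var (if i = c then 0 else Suc i))"
  have "subst \<sigma> (\<lambda>X. X) q = liftN q" if "q \<in> \<Gamma>" for q
    unfolding liftN_def using assms(1) that by (intro subst_cong_closed[of c c]) (auto simp: \<sigma>_def)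
  then have "subst \<sigma> (\<lambda>X. X) ` \<Gamma> = liftN ` \<Gamma>" by (auto intro: image_cong)
  moreover have "subst \<sigma> (\<lambda>X. X) (instN (Var c) p) = subst Var (\<lambda>X. X) p"
    unfolding instN_def subst_subst
    using p by (intro subst_cong_closed[of "Suc c" c]) (auto simp: \<sigma>_def split: nat.split)
  ultimately show "liftN ` \<Gamma> \<turnstile> p"
    using derives_subst[OF d, of \<sigma> "\<lambda>X. X"] by simp
qed

lemma derives_AllS_fresh:
  assumes "\<forall>q \<in> \<Gamma>. closedF c c q" and p: "closedF c (Suc c) p" and d: "\<Gamma> \<turnstile> instS c p"
  shows "\<Gamma> \<turnstile> AllS p"
proof (rule allSI)
  define \<rho> where "\<rho> = (\<lambda>i. if i = c then 0 else Suc i)"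
  have "subst Var \<rho> q = liftS q" if "q \<in> \<Gamma>" for q
    unfolding liftS_def using assms(1) that by (intro subst_cong_closed[of c c]) (auto simp: \<rho>_def)
  then have "subst Var \<rho> ` \<Gamma> = liftS ` \<Gamma>" by (auto intro: image_cong)
  moreover have "subst Var \<rho> (instS c p) = subst Var (\<lambda>X. X) p"
    unfolding instS_def subst_subst
    using p by (intro subst_cong_closed[of c "Suc c"]) (auto simp: \<rho>_def split: nat.split)
  ultimately show "liftS ` \<Gamma> \<turnstile> p"
    using derives_subst[OF d, of Var \<rho>] by simp
qed

section \<open>Henkin sets\<close>

instance tm :: countable by countable_datatype
instance fm :: countable by countable_datatype

text \<open>Besides maximal consistency, the last two clauses provide witnesses: if a universal
  formula is missing from \<open>H\<close>, then so is one of its instances. Free variables take the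
  place of new constants.\<close>

definition henkin :: "fm set \<Rightarrow> bool" where
  "henkin H \<longleftrightarrow>
    \<not> H \<turnstile> Bot \<and> (\<forall>p. p \<in> H \<or> Neg p \<in> H) \<and>
    (\<forall>p. (\<forall>t. instN t p \<in> H) \<longrightarrow> AllN p \<in> H) \<and>
    (\<forall>p. (\<forall>X. instS X p \<in> H) \<longrightarrow> AllS p \<in> H)"

lemma derives_Neg_E: "\<Gamma> \<turnstile> Neg p \<Longrightarrow> \<Gamma> \<turnstile> p \<Longrightarrow> \<Gamma> \<turnstile> Bot"
  unfolding Neg_def by (rule impE)

lemma derives_cut: "insert p \<Gamma> \<turnstile> q \<Longrightarrow> \<Gamma> \<turnstile> p \<Longrightarrow> \<Gamma> \<turnstile> q"
  using impI impE by metis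

text \<open>One stage of the construction decides \<open>p\<close>, and on rejecting a universal
  \<open>p\<close> it also rejects an instance. The number \<open>b\<close> bounds all free
  variables of the stage, so that a fresh one is always left.\<close>

lemma henkin_step:
  assumes cons: "\<not> \<Gamma> \<turnstile> Bot" and bd: "\<forall>q \<in> \<Gamma>. closedF b b q"
  shows "\<exists>\<Delta> b'. \<Gamma> \<subseteq> \<Delta> \<and> \<not> \<Delta> \<turnstile> Bot \<and> (\<forall>q \<in> \<Delta>. closedF b' b' q) \<and> (p \<in> \<Delta> \<or> Neg p \<in> \<Delta>) \<and>
    (\<forall>q. p = AllN q \<longrightarrow> p \<in> \<Delta> \<or> (\<exists>t. Neg (instN t q) \<in> \<Delta>)) \<and>
    (\<forall>q. p = AllS q \<longrightarrow> p \<in> \<Delta> \<or> (\<exists>X. Neg (instS X q) \<in> \<Delta>))"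
proof (cases "insert p \<Gamma> \<turnstile> Bot")
  case False
  obtain b0 where "closedF b0 b0 p" using ex_closedF_diag by blast
  then have "\<forall>q \<in> insert p \<Gamma>. closedF (max b b0) (max b b0) q"
    using bd by (auto elim!: closedF_mono)
  with False show ?thesis by (intro exI[of _ "insert p \<Gamma>"]) blast
next
  case True
  then have neg: "\<Gamma> \<turnstile> Neg p" unfolding Neg_def by (rule impI)
  then have np: "\<not> \<Gamma> \<turnstile> p" using cons derives_Neg_E by blast
  obtain b0 where b0: "closedF b0 b0 p" using ex_closedF_diag by blast
  define c where "c = max b b0"
  have \<Gamma>c: "\<forall>q \<in> \<Gamma>. closedF c c q" using bd by (auto simp: c_def elim!: closedF_mono)
  have pc: "closedF c c p" using b0 by (auto simp: c_def elim!: closedF_mono)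
  \<comment> \<open>For a universal \<open>p\<close> this is its instance at the fresh variable
    \<open>c\<close>, otherwise \<open>p\<close> itself, so that all shapes of \<open>p\<close> are
    treated alike.\<close>
  define w where "w = (case p of AllN q \<Rightarrow> instN (Var c) q | AllS q \<Rightarrow> instS c q | _ \<Rightarrow> p)"
  have "\<not> \<Gamma> \<turnstile> w"
  proof
    assume w: "\<Gamma> \<turnstile> w"
    have "\<Gamma> \<turnstile> p"
    proof (cases p)
      case (AllN q)
      then show ?thesis
        using derives_AllN_fresh[OF \<Gamma>c, of q] pc w by (simp add: w_def)
    next
      case (AllS q)
      then show ?thesis
        using derives_AllS_fresh[OF \<Gamma>c, of q] pc w by (simp add: w_def)
    qed (use w in \<open>simp_all add: w_def\<close>)
    with np show False ..
  qed
  then have "\<not> insert (Neg w) \<Gamma> \<turnstile> Bot" using raa by blast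
  then have cons': "\<not> insert (Neg p) (insert (Neg w) \<Gamma>) \<turnstile> Bot"
    using neg derives_cut derives_mono[OF neg] by blast
  obtain b1 where b1: "closedF b1 b1 w" using ex_closedF_diag by blast
  have "\<forall>q \<in> insert (Neg p) (insert (Neg w) \<Gamma>). closedF (max c b1) (max c b1) q"
    using \<Gamma>c pc b1 by (auto simp: Neg_def elim!: closedF_mono)
  moreover have "\<forall>q. p = AllN q \<longrightarrow> (\<exists>t. Neg (instN t q) \<in> insert (Neg p) (insert (Neg w) \<Gamma>))"
    by (auto simp: w_def)
  moreover have "\<forall>q. p = AllS q \<longrightarrow> (\<exists>t. Neg (instS t q) \<in> insert (Neg p) (insert (Neg w) \<Gamma>))"
    by (auto simp: w_def)
  ultimately show ?thesis using cons'
    by (intro exI[of _ "insert (Neg p) (insert (Neg w) \<Gamma>)"]) blast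
qed

theorem ex_henkin:
  assumes cons: "\<not> \<Gamma> \<turnstile> Bot" and bd: "\<forall>q \<in> \<Gamma>. closedF b b q"
  shows "\<exists>H. henkin H \<and> \<Gamma> \<subseteq> H"
proof -
  define ok where "ok \<Delta> \<longleftrightarrow> \<Gamma> \<subseteq> \<Delta> \<and> \<not> \<Delta> \<turnstile> Bot \<and> (\<exists>b. \<forall>q \<in> \<Delta>. closedF b b q)" for \<Delta>
  define dec where "dec p \<Delta> \<longleftrightarrow> (p \<in> \<Delta> \<or> Neg p \<in> \<Delta>) \<and>
    (\<forall>q. p = AllN q \<longrightarrow> p \<in> \<Delta> \<or> (\<exists>t. Neg (instN t q) \<in> \<Delta>)) \<and>
    (\<forall>q. p = AllS q \<longrightarrow> p \<in> \<Delta> \<or> (\<exists>X. Neg (instS X q) \<in> \<Delta>))" for p \<Delta>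
  \<comment> \<open>Stage \<open>Suc n\<close> decides the formula with number \<open>n\<close>.
    Only free variables are bounded at a stage, so the stages may be infinite, as
    \<open>RCA0_star\<close> is.\<close>
  have "\<exists>G. \<forall>n. ok (G n) \<and> (G n \<subseteq> G (Suc n) \<and> dec (from_nat n) (G (Suc n)))"
  proof (rule dependent_nat_choice[where P = "\<lambda>_. ok" and
      Q = "\<lambda>n \<Delta> \<Delta>'. \<Delta> \<subseteq> \<Delta>' \<and> dec (from_nat n) \<Delta>'"])
    show "\<exists>\<Delta>. ok \<Delta>" using cons bd by (auto simp: ok_def)
    show "\<exists>\<Delta>'. ok \<Delta>' \<and> \<Delta> \<subseteq> \<Delta>' \<and> dec (from_nat n) \<Delta>'" if ok: "ok \<Delta>" for \<Delta> n
    proof -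
      obtain b where b: "\<not> \<Delta> \<turnstile> Bot" "\<forall>q \<in> \<Delta>. closedF b b q" "\<Gamma> \<subseteq> \<Delta>"
        using ok unfolding ok_def by blast
      obtain \<Delta>' b' where "\<Delta> \<subseteq> \<Delta>'" "\<not> \<Delta>' \<turnstile> Bot" "\<forall>q \<in> \<Delta>'. closedF b' b' q"
        "dec (from_nat n) \<Delta>'"
        using henkin_step[OF b(1,2), of "from_nat n"] unfolding dec_def by blast
      then show ?thesis using b(3) unfolding ok_def by blast
    qed
  qed
  then obtain G where G: "\<And>n. ok (G n)" "\<And>n. G n \<subseteq> G (Suc n)" "\<And>n. dec (from_nat n) (G (Suc n))"
    by blast
  define H where "H = (\<Union>n. G n)"
  have mono: "mono G" using G(2) by (simp add: mono_iff_le_Suc)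
  have con: "\<not> H \<turnstile> Bot"
  proof
    assume "H \<turnstile> Bot"
    then obtain \<Delta> where \<Delta>: "finite \<Delta>" "\<Delta> \<subseteq> H" "\<Delta> \<turnstile> Bot" using derives_finite by blast
    have "\<exists>n. \<Delta> \<subseteq> G n"
      using \<Delta>(1,2)
    proof (induction rule: finite_induct)
      case (insert p \<Delta>)
      then obtain n m where "\<Delta> \<subseteq> G n" "p \<in> G m" by (auto simp: H_def)
      then have "insert p \<Delta> \<subseteq> G (max n m)"
        using monoD[OF mono, of n "max n m"] monoD[OF mono, of m "max n m"] by auto
      then show ?case ..
    qed simp
    then show False using \<Delta>(3) G(1) derives_mono unfolding ok_def by blast
  qed
  have dec: "dec p H" for p
  proof -
    have "dec p (G (Suc (to_nat p)))" using G(3)[of "to_nat p"] by simp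
    moreover have "G (Suc (to_nat p)) \<subseteq> H" by (auto simp: H_def)
    ultimately show ?thesis unfolding dec_def by blast
  qed
  have excl: "Neg p \<in> H \<Longrightarrow> p \<in> H \<Longrightarrow> False" for p
    using con by (metis assm derives_Neg_E)
  have "\<forall>p. p \<in> H \<or> Neg p \<in> H" using dec by (auto simp: dec_def)
  moreover have "\<forall>p. (\<forall>t. instN t p \<in> H) \<longrightarrow> AllN p \<in> H"
    using dec excl unfolding dec_def by blast
  moreover have "\<forall>p. (\<forall>X. instS X p \<in> H) \<longrightarrow> AllS p \<in> H"
    using dec excl unfolding dec_def by blast
  ultimately have "henkin H" using con unfolding henkin_def by blast
  moreover have "\<Gamma> \<subseteq> H" using G(1) by (auto simp: H_def ok_def)
  ultimately show ?thesis by blast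
qed

lemma henkin_derives: "henkin H \<Longrightarrow> H \<turnstile> p \<longleftrightarrow> p \<in> H"
  unfolding henkin_def by (metis assm derives_Neg_E)

lemma henkin_Bot: "henkin H \<Longrightarrow> Bot \<notin> H"
  using henkin_def assm by metis

lemma henkin_Imp: "henkin H \<Longrightarrow> Imp p q \<in> H \<longleftrightarrow> (p \<in> H \<longrightarrow> q \<in> H)"
proof
  assume H: "henkin H"
  show "p \<in> H \<longrightarrow> q \<in> H" if "Imp p q \<in> H"
    using that H impE assm henkin_derives by blast
  assume r: "p \<in> H \<longrightarrow> q \<in> H"
  show "Imp p q \<in> H"
  proof (cases "p \<in> H")
    case True
    then have "insert p H \<turnstile> q" using r by (auto intro: assm)
    then show ?thesis using H henkin_derives impI by blast
  next
    case False
    then have "Neg p \<in> H" using H henkin_def by blast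
    then have "insert (Neg q) (insert p H) \<turnstile> Bot"
      by (metis assm derives_Neg_E insertCI)
    then show ?thesis using H by (metis henkin_derives impI raa)
  qed
qed

lemma henkin_AllN: "henkin H \<Longrightarrow> AllN p \<in> H \<longleftrightarrow> (\<forall>t. instN t p \<in> H)"
  by (metis allNE assm henkin_def henkin_derives)

lemma henkin_AllS: "henkin H \<Longrightarrow> AllS p \<in> H \<longleftrightarrow> (\<forall>X. instS X p \<in> H)"
  by (metis allSE assm henkin_def henkin_derives)

lemma henkin_eqE: "henkin H \<Longrightarrow> Eq s t \<in> H \<Longrightarrow> instN s p \<in> H \<Longrightarrow> instN t p \<in> H"
  by (metis eqE henkin_derives)

lemma henkin_refl: "henkin H \<Longrightarrow> Eq t t \<in> H"
  by (metis eqI henkin_derives)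

section \<open>Semantics\<close>

text \<open>A structure is a type rather than a record, so that arithmetic inside a model can
  inherit HOL's algebraic classes.\<close>

class l2 = plus + times + zero + one + ord +
  fixes expo :: "'a \<Rightarrow> 'a \<Rightarrow> 'a"  (infixr "\<up>" 80)
    and Sets :: "'a set set"
begin

primrec evalT :: "(nat \<Rightarrow> 'a) \<Rightarrow> tm \<Rightarrow> 'a" where
  "evalT e (Var i) = e i"
| "evalT e Zero = 0"
| "evalT e One = 1"
| "evalT e (Add s t) = evalT e s + evalT e t"
| "evalT e (Mul s t) = evalT e s * evalT e t"
| "evalT e (Exp s t) = evalT e s \<up> evalT e t"

primrec sat :: "(nat \<Rightarrow> 'a) \<Rightarrow> (nat \<Rightarrow> 'a set) \<Rightarrow> fm \<Rightarrow> bool" where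
  "sat e E (Eq s t) \<longleftrightarrow> evalT e s = evalT e t"
| "sat e E (Less s t) \<longleftrightarrow> evalT e s < evalT e t"
| "sat e E (Mem t X) \<longleftrightarrow> evalT e t \<in> E X"
| "sat e E Bot \<longleftrightarrow> False"
| "sat e E (Imp p q) \<longleftrightarrow> (sat e E p \<longrightarrow> sat e E q)"
| "sat e E (AllN p) \<longleftrightarrow> (\<forall>x. sat (case_nat x e) E p)"
| "sat e E (AllS p) \<longleftrightarrow> (\<forall>X \<in> Sets. sat e (case_nat X E) p)"

end

text \<open>A model of \<open>RCA\<^sup>*\<^sub>0\<close>. The order \<open>\<le>\<close> and truncated subtraction are definitional extensions,
  with \<open>x - y = 0\<close> for \<open>x < y\<close>.\<close>

class rca = l2 + minus +
  assumes sat_RCA: "p \<in> RCA0_star \<Longrightarrow> (\<forall>X. E X \<in> Sets) \<Longrightarrow> sat e E p"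
    and rca_le: "x \<le> y \<longleftrightarrow> x < y \<or> x = y"
    and rca_minus: "x - y = (if \<exists>z. x = y + z then THE z. x = y + z else 0)"
    and Sets_nonempty: "Sets \<noteq> {}"

lemma evalT_substT: "evalT e (substT \<sigma> t) = evalT (\<lambda>i. evalT e (\<sigma> i)) t"
  by (induction t) auto

lemma evalT_liftT [simp]: "evalT (case_nat x e) (liftT t) = evalT e t"
  by (simp add: liftT_def evalT_substT)

lemma sat_subst: "sat e E (subst \<sigma> \<rho> p) \<longleftrightarrow> sat (\<lambda>i. evalT e (\<sigma> i)) (\<lambda>X. E (\<rho> X)) p"
proof (induction p arbitrary: e E \<sigma> \<rho>)
  case (AllN p)
  have "(\<lambda>i. evalT (case_nat x e) (upN \<sigma> i)) = case_nat x (\<lambda>i. evalT e (\<sigma> i))" for x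
    by (auto simp: fun_eq_iff split: nat.split)
  then show ?case by (simp add: AllN)
next
  case (AllS p)
  have "(\<lambda>i. case_nat Y E (upS \<rho> i)) = case_nat Y (\<lambda>i. E (\<rho> i))" for Y
    by (auto simp: fun_eq_iff split: nat.split)
  then show ?case by (simp add: AllS)
qed (simp_all add: evalT_substT)

lemma sat_liftN: "sat e E (liftN p) \<longleftrightarrow> sat (\<lambda>i. e (Suc i)) E p"
  by (simp add: liftN_def sat_subst)

lemma sat_liftS: "sat e E (liftS p) \<longleftrightarrow> sat e (\<lambda>X. E (Suc X)) p"
  by (simp add: liftS_def sat_subst)

lemma sat_instN: "sat e E (instN t p) \<longleftrightarrow> sat (case_nat (evalT e t) e) E p"
proof -
  have "(\<lambda>i. evalT e (case_nat t Var i)) = case_nat (evalT e t) e"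
    by (auto simp: fun_eq_iff split: nat.split)
  then show ?thesis by (simp add: instN_def sat_subst)
qed

lemma sat_instS: "sat e E (instS X p) \<longleftrightarrow> sat e (case_nat (E X) E) p"
proof -
  have "(\<lambda>i. E (case_nat X (\<lambda>Y. Y) i)) = case_nat (E X) E"
    by (auto simp: fun_eq_iff split: nat.split)
  then show ?thesis by (simp add: instS_def sat_subst)
qed

lemma sat_connectives [simp]:
  "sat e E (Neg p) \<longleftrightarrow> \<not> sat e E p"
  "sat e E (And p q) \<longleftrightarrow> sat e E p \<and> sat e E q"
  "sat e E (Or p q) \<longleftrightarrow> sat e E p \<or> sat e E q"
  "sat e E (Iff p q) \<longleftrightarrow> (sat e E p \<longleftrightarrow> sat e E q)"
  "sat e E (ExN p) \<longleftrightarrow> (\<exists>x. sat (case_nat x e) E p)"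
  "sat e E (ExS p) \<longleftrightarrow> (\<exists>X \<in> Sets. sat e (case_nat X E) p)"
  by (auto simp: Neg_def And_def Or_def Iff_def ExN_def ExS_def)

theorem soundness:
  fixes e :: "nat \<Rightarrow> 'a::l2"
  shows "\<Gamma> \<turnstile> p \<Longrightarrow> (\<forall>X. E X \<in> Sets) \<Longrightarrow> (\<forall>q \<in> \<Gamma>. sat e E q) \<Longrightarrow> sat e E p"
proof (induction arbitrary: e E rule: derives.induct)
  case (raa p \<Gamma>)
  then show ?case by (metis insert_iff sat.simps(4) sat_connectives(1))
next
  case (allNI \<Gamma> p)
  then show ?case by (simp add: sat_liftN)
next
  case (allSI \<Gamma> p)
  have "sat e (case_nat X E) p" if "X \<in> Sets" for X
    using allSI.prems that by (intro allSI.IH) (auto simp: sat_liftS split: nat.split)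
  then show ?case by simp
next
  case (eqE \<Gamma> s t p)
  then show ?case by (metis sat.simps(1) sat_instN)
qed (auto simp: sat_instN sat_instS)

definition valid :: "'a::l2 itself \<Rightarrow> fm \<Rightarrow> bool" where
  "valid _ p \<longleftrightarrow> (\<forall>(e :: nat \<Rightarrow> 'a) E. (\<forall>X. E X \<in> Sets) \<longrightarrow> sat e E p)"

lemma valid_AllN: "valid TYPE('a::l2) (AllN p) \<longleftrightarrow> valid TYPE('a) p"
proof
  assume a: "valid TYPE('a) (AllN p)"
  show "valid TYPE('a) p"
    unfolding valid_def
  proof (intro allI HOL.impI)
    fix e :: "nat \<Rightarrow> 'a" and E :: "nat \<Rightarrow> 'a set"
    assume "\<forall>X. E X \<in> Sets"
    then have "sat (case_nat (e 0) (\<lambda>i. e (Suc i))) E p" using a by (simp add: valid_def)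
    moreover have "case_nat (e 0) (\<lambda>i. e (Suc i)) = e" by (auto simp: fun_eq_iff split: nat.split)
    ultimately show "sat e E p" by simp
  qed
qed (simp add: valid_def)

lemma valid_AllS: "valid TYPE('a::l2) (AllS p) \<longleftrightarrow> valid TYPE('a) p"
proof
  assume a: "valid TYPE('a) (AllS p)"
  show "valid TYPE('a) p"
    unfolding valid_def
  proof (intro allI HOL.impI)
    fix e :: "nat \<Rightarrow> 'a" and E :: "nat \<Rightarrow> 'a set"
    assume "\<forall>X. E X \<in> Sets"
    then have "sat e (case_nat (E 0) (\<lambda>i. E (Suc i))) p" using a by (simp add: valid_def)
    moreover have "case_nat (E 0) (\<lambda>i. E (Suc i)) = E" by (auto simp: fun_eq_iff split: nat.split)
    ultimately show "sat e E p" by simp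
  qed
next
  assume "valid TYPE('a) p"
  then show "valid TYPE('a) (AllS p)" by (auto simp: valid_def split: nat.split)
qed

text \<open>Universal prefixes do not affect truth under all assignments, so the schemes of
  \<open>RCA0_star\<close> can be checked and used in open form.\<close>

lemma valid_closures: "q \<in> closures p \<Longrightarrow> valid TYPE('a::l2) q \<longleftrightarrow> valid TYPE('a) p"
proof -
  have "valid TYPE('a) ((AllN ^^ n) r) \<longleftrightarrow> valid TYPE('a) r" for n r
    by (induction n) (auto simp: valid_AllN)
  moreover have "valid TYPE('a) ((AllS ^^ n) r) \<longleftrightarrow> valid TYPE('a) r" for n r
    by (induction n) (auto simp: valid_AllS)
  ultimately show "q \<in> closures p \<Longrightarrow> ?thesis" by (auto simp: closures_def)
qed

lemma closures_nonempty: "\<exists>q. q \<in> closures p"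
  using ex_closedF by (force simp: closures_def)

lemma sat_induction_fm:
  "sat e E (induction_fm p) \<longleftrightarrow>
    (sat (case_nat 0 e) E p \<longrightarrow>
     (\<forall>x. sat (case_nat x e) E p \<longrightarrow> sat (case_nat (x + 1) e) E p) \<longrightarrow>
     (\<forall>x. sat (case_nat x e) E p))"
proof -
  have "(\<lambda>i. evalT (case_nat x e) (case_nat (Add (Var 0) One) (\<lambda>i. Var (Suc i)) i)) = case_nat (x + 1) e"
    for x by (auto simp: fun_eq_iff split: nat.split)
  then show ?thesis by (auto simp: induction_fm_def sat_instN sat_subst)
qed

lemma sat_comprehension_fm:
  "sat e E (comprehension_fm p q) \<longleftrightarrow>
    ((\<forall>x. sat (case_nat x e) E p \<longleftrightarrow> sat (case_nat x e) E q) \<longrightarrow>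
     (\<exists>X \<in> Sets. \<forall>x. x \<in> X \<longleftrightarrow> sat (case_nat x e) E p))"
  by (simp add: comprehension_fm_def sat_liftS)

section \<open>The standard model\<close>

instantiation nat :: l2
begin
definition expo_nat :: "nat \<Rightarrow> nat \<Rightarrow> nat" where "expo_nat m n = m ^ n"
definition Sets_nat :: "nat set set" where "Sets_nat = UNIV"
instance ..
end

lemmas named_defs = sentence_def nZero_def nOne_def nAdd_def nMul_def nPow_def fEq_def fLess_def
  fMem_def fBot_def fNeg_def fAnd_def fOr_def fImp_def fIff_def fAllN_def fExN_def fAllS_def fExS_def

lemma sat_basic_axioms_nat: "p \<in> sentence ` basic_axioms \<Longrightarrow> sat (e :: nat \<Rightarrow> nat) E p"
  by (auto simp: basic_axioms_def named_defs expo_nat_def)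

lemma valid_RCA0_star_nat: "p \<in> RCA0_star \<Longrightarrow> valid TYPE(nat) p"
proof -
  have ind: "P x" if "P 0" "\<forall>x. P x \<longrightarrow> P (x + 1)" for P and x :: nat
    using that by (induction x) auto
  have "valid TYPE(nat) (induction_fm p)" for p
    unfolding valid_def sat_induction_fm
    by (intro allI HOL.impI) (rule ind[of "\<lambda>x. sat (case_nat x _) _ p"])
  moreover have "valid TYPE(nat) (comprehension_fm p q)" for p q
    unfolding valid_def sat_comprehension_fm Sets_nat_def
    by (intro allI HOL.impI bexI[of _ "Collect _"]) auto
  moreover have "p \<in> sentence ` basic_axioms \<Longrightarrow> valid TYPE(nat) p"
    unfolding valid_def using sat_basic_axioms_nat by blast
  moreover assume "p \<in> RCA0_star"
  ultimately show ?thesis unfolding RCA0_star_def by (auto simp: valid_closures)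
qed

text \<open>The type \<open>term_model\<close> has to be a model even if every goal is derivable. In
  that case consistency supplies the Henkin set.\<close>

lemma consistent_RCA0_star: "\<not> RCA0_star \<turnstile> Bot"
  using soundness[of RCA0_star Bot "\<lambda>_. UNIV" "\<lambda>_. 0 :: nat"] valid_RCA0_star_nat
  by (auto simp: Sets_nat_def valid_def)

lemma closedF_funpow:
  "closedF n m ((AllN ^^ k) p) \<longleftrightarrow> closedF (n + k) m p"
  "closedF n m ((AllS ^^ k) p) \<longleftrightarrow> closedF n (m + k) p"
  by (induction k arbitrary: n m) auto

lemma closedF_closures: "q \<in> closures p \<Longrightarrow> closedF 0 0 q"
  by (auto simp: closures_def closedF_funpow)

lemma closedF_basic_axioms: "p \<in> sentence ` basic_axioms \<Longrightarrow> closedF 0 0 p"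
  by (auto simp: basic_axioms_def named_defs Neg_def And_def Or_def Iff_def)

lemma closedF_RCA0_star: "p \<in> RCA0_star \<Longrightarrow> closedF 0 0 p"
  by (auto simp: RCA0_star_def closedF_closures closedF_basic_axioms)

section \<open>The term model\<close>

text \<open>A type cannot depend on an underivable sentence, so one term model is fixed for all goals: it
  refutes some goal, provided that some goal is underivable.\<close>

definition goals :: "fm set" where
  "goals = (\<Union>h k. {Imp (sentence (Tot h)) (sentence (WPH h k \<^bold>\<longleftrightarrow> HCT h k)),
    Imp (sentence (Tot h)) (sentence (HCT h k \<^bold>\<longleftrightarrow> TT h k)),
    Imp (sentence (Tot h)) (sentence (WPH h k \<^bold>\<longleftrightarrow> TT h k))})"

definition H0 :: "fm set" where
  "H0 = (SOME H. henkin H \<and> RCA0_star \<subseteq> H \<and>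
    ((\<exists>p \<in> goals. \<not> RCA0_star \<turnstile> p) \<longrightarrow> (\<exists>p \<in> goals. Neg p \<in> H)))"

lemma H0: "henkin H0" "RCA0_star \<subseteq> H0"
  and H0_goals: "p \<in> goals \<Longrightarrow> \<not> RCA0_star \<turnstile> p \<Longrightarrow> \<exists>q \<in> goals. Neg q \<in> H0"
proof -
  have "\<exists>H. henkin H \<and> RCA0_star \<subseteq> H \<and>
    ((\<exists>p \<in> goals. \<not> RCA0_star \<turnstile> p) \<longrightarrow> (\<exists>p \<in> goals. Neg p \<in> H))"
  proof (cases "\<exists>p \<in> goals. \<not> RCA0_star \<turnstile> p")
    case True
    then obtain p where p: "p \<in> goals" "\<not> RCA0_star \<turnstile> p" by blast
    obtain b where b: "closedF b b (Neg p)" using ex_closedF_diag by blast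
    have "\<forall>q \<in> insert (Neg p) RCA0_star. closedF b b q"
      using b closedF_mono[OF closedF_RCA0_star] by auto
    moreover have "\<not> insert (Neg p) RCA0_star \<turnstile> Bot" using p raa by metis
    ultimately obtain H where "henkin H" "insert (Neg p) RCA0_star \<subseteq> H" using ex_henkin by metis
    then show ?thesis using p(1) by (intro exI[of _ H]) auto
  next
    case False
    obtain H where "henkin H" "RCA0_star \<subseteq> H"
      using ex_henkin[OF consistent_RCA0_star, of 0] closedF_RCA0_star by metis
    then show ?thesis using False by (intro exI[of _ H]) auto
  qed
  from someI_ex[OF this] have *: "henkin H0 \<and> RCA0_star \<subseteq> H0 \<and>
    ((\<exists>p \<in> goals. \<not> RCA0_star \<turnstile> p) \<longrightarrow> (\<exists>p \<in> goals. Neg p \<in> H0))"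
    unfolding H0_def[symmetric] .
  then show "henkin H0" "RCA0_star \<subseteq> H0" by simp_all
  show "p \<in> goals \<Longrightarrow> \<not> RCA0_star \<turnstile> p \<Longrightarrow> \<exists>q \<in> goals. Neg q \<in> H0"
    using * by metis
qed

definition eqH :: "tm \<Rightarrow> tm \<Rightarrow> bool" where "eqH s t \<longleftrightarrow> Eq s t \<in> H0"

lemma instN_simps [simp]:
  "instN s (Eq (Var 0) (liftT t)) = Eq s t"
  "instN s (Less (Var 0) (liftT t)) = Less s t"
  "instN s (Less (liftT t) (Var 0)) = Less t s"
  "instN s (Mem (Var 0) X) = Mem s X"
  by (auto simp: instN_def liftT_def substT_substT)

lemma eqH_refl: "eqH t t"
  unfolding eqH_def by (rule henkin_refl[OF H0(1)])

lemma eqH_sym: "eqH s t \<Longrightarrow> eqH t s"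
  using henkin_eqE[OF H0(1), of s t "Eq (Var 0) (liftT s)"] eqH_refl by (simp add: eqH_def)

lemma eqH_trans: "eqH s t \<Longrightarrow> eqH t u \<Longrightarrow> eqH s u"
  using henkin_eqE[OF H0(1), of t s "Eq (Var 0) (liftT u)"] eqH_sym by (simp add: eqH_def)

text \<open>Leibniz' rule \<open>eqE\<close> for the formula u(s) = u(x), which holds at x = s by
  reflexivity.\<close>

lemma eqH_substT: "eqH s t \<Longrightarrow> eqH (substT (case_nat s Var) u) (substT (case_nat t Var) u)"
proof -
  let ?p = "Eq (liftT (substT (case_nat s Var) u)) u"
  have i: "instN r ?p = Eq (substT (case_nat s Var) u) (substT (case_nat r Var) u)" for r
    by (simp add: instN_def liftT_def substT_substT)
  assume "eqH s t"
  then show ?thesis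
    using henkin_eqE[OF H0(1), of s t ?p] eqH_refl unfolding i eqH_def by blast
qed

lemma eqH_cong:
  assumes "eqH s s'" "eqH t t'"
  shows "eqH (Add s t) (Add s' t')" "eqH (Mul s t) (Mul s' t')" "eqH (Exp s t) (Exp s' t')"
proof -
  have l: "substT (case_nat r Var) (liftT q) = q" for r q by (simp add: liftT_def substT_substT)
  show "eqH (Add s t) (Add s' t')"
    using eqH_substT[OF assms(1), of "Add (Var 0) (liftT t)"]
      eqH_substT[OF assms(2), of "Add (liftT s') (Var 0)"] eqH_trans by (fastforce simp: l)
  show "eqH (Mul s t) (Mul s' t')"
    using eqH_substT[OF assms(1), of "Mul (Var 0) (liftT t)"]
      eqH_substT[OF assms(2), of "Mul (liftT s') (Var 0)"] eqH_trans by (fastforce simp: l)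
  show "eqH (Exp s t) (Exp s' t')"
    using eqH_substT[OF assms(1), of "Exp (Var 0) (liftT t)"]
      eqH_substT[OF assms(2), of "Exp (liftT s') (Var 0)"] eqH_trans by (fastforce simp: l)
qed

lemma Less_eqH: "eqH s s' \<Longrightarrow> eqH t t' \<Longrightarrow> Less s t \<in> H0 \<Longrightarrow> Less s' t' \<in> H0"
  using henkin_eqE[OF H0(1), of s s' "Less (Var 0) (liftT t)"]
    henkin_eqE[OF H0(1), of t t' "Less (liftT s') (Var 0)"] by (simp add: eqH_def)

lemma Mem_eqH: "eqH s s' \<Longrightarrow> Mem s X \<in> H0 \<Longrightarrow> Mem s' X \<in> H0"
  using henkin_eqE[OF H0(1), of s s' "Mem (Var 0) X"] by (simp add: eqH_def)

quotient_type term_model = tm / eqH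
proof (rule equivpI)
  show "reflp eqH" by (auto intro: reflpI eqH_refl)
  show "symp eqH" by (auto intro: sympI eqH_sym)
  show "transp eqH" by (auto intro: transpI eqH_trans)
qed

lift_definition memM :: "nat \<Rightarrow> term_model \<Rightarrow> bool" is "\<lambda>X t. Mem t X \<in> H0"
  using Mem_eqH eqH_sym by blast

instantiation term_model :: "{l2, minus}"
begin
lift_definition zero_term_model :: term_model is Zero .
lift_definition one_term_model :: term_model is One .
lift_definition plus_term_model :: "term_model \<Rightarrow> term_model \<Rightarrow> term_model" is Add
  by (rule eqH_cong)
lift_definition times_term_model :: "term_model \<Rightarrow> term_model \<Rightarrow> term_model" is Mul
  by (rule eqH_cong)
lift_definition expo_term_model :: "term_model \<Rightarrow> term_model \<Rightarrow> term_model" is Exp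
  by (rule eqH_cong)
lift_definition less_term_model :: "term_model \<Rightarrow> term_model \<Rightarrow> bool" is "\<lambda>s t. Less s t \<in> H0"
  using Less_eqH eqH_sym by blast
definition less_eq_term_model :: "term_model \<Rightarrow> term_model \<Rightarrow> bool" where
  "less_eq_term_model x y \<longleftrightarrow> x < y \<or> x = y"
definition minus_term_model :: "term_model \<Rightarrow> term_model \<Rightarrow> term_model" where
  "minus_term_model x y = (if \<exists>z. x = y + z then THE z. x = y + z else 0)"
definition Sets_term_model :: "term_model set set" where
  "Sets_term_model = range (\<lambda>X. Collect (memM X))"
instance ..
end

lemma abs_term_model_surj: "\<exists>t. x = abs_term_model t"
  by (induction x rule: term_model.abs_induct) blast

lemma evalT_term_model: "evalT (\<lambda>i. abs_term_model (\<sigma> i)) t = abs_term_model (substT \<sigma> t)"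
  by (induction t) (auto simp: zero_term_model.abs_eq one_term_model.abs_eq plus_term_model.abs_eq
      times_term_model.abs_eq expo_term_model.abs_eq)

text \<open>The truth lemma. Every element is the class of a term and every set is named by a set
  variable, so an assignment amounts to a pair of substitutions.\<close>

lemma sat_term_model:
  "sat (\<lambda>i. abs_term_model (\<sigma> i)) (\<lambda>X. Collect (memM (\<rho> X))) p \<longleftrightarrow> subst \<sigma> \<rho> p \<in> H0"
proof (induction p arbitrary: \<sigma> \<rho>)
  case (Eq s t)
  then show ?case by (simp add: evalT_term_model term_model.abs_eq_iff eqH_def)
next
  case (AllN p)
  have "case_nat (abs_term_model t) (\<lambda>i. abs_term_model (\<sigma> i)) =
      (\<lambda>i. abs_term_model (case_nat t \<sigma> i))" for t
    by (auto simp: fun_eq_iff split: nat.split)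
  then have "sat (\<lambda>i. abs_term_model (\<sigma> i)) (\<lambda>X. Collect (memM (\<rho> X))) (AllN p) \<longleftrightarrow>
      (\<forall>t. subst (case_nat t \<sigma>) \<rho> p \<in> H0)"
    using AllN by simp (metis abs_term_model_surj)
  then show ?case by (simp add: henkin_AllN[OF H0(1)] instN_upN)
next
  case (AllS p)
  have "case_nat (Collect (memM Y)) (\<lambda>i. Collect (memM (\<rho> i))) =
      (\<lambda>i. Collect (memM (case_nat Y \<rho> i)))" for Y
    by (auto simp: fun_eq_iff split: nat.split)
  then show ?case using AllS by (simp add: henkin_AllS[OF H0(1)] instS_upS Sets_term_model_def)
qed (simp_all add: evalT_term_model henkin_Bot[OF H0(1)] henkin_Imp[OF H0(1)]
    less_term_model.abs_eq memM.abs_eq)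

lemma sat_term_model':
  assumes "\<forall>X. E X \<in> (Sets :: term_model set set)"
  shows "\<exists>\<sigma> \<rho>. sat e E p \<longleftrightarrow> subst \<sigma> \<rho> p \<in> H0"
proof -
  obtain \<sigma> where "e = (\<lambda>i. abs_term_model (\<sigma> i))"
    using choice[of "\<lambda>i t. e i = abs_term_model t"] abs_term_model_surj by blast
  moreover have "\<forall>X. \<exists>Y. E X = Collect (memM Y)" using assms by (auto simp: Sets_term_model_def)
  then obtain \<rho> where "E = (\<lambda>X. Collect (memM (\<rho> X)))"
    using choice[of "\<lambda>X Y. E X = Collect (memM Y)"] by blast
  ultimately show ?thesis using sat_term_model by blast
qed

instance term_model :: rca
proof
  fix p and e :: "nat \<Rightarrow> term_model" and E :: "nat \<Rightarrow> term_model set"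
  assume p: "p \<in> RCA0_star" and E: "\<forall>X. E X \<in> Sets"
  obtain \<sigma> \<rho> where "sat e E p \<longleftrightarrow> subst \<sigma> \<rho> p \<in> H0" using sat_term_model'[OF E] by blast
  moreover have "subst \<sigma> \<rho> p = subst Var (\<lambda>X. X) p"
    by (rule subst_cong_closed[OF closedF_RCA0_star[OF p]]) auto
  ultimately show "sat e E p" using p H0(2) by auto
qed (auto simp: less_eq_term_model_def minus_term_model_def Sets_term_model_def)

text \<open>Underivability of \<open>p\<close> puts the negation of some goal, possibly another one,
  into \<open>H0\<close>; this is why truth is demanded of all goals at once.\<close>

theorem goals_derivable:
  assumes "\<And>q e E. q \<in> goals \<Longrightarrow> (\<forall>X. E X \<in> Sets) \<Longrightarrow> sat (e :: nat \<Rightarrow> term_model) E q"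
    and "p \<in> goals"
  shows "RCA0_star \<turnstile> p"
proof (rule ccontr)
  assume "\<not> RCA0_star \<turnstile> p"
  then obtain q where q: "q \<in> goals" "Neg q \<in> H0" using H0_goals assms(2) by blast
  have "sat (\<lambda>i. abs_term_model (Var i)) (\<lambda>X. Collect (memM X)) (Neg q)"
    using q(2) by (subst sat_term_model) simp
  then show False using assms(1)[OF q(1)] by (auto simp: Sets_term_model_def)
qed

section \<open>Definability by bounded formulas\<close>

text \<open>A predicate on environments is \<open>dpred\<close> if it is defined by a bounded formula with parameters from the
  model. Stating closure properties for predicates instead of formulas lets HOL's binders do the
  bookkeeping of variables.\<close>

inductive dterm :: "((nat \<Rightarrow> 'a::rca) \<Rightarrow> 'a) \<Rightarrow> bool" where
  dterm_var: "dterm (\<lambda>e. e i)"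
| dterm_const: "dterm (\<lambda>e. a)"
| dterm_add: "dterm s \<Longrightarrow> dterm t \<Longrightarrow> dterm (\<lambda>e. s e + t e)"
| dterm_mult: "dterm s \<Longrightarrow> dterm t \<Longrightarrow> dterm (\<lambda>e. s e * t e)"
| dterm_expo: "dterm s \<Longrightarrow> dterm t \<Longrightarrow> dterm (\<lambda>e. s e \<up> t e)"

inductive dpred :: "((nat \<Rightarrow> 'a::rca) \<Rightarrow> bool) \<Rightarrow> bool" where
  dpred_eq: "dterm s \<Longrightarrow> dterm t \<Longrightarrow> dpred (\<lambda>e. s e = t e)"
| dpred_less: "dterm s \<Longrightarrow> dterm t \<Longrightarrow> dpred (\<lambda>e. s e < t e)"
| dpred_mem: "dterm t \<Longrightarrow> X \<in> Sets \<Longrightarrow> dpred (\<lambda>e. t e \<in> X)"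
| dpred_False: "dpred (\<lambda>e. False)"
| dpred_imp: "dpred P \<Longrightarrow> dpred Q \<Longrightarrow> dpred (\<lambda>e. P e \<longrightarrow> Q e)"
| dpred_all_less: "dterm t \<Longrightarrow> dpred (\<lambda>e. P (e 0) (\<lambda>i. e (Suc i))) \<Longrightarrow>
    dpred (\<lambda>e. \<forall>x. x < t e \<longrightarrow> P x e)"

lemma dterm_subst:
  "dterm t \<Longrightarrow> (\<And>i. dterm (\<sigma> i)) \<Longrightarrow> dterm (\<lambda>e. t (\<lambda>i. \<sigma> i e))"
  by (induction rule: dterm.induct) (auto intro: dterm.intros)

lemma dpred_subst:
  "dpred P \<Longrightarrow> (\<And>i. dterm (\<sigma> i)) \<Longrightarrow> dpred (\<lambda>e. P (\<lambda>i. \<sigma> i e))"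
proof (induction arbitrary: \<sigma> rule: dpred.induct)
  case (dpred_all_less t P)
  \<comment> \<open>The bounded quantifier adds an entry 0 to the environment; the shifted
    substitution leaves it fixed.\<close>
  define \<tau> where "\<tau> = case_nat (\<lambda>e. e 0) (\<lambda>i e. \<sigma> i (\<lambda>j. e (Suc j)))"
  have "dterm (\<lambda>e. \<sigma> i (\<lambda>j. e (Suc j)))" for i
    using dterm_subst[OF dpred_all_less.prems(1)[of i], of "\<lambda>j e. e (Suc j)"] dterm_var by blast
  then have "dterm (\<tau> i)" for i
    unfolding \<tau>_def using dterm_var[of 0] by (cases i) simp_all
  then have "dpred (\<lambda>e. P (\<tau> 0 e) (\<lambda>i. \<tau> (Suc i) e))" by (rule dpred_all_less.IH[of \<tau>])
  then have "dpred (\<lambda>e. P (e 0) (\<lambda>i. \<sigma> i (\<lambda>j. e (Suc j))))" by (simp add: \<tau>_def)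
  then show ?case
    using dpred.dpred_all_less[OF dterm_subst[OF dpred_all_less.hyps(1) dpred_all_less.prems],
        of "\<lambda>x e. P x (\<lambda>i. \<sigma> i e)" "\<lambda>i. i"] by simp
next
  case (dpred_eq s t)
  then show ?case using dterm_subst[of s \<sigma>] dterm_subst[of t \<sigma>] dpred.dpred_eq by simp
next
  case (dpred_less s t)
  then show ?case using dterm_subst[of s \<sigma>] dterm_subst[of t \<sigma>] dpred.dpred_less by simp
next
  case (dpred_mem t X)
  then show ?case using dterm_subst[of t \<sigma>] dpred.dpred_mem by simp
next
  case dpred_False
  show ?case by (rule dpred.dpred_False)
next
  case (dpred_imp P Q)
  show ?case
    using dpred.dpred_imp[OF dpred_imp.IH(1)[OF dpred_imp.prems] dpred_imp.IH(2)[OF dpred_imp.prems]]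
    by simp
qed

lemma delta00_subst: "delta00 p \<Longrightarrow> delta00 (subst \<sigma> \<rho> p)"
proof (induction arbitrary: \<sigma> \<rho> rule: delta00.induct)
  case (6 p t)
  have "substT (upN \<sigma>) (liftT t) = liftT (substT \<sigma> t)"
    by (simp add: liftT_def substT_substT)
  with 6 show ?case by (simp add: delta00.intros(6))
qed (simp_all add: delta00.intros)

text \<open>Variables of a formula stand either for parameters or for entries of the environment.\<close>

definition dec :: "(nat \<Rightarrow> 'a + nat) \<Rightarrow> (nat \<Rightarrow> 'a) \<Rightarrow> nat \<Rightarrow> 'a" where
  "dec v e i = (case v i of Inl a \<Rightarrow> a | Inr j \<Rightarrow> e j)"

text \<open>Keeps the variables of two formulas apart under a single assignment: one formula moves
  to the even indices, the other to the odd ones.\<close>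

definition interleave :: "(nat \<Rightarrow> 'b) \<Rightarrow> (nat \<Rightarrow> 'b) \<Rightarrow> nat \<Rightarrow> 'b" where
  "interleave f g i = (if even i then f (i div 2) else g (i div 2))"

lemma interleave_simps [simp]: "interleave f g (2 * i) = f i" "interleave f g (Suc (2 * i)) = g i"
  by (simp_all add: interleave_def)

lemma dec_interleave [simp]:
  "(\<lambda>i. dec (interleave v w) e (2 * i)) = dec v e"
  "(\<lambda>i. dec (interleave v w) e (Suc (2 * i))) = dec w e"
  by (simp_all add: dec_def fun_eq_iff)

lemma dterm_rep:
  fixes t :: "(nat \<Rightarrow> 'a::rca) \<Rightarrow> 'a"
  shows "dterm t \<Longrightarrow> \<exists>u v. \<forall>e. t e = evalT (dec v e) u"
proof (induction rule: dterm.induct)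
  case (dterm_var i)
  show ?case by (intro exI[of _ "Var 0"] exI[of _ "\<lambda>_. Inr i"]) (simp add: dec_def)
next
  case (dterm_const a)
  show ?case by (intro exI[of _ "Var 0"] exI[of _ "\<lambda>_. Inl a"]) (simp add: dec_def)
next
  case (dterm_add s t)
  then obtain u v u' v' where "\<And>e. s e = evalT (dec v e) u" "\<And>e. t e = evalT (dec v' e) u'" by auto
  then show ?case
    by (intro exI[of _ "Add (substT (\<lambda>i. Var (2 * i)) u) (substT (\<lambda>i. Var (Suc (2 * i))) u')"]
        exI[of _ "interleave v v'"]) (simp add: evalT_substT)
next
  case (dterm_mult s t)
  then obtain u v u' v' where "\<And>e. s e = evalT (dec v e) u" "\<And>e. t e = evalT (dec v' e) u'" by auto
  then show ?case
    by (intro exI[of _ "Mul (substT (\<lambda>i. Var (2 * i)) u) (substT (\<lambda>i. Var (Suc (2 * i))) u')"]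
        exI[of _ "interleave v v'"]) (simp add: evalT_substT)
next
  case (dterm_expo s t)
  then obtain u v u' v' where "\<And>e. s e = evalT (dec v e) u" "\<And>e. t e = evalT (dec v' e) u'" by auto
  then show ?case
    by (intro exI[of _ "Exp (substT (\<lambda>i. Var (2 * i)) u) (substT (\<lambda>i. Var (Suc (2 * i))) u')"]
        exI[of _ "interleave v v'"]) (simp add: evalT_substT)
qed

lemma dterm_rep2:
  assumes "dterm s" "dterm t"
  shows "\<exists>u u' v. \<forall>e. s e = evalT (dec v e) u \<and> t e = evalT (dec v e) u'"
proof -
  obtain u v u' v' where "\<And>e. s e = evalT (dec v e) u" "\<And>e. t e = evalT (dec v' e) u'"
    using assms dterm_rep by metis
  then show ?thesis
    by (intro exI[of _ "substT (\<lambda>i. Var (2 * i)) u"] exI[of _ "substT (\<lambda>i. Var (Suc (2 * i))) u'"]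
        exI[of _ "interleave v v'"]) (simp add: evalT_substT)
qed

definition represents :: "((nat \<Rightarrow> 'a::rca) \<Rightarrow> bool) \<Rightarrow> fm \<Rightarrow> (nat \<Rightarrow> 'a + nat) \<Rightarrow> (nat \<Rightarrow> 'a set) \<Rightarrow> bool" where
  "represents P p v E \<longleftrightarrow> delta00 p \<and> (\<forall>X. E X \<in> Sets) \<and> (\<forall>e. P e \<longleftrightarrow> sat (dec v e) E p)"

lemma represents_join:
  assumes "represents P p v E" "represents Q q w F"
  shows "\<exists>p' q' u G. represents P p' u G \<and> represents Q q' u G"
proof (intro exI conjI)
  show "represents P (subst (\<lambda>i. Var (2 * i)) (\<lambda>i. 2 * i) p) (interleave v w) (interleave E F)"
    using assms by (simp add: represents_def sat_subst delta00_subst) (simp add: interleave_def)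
  show "represents Q (subst (\<lambda>i. Var (Suc (2 * i))) (\<lambda>i. Suc (2 * i)) q) (interleave v w) (interleave E F)"
    using assms by (simp add: represents_def sat_subst delta00_subst) (simp add: interleave_def)
qed

definition some_set :: "'a::rca set" where "some_set = (SOME X. X \<in> Sets)"

lemma some_set: "some_set \<in> Sets"
  unfolding some_set_def using Sets_nonempty by (simp add: some_in_eq)

text \<open>The way back from predicates to formulas, to which the axiom schemes apply.\<close>

lemma dpred_rep: "dpred (P :: (nat \<Rightarrow> 'a::rca) \<Rightarrow> bool) \<Longrightarrow> \<exists>p v E. represents P p v E"
proof (induction rule: dpred.induct)
  case (dpred_eq s t)
  then obtain u u' v where uv: "\<And>e. s e = evalT (dec v e) u \<and> t e = evalT (dec v e) u'"
    using dterm_rep2 by metis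
  show ?case
    by (intro exI[of _ "Eq u u'"] exI[of _ v] exI[of _ "\<lambda>_. some_set"])
      (simp add: represents_def some_set uv delta00.intros)
next
  case (dpred_less s t)
  then obtain u u' v where uv: "\<And>e. s e = evalT (dec v e) u \<and> t e = evalT (dec v e) u'"
    using dterm_rep2 by metis
  show ?case
    by (intro exI[of _ "Less u u'"] exI[of _ v] exI[of _ "\<lambda>_. some_set"])
      (simp add: represents_def some_set uv delta00.intros)
next
  case (dpred_mem t X)
  then obtain u v where uv: "\<And>e. t e = evalT (dec v e) u"
    using dterm_rep by metis
  show ?case
    by (intro exI[of _ "Mem u 0"] exI[of _ v] exI[of _ "\<lambda>_. X"])
      (simp add: represents_def dpred_mem uv delta00.intros)
next
  case dpred_False
  show ?case
    by (intro exI[of _ Bot] exI[of _ "\<lambda>_. Inr 0"] exI[of _ "\<lambda>_. some_set"])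
      (simp add: represents_def some_set delta00.intros)
next
  case (dpred_imp P Q)
  then obtain p q v E where "represents P p v E" "represents Q q v E"
    using represents_join by metis
  then show ?case
    by (intro exI[of _ "Imp p q"] exI[of _ v] exI[of _ E]) (simp add: represents_def delta00.intros)
next
  case (dpred_all_less t P)
  obtain u w where u: "\<And>e. t e = evalT (dec w e) u" using dpred_all_less.hyps(1) dterm_rep by metis
  obtain p v E where p: "represents (\<lambda>e. P (e 0) (\<lambda>i. e (Suc i))) p v E"
    using dpred_all_less.IH by blast
  \<comment> \<open>The variables that denote entry 0 become the bound variable. The others sit at
    the odd positions, raised by one under the quantifier, and \<open>v'\<close> lowers their entry
    by one because the environment outside lacks entry 0. Where \<open>v\<close> gives
    \<open>Inr 0\<close>, \<open>\<sigma>\<close> bypasses \<open>v'\<close>.\<close>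
  define \<sigma> where "\<sigma> i = (if v i = Inr 0 then Var 0 else Var (Suc (Suc (2 * i))))" for i
  define v' where "v' i = (case v i of Inl a \<Rightarrow> Inl a | Inr j \<Rightarrow> Inr (j - 1))" for i
  have \<sigma>: "evalT (case_nat x (dec (interleave w v') e)) (\<sigma> i) = dec v (case_nat x e) i" for x e i
    by (auto simp: \<sigma>_def v'_def dec_def split: sum.split nat.split)
  have "P x e \<longleftrightarrow> sat (case_nat x (dec (interleave w v') e)) E (subst \<sigma> (\<lambda>X. X) p)" for x e
  proof -
    have "P x e \<longleftrightarrow> sat (dec v (case_nat x e)) E p"
      using p unfolding represents_def by (metis (no_types, lifting) nat.case(1) nat.case(2) ext)
    then show ?thesis by (simp add: sat_subst \<sigma>)
  qed
  then have "represents (\<lambda>e. \<forall>x. x < t e \<longrightarrow> P x e)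
      (AllN (Imp (Less (Var 0) (liftT (substT (\<lambda>i. Var (2 * i)) u))) (subst \<sigma> (\<lambda>X. X) p)))
      (interleave w v') E"
    using p u by (simp add: represents_def delta00.intros delta00_subst evalT_substT)
  then show ?case by blast
qed

section \<open>Bounded induction and comprehension for predicates\<close>

lemma rca_axiom: "p \<in> RCA0_star \<Longrightarrow> valid TYPE('a::rca) p"
  unfolding valid_def using sat_RCA by blast

lemma valid_induction_fm:
  assumes "delta00 p" shows "valid TYPE('a::rca) (induction_fm p)"
proof -
  obtain q where q: "q \<in> closures (induction_fm p)" using closures_nonempty by metis
  then have "q \<in> RCA0_star" using assms by (auto simp: RCA0_star_def)
  then show ?thesis using rca_axiom valid_closures[OF q] by metis
qed

lemma valid_comprehension_fm:
  assumes "sigma01 p" "pi01 q" shows "valid TYPE('a::rca) (comprehension_fm p q)"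
proof -
  obtain r where r: "r \<in> closures (comprehension_fm p q)" using closures_nonempty by metis
  then have "r \<in> RCA0_star" using assms by (auto simp: RCA0_star_def)
  then show ?thesis using rca_axiom valid_closures[OF r] by metis
qed

theorem dpred_induct [case_names dpred zero Suc]:
  fixes x :: "'a::rca"
  assumes P: "dpred (\<lambda>e. P (e 0))" and "P 0" and "\<And>x. P x \<Longrightarrow> P (x + 1)"
  shows "P x"
proof -
  obtain p v E where p: "represents (\<lambda>e. P (e 0)) p v E" using dpred_rep[OF P] by blast
  \<comment> \<open>Variables denoting entry 0 become the induction variable; all others are
    parameters valued by \<open>e\<close>, with 0 for the entries on which the predicate does not
    depend.\<close>
  define \<sigma> where "\<sigma> i = (if v i = Inr 0 then Var 0 else Var (Suc i))" for i
  define e where "e = dec v (\<lambda>_. 0)"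
  have "evalT (case_nat x e) (\<sigma> i) = dec v (\<lambda>j. if j = 0 then x else 0) i" for x i
    by (auto simp: \<sigma>_def e_def dec_def split: sum.split)
  then have s: "sat (case_nat x e) E (subst \<sigma> (\<lambda>X. X) p) \<longleftrightarrow> P x" for x
    using p spec[of "\<lambda>e. P (e 0) \<longleftrightarrow> sat (dec v e) E p" "\<lambda>j. if j = 0 then x else 0"]
    by (simp add: sat_subst represents_def)
  have "sat e E (induction_fm (subst \<sigma> (\<lambda>X. X) p))"
    using valid_induction_fm[OF delta00_subst] p unfolding valid_def represents_def by blast
  then show ?thesis using assms(2,3) by (simp add: sat_induction_fm s)
qed

theorem delta1_comprehension:
  fixes P Q :: "'a::rca \<Rightarrow> 'a \<Rightarrow> bool"
  assumes P: "dpred (\<lambda>e. P (e 0) (e 1))" and Q: "dpred (\<lambda>e. Q (e 0) (e 1))"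
    and eq: "\<And>x. (\<exists>y. P x y) \<longleftrightarrow> (\<forall>y. Q x y)"
  shows "{x. \<exists>y. P x y} \<in> Sets"
proof -
  obtain p\<^sub>0 v\<^sub>0 E\<^sub>0 q\<^sub>0 w\<^sub>0 F\<^sub>0 where "represents (\<lambda>e. P (e 0) (e 1)) p\<^sub>0 v\<^sub>0 E\<^sub>0"
    "represents (\<lambda>e. Q (e 0) (e 1)) q\<^sub>0 w\<^sub>0 F\<^sub>0"
    using dpred_rep[OF P] dpred_rep[OF Q] by blast
  from represents_join[OF this] obtain p q v E where p: "represents (\<lambda>e. P (e 0) (e 1)) p v E"
      and q: "represents (\<lambda>e. Q (e 0) (e 1)) q v E" by blast
  \<comment> \<open>Entry 0 is the element and entry 1 the witness. The witness is bound innermost,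
    hence the swap of indices.\<close>
  define \<sigma> where "\<sigma> i = (if v i = Inr 1 then Var 0 else if v i = Inr 0 then Var 1 else Var (i + 2))" for i
  define e where "e = dec v (\<lambda>_. 0)"
  have \<sigma>: "evalT (case_nat y (case_nat x e)) (\<sigma> i) = dec v (case_nat x (case_nat y (\<lambda>_. 0))) i" for x y i
    by (auto simp: \<sigma>_def e_def dec_def split: sum.split nat.split)
  have sp: "sat (case_nat y (case_nat x e)) E (subst \<sigma> (\<lambda>X. X) p) \<longleftrightarrow> P x y" for x y
    using p spec[of "\<lambda>e. P (e 0) (e 1) \<longleftrightarrow> sat (dec v e) E p" "case_nat x (case_nat y (\<lambda>_. 0))"]
    by (simp add: sat_subst \<sigma> represents_def)
  have sq: "sat (case_nat y (case_nat x e)) E (subst \<sigma> (\<lambda>X. X) q) \<longleftrightarrow> Q x y" for x y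
    using q spec[of "\<lambda>e. Q (e 0) (e 1) \<longleftrightarrow> sat (dec v e) E q" "case_nat x (case_nat y (\<lambda>_. 0))"]
    by (simp add: sat_subst \<sigma> represents_def)
  have "sigma01 (ExN (subst \<sigma> (\<lambda>X. X) p))" "pi01 (AllN (subst \<sigma> (\<lambda>X. X) q))"
    unfolding sigma01_def pi01_def using p q
    by (metis represents_def delta00_subst)+
  from valid_comprehension_fm[OF this]
  have "sat e E (comprehension_fm (ExN (subst \<sigma> (\<lambda>X. X) p)) (AllN (subst \<sigma> (\<lambda>X. X) q)))"
    using p unfolding valid_def represents_def by metis
  then obtain X where "X \<in> Sets" "\<forall>x. x \<in> X \<longleftrightarrow> (\<exists>y. P x y)"
    using eq by (auto simp: sat_comprehension_fm sp sq)
  moreover from this(2) have "X = {x. \<exists>y. P x y}" by blast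
  ultimately show ?thesis by simp
qed

theorem dpred_comprehension:
  assumes "dpred (\<lambda>e. P (e 0))"
  shows "{x. P x} \<in> Sets"
  using delta1_comprehension[of "\<lambda>x y. P x" "\<lambda>x y. P x"] assms by simp

named_theorems dintros

declare dterm.intros [dintros]
declare dpred_eq [dintros] dpred_less [dintros] dpred_mem [dintros] dpred_imp [dintros]
  dpred_all_less [dintros]

lemma dpred_not [dintros]: "dpred P \<Longrightarrow> dpred (\<lambda>e. \<not> P e)"
  using dpred_imp[OF _ dpred_False, of P] by simp

lemma dpred_const [dintros]: "dpred (\<lambda>e. c)"
  using dpred_False dpred_not[OF dpred_False] by (cases c) simp_all

lemma dpred_or [dintros]: "dpred P \<Longrightarrow> dpred Q \<Longrightarrow> dpred (\<lambda>e. P e \<or> Q e)"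
  using dpred_imp[OF dpred_not, of P Q] by (simp add: disj_imp)

lemma dpred_and [dintros]: "dpred P \<Longrightarrow> dpred Q \<Longrightarrow> dpred (\<lambda>e. P e \<and> Q e)"
  using dpred_not[OF dpred_imp[OF _ dpred_not], of P Q] by simp

lemma dpred_iff [dintros]: "dpred P \<Longrightarrow> dpred Q \<Longrightarrow> dpred (\<lambda>e. P e \<longleftrightarrow> Q e)"
  using dpred_and[OF dpred_imp dpred_imp, of P Q Q P] by (simp add: iff_conv_conj_imp)

lemma dpred_ex_less [dintros]:
  "dterm t \<Longrightarrow> dpred (\<lambda>e. P (e 0) (\<lambda>i. e (Suc i))) \<Longrightarrow> dpred (\<lambda>e. \<exists>x. x < t e \<and> P x e)"
  using dpred_not[OF dpred_all_less[OF _ dpred_not], of t P] by simp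

lemma dpred_le [dintros]: "dterm s \<Longrightarrow> dterm t \<Longrightarrow> dpred (\<lambda>e. s e \<le> t e)"
  unfolding rca_le by (intro dintros)

lemma dpred_subst2:
  "dpred (\<lambda>e. R (e 0) (e 1)) \<Longrightarrow> dterm s \<Longrightarrow> dterm t \<Longrightarrow> dpred (\<lambda>e. R (s e) (t e))"
  using dpred_subst[of "\<lambda>e. R (e 0) (e 1)" "\<lambda>i. if i = 0 then s else t"] by simp

section \<open>Arithmetic in models\<close>

lemma PA_axioms:
  fixes x y :: "'a::rca"
  shows rca_Suc_neq_0: "x + 1 \<noteq> 0" and rca_Suc_inject: "x + 1 = y + 1 \<Longrightarrow> x = y"
    and rca_add_0: "x + 0 = x" and rca_add_Suc: "x + (y + 1) = (x + y) + 1"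
    and rca_mult_0: "x * 0 = 0" and rca_mult_Suc: "x * (y + 1) = x * y + x"
    and rca_not_less_0: "\<not> x < 0" and rca_less_Suc: "x < y + 1 \<longleftrightarrow> x < y \<or> x = y"
    and expo_0: "x \<up> 0 = 1" and expo_Suc: "x \<up> (y + 1) = x \<up> y * x"
proof -
  have "sat (\<lambda>_. 0 :: 'a) (\<lambda>_. some_set) (sentence p)" if "p \<in> basic_axioms" for p
  proof -
    have "sentence p \<in> RCA0_star" using that by (simp add: RCA0_star_def)
    then show ?thesis using sat_RCA some_set by metis
  qed
  then have "\<forall>p \<in> basic_axioms. sat (\<lambda>_. 0 :: 'a) (\<lambda>_. some_set) (sentence p)" by blast
  then show "x + 1 \<noteq> 0" "x + 1 = y + 1 \<Longrightarrow> x = y" "x + 0 = x" "x + (y + 1) = (x + y) + 1"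
    "x * 0 = 0" "x * (y + 1) = x * y + x" "\<not> x < 0" "x < y + 1 \<longleftrightarrow> x < y \<or> x = y"
    "x \<up> 0 = 1" "x \<up> (y + 1) = x \<up> y * x"
    by (simp_all add: basic_axioms_def named_defs)
qed

lemma rca_add_assoc: "(x + y) + z = x + (y + z :: 'a::rca)"
  by (induction z rule: dpred_induct) (intro dintros, simp_all add: rca_add_0 rca_add_Suc)

lemma rca_0_add: "0 + x = (x :: 'a::rca)"
  by (induction x rule: dpred_induct) (intro dintros, simp_all add: rca_add_0 rca_add_Suc)

lemma rca_Suc_add: "(x + 1) + y = (x + y) + (1 :: 'a::rca)"
  by (induction y rule: dpred_induct) (intro dintros, simp_all add: rca_add_0 rca_add_Suc)

lemma rca_add_comm: "x + y = y + (x :: 'a::rca)"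
  by (induction y rule: dpred_induct)
    (intro dintros, simp_all add: rca_add_0 rca_0_add rca_add_Suc rca_Suc_add)

lemma rca_add_left_comm: "x + (y + z) = y + (x + z :: 'a::rca)"
  by (metis rca_add_comm rca_add_assoc)

lemmas rca_add_ac = rca_add_assoc rca_add_comm rca_add_left_comm

lemma rca_distrib_left: "x * (y + z) = x * y + x * (z :: 'a::rca)"
proof (induction z rule: dpred_induct)
  case (Suc z)
  have "x * (y + (z + 1)) = x * (y + z) + x" by (simp only: rca_add_Suc rca_mult_Suc)
  also have "\<dots> = x * y + x * (z + 1)" by (simp only: Suc rca_mult_Suc rca_add_assoc)
  finally show ?case .
qed (intro dintros, simp add: rca_add_0 rca_mult_0)

lemma rca_0_mult: "0 * x = (0 :: 'a::rca)"
  by (induction x rule: dpred_induct) (intro dintros, simp_all add: rca_add_0 rca_mult_0 rca_mult_Suc)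

lemma rca_Suc_mult: "(x + 1) * y = x * y + (y :: 'a::rca)"
proof (induction y rule: dpred_induct)
  case (Suc y)
  have "(x + 1) * (y + 1) = x * y + y + (x + 1)" by (simp only: rca_mult_Suc Suc)
  also have "\<dots> = x * (y + 1) + (y + 1)" by (simp only: rca_mult_Suc) (simp only: rca_add_ac)
  finally show ?case .
qed (intro dintros, simp add: rca_add_0 rca_mult_0)

lemma rca_mult_comm: "x * y = y * (x :: 'a::rca)"
  by (induction y rule: dpred_induct)
    (intro dintros, simp_all add: rca_mult_0 rca_0_mult rca_mult_Suc rca_Suc_mult)

lemma rca_mult_1: "x * 1 = (x :: 'a::rca)"
  using rca_mult_Suc[of x 0] by (simp add: rca_0_add rca_mult_0)

lemma rca_mult_assoc: "(x * y) * z = x * (y * z :: 'a::rca)"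
  by (induction z rule: dpred_induct)
    (intro dintros, simp_all add: rca_mult_0 rca_mult_1 rca_distrib_left)

lemma rca_add_cancel: "x + z = y + z \<Longrightarrow> x = (y :: 'a::rca)"
  by (induction z rule: dpred_induct)
    (intro dintros, auto simp: rca_add_0 rca_add_Suc dest: rca_Suc_inject)

lemma rca_pred: "x = 0 \<or> (\<exists>y. x = y + (1 :: 'a::rca))"
proof -
  \<comment> \<open>The bound \<open>y < x\<close> makes this a legitimate induction statement; the
    same device recurs in the inductions below.\<close>
  have "x = 0 \<or> (\<exists>y. y < x \<and> x = y + 1)"
    by (induction x rule: dpred_induct) (intro dintros, auto simp: rca_less_Suc)
  then show ?thesis by blast
qed

lemma rca_less_add: "x < x + z + (1 :: 'a::rca)"
  by (induction z rule: dpred_induct)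
    (intro dintros, simp_all add: rca_add_0 rca_add_Suc rca_less_Suc)

lemma rca_less_iff: "x < y \<longleftrightarrow> (\<exists>z. y = x + z + (1 :: 'a::rca))"
proof
  have "x < y \<longrightarrow> (\<exists>z. z < y \<and> y = x + z + 1)"
  proof (induction y rule: dpred_induct)
    case (Suc y)
    show ?case
    proof
      assume "x < y + 1"
      then consider "x < y" | "x = y" by (auto simp: rca_less_Suc)
      then show "\<exists>z. z < y + 1 \<and> y + 1 = x + z + 1"
      proof cases
        case 1
        then obtain z where "z < y" "y = x + z + 1" using Suc by blast
        then have "y + 1 = x + (z + 1) + 1" "z + 1 < y + 1"
          using rca_less_add[of "z + 1" x] by (simp_all add: rca_add_ac)
        then show ?thesis by blast
      next
        case 2
        then show ?thesis
          using rca_less_add[of 0 y] by (intro exI[of _ 0]) (simp add: rca_add_0 rca_0_add)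
      qed
    qed
  qed (intro dintros, simp add: rca_not_less_0)
  then show "x < y \<Longrightarrow> \<exists>z. y = x + z + 1" by blast
qed (auto simp: rca_less_add)

lemma rca_le_iff: "x \<le> y \<longleftrightarrow> (\<exists>z. y = x + (z :: 'a::rca))"
  unfolding rca_le rca_less_iff by (metis rca_add_0 rca_add_assoc rca_pred)

lemma rca_add_eq_0: "x + y = 0 \<Longrightarrow> x = (0 :: 'a::rca)"
  by (metis rca_Suc_neq_0 rca_add_0 rca_add_Suc rca_pred)

lemma rca_linear: "x < y \<or> x = y \<or> y < (x :: 'a::rca)"
proof (induction y rule: dpred_induct)
  case zero
  then show ?case using rca_pred[of x] rca_less_add[of 0] by (auto simp: rca_0_add)
next
  case (Suc y)
  then show ?case
  proof (elim disjE)
    assume "y < x"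
    then obtain z where "x = y + z + 1" by (auto simp: rca_less_iff)
    then show ?thesis
      using rca_pred[of z] rca_less_add[of "y + 1"] by (auto simp: rca_add_ac rca_add_0 rca_0_add)
  qed (auto simp: rca_less_Suc)
qed (intro dintros)

lemma rca_0_minus: "0 - a = (0 :: 'a::rca)"
  using rca_add_eq_0 rca_0_add unfolding rca_minus by (smt (verit) the_equality)

text \<open>Makes HOL's rules for ordered semirings available in every model. This class has laws
  for subtraction, which is the reason for the truncated subtraction in \<open>rca\<close>.\<close>

instance rca \<subseteq> linordered_semidom
proof
  fix a b c :: 'a
  show "a + b + c = a + (b + c)" by (rule rca_add_assoc)
  show "a + b = b + a" by (rule rca_add_comm)
  show "0 + a = a" by (rule rca_0_add)
  show "a * b * c = a * (b * c)" by (rule rca_mult_assoc)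
  show "a * b = b * a" by (rule rca_mult_comm)
  show "1 * a = a" by (metis rca_mult_comm rca_mult_1)
  show "(a + b) * c = a * c + b * c" by (metis rca_mult_comm rca_distrib_left)
  show "0 * a = 0" by (rule rca_0_mult)
  show "a * 0 = 0" by (rule rca_mult_0)
  show "(0::'a) \<noteq> 1" using rca_Suc_neq_0[of 0] by (metis rca_0_add)
  have minus: "b + a - b = a" for a b :: 'a
    unfolding rca_minus using rca_add_cancel by (auto simp: rca_add_comm[of b])
  show "a + b - a = b" by (rule minus)
  have diff_diff: "a - b - c = a - (b + c)" for a b c :: 'a
  proof (cases "b \<le> a")
    case True
    then obtain z where z: "a = b + z" by (auto simp: rca_le_iff)
    have "(\<exists>w. z = c + w) \<longleftrightarrow> (\<exists>w. b + z = b + c + w)"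
      by (metis rca_add_assoc rca_add_cancel rca_add_comm)
    moreover have "z = c + w \<longleftrightarrow> b + z = b + c + w" for w
      by (metis rca_add_assoc rca_add_cancel rca_add_comm)
    ultimately show ?thesis unfolding z minus unfolding rca_minus by simp
  next
    case False
    then have "\<not> (\<exists>z. a = b + z)" "\<not> (\<exists>z. a = b + c + z)"
      by (auto simp: rca_le_iff rca_add_assoc)
    then have "a - b = 0" "a - (b + c) = 0" by (simp_all add: rca_minus)
    then show ?thesis by (simp add: rca_0_minus)
  qed
  show "a - b - c = a - (b + c)" by (rule diff_diff)
  show "a * (b - c) = a * b - a * c"
  proof (cases "c \<le> b")
    case True
    then show ?thesis using minus by (auto simp: rca_le_iff rca_distrib_left)
  next
    case False
    then have "b - c = 0" by (auto simp: rca_minus rca_le_iff)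
    obtain d where "c = b + d" using False rca_linear[of b c] by (auto simp: rca_le rca_less_iff rca_add_assoc)
    then have "a * b - a * c = 0"
      using minus[of "a * b" 0] by (simp add: rca_distrib_left rca_add_0 rca_0_minus flip: diff_diff)
    then show ?thesis using \<open>b - c = 0\<close> by (simp add: rca_mult_0)
  qed
  show "a * (b + c) = a * b + a * c" by (rule rca_distrib_left)
  have irrefl: "\<not> a < a" for a :: 'a
    unfolding rca_less_iff by (metis rca_Suc_neq_0 rca_0_add rca_add_assoc rca_add_cancel rca_add_comm)
  show "a \<le> a" by (simp add: rca_le)
  show le_trans: "a \<le> b \<Longrightarrow> b \<le> c \<Longrightarrow> a \<le> c" for a b c :: 'a by (metis rca_le_iff rca_add_assoc)
  show antisym: "a \<le> b \<Longrightarrow> b \<le> a \<Longrightarrow> a = b" for a b :: 'a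
  proof (rule ccontr)
    assume "a \<le> b" "b \<le> a" "a \<noteq> b"
    then have "a < b" "b < a" by (auto simp: rca_le)
    then obtain z w where "b = a + z + 1" "a = b + w + 1" by (auto simp: rca_less_iff)
    then have "a = a + (z + 1 + w) + 1" by (metis rca_add_assoc)
    then show False using irrefl rca_less_add by metis
  qed
  show "a < b \<longleftrightarrow> a \<le> b \<and> \<not> b \<le> a" by (metis antisym irrefl rca_le)
  show "a \<le> b \<or> b \<le> a" using rca_linear[of a b] by (auto simp: rca_le)
  show "a \<le> b \<Longrightarrow> c + a \<le> c + b" by (metis rca_le_iff rca_add_assoc)
  have pos: "0 < c \<longleftrightarrow> (\<exists>d. c = d + 1)" for c :: 'a by (simp add: rca_less_iff rca_0_add)
  show "a < b \<Longrightarrow> 0 < c \<Longrightarrow> c * a < c * b"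
  proof -
    assume "a < b" "0 < c"
    then obtain d z where "c = d + 1" "b = a + z + 1" by (auto simp: pos rca_less_iff)
    then have "c * b = c * a + (c * z + d) + 1"
      by (metis rca_distrib_left rca_mult_Suc rca_add_assoc)
    then show "c * a < c * b" using rca_less_add by simp
  qed
  show "(0::'a) < 1" using rca_less_add[of 0 0] by (simp add: rca_0_add)
  show "a \<noteq> 0 \<Longrightarrow> b \<noteq> 0 \<Longrightarrow> a * b \<noteq> 0"
    by (metis rca_Suc_neq_0 rca_add_Suc rca_mult_Suc rca_pred)
  show "b \<le> a \<Longrightarrow> a - b + b = a"
    by (metis minus rca_le_iff rca_add_comm)
qed

instance rca \<subseteq> ordered_cancel_comm_monoid_diff
proof
  fix a b :: 'a
  show "a \<le> b \<longleftrightarrow> (\<exists>c. b = a + c)" by (rule rca_le_iff)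
  show "0 - a = 0" by (rule rca_0_minus)
qed

lemma less_Suc [simp]: "x < y + 1 \<longleftrightarrow> x \<le> (y :: 'a::rca)"
  by (simp add: rca_less_Suc le_less)

lemma Suc_le [simp]: "x + 1 \<le> y \<longleftrightarrow> x < (y :: 'a::rca)"
  by (metis less_Suc not_less)

lemma less_imp_Suc: "x < y \<Longrightarrow> \<exists>z. y = x + z + (1 :: 'a::rca)"
  by (simp add: rca_less_iff)

lemma Suc_cases: obtains (zero) "x = 0" | (Suc) y where "x = y + (1 :: 'a::rca)"
  using rca_pred by blast

lemma pos_Suc: "0 < x \<Longrightarrow> \<exists>y. x = y + (1 :: 'a::rca)"
  using Suc_cases by blast

lemma rca_less_one [simp]: "x < 1 \<longleftrightarrow> x = (0 :: 'a::rca)"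
  using less_Suc[of x 0] by simp

lemma less_two [simp]: "x < 2 \<longleftrightarrow> x = 0 \<or> x = (1 :: 'a::rca)"
  using less_Suc[of x 1] less_Suc[of x 0] by (auto simp: le_less one_add_one simp del: less_Suc)

lemma dpred_all_le [dintros]:
  "dterm t \<Longrightarrow> dpred (\<lambda>e. P (e 0) (\<lambda>i. e (Suc i))) \<Longrightarrow> dpred (\<lambda>e. \<forall>x. x \<le> t e \<longrightarrow> P x e)"
  unfolding less_Suc[symmetric] by (intro dintros)

lemma dpred_ex_le [dintros]:
  "dterm t \<Longrightarrow> dpred (\<lambda>e. P (e 0) (\<lambda>i. e (Suc i))) \<Longrightarrow> dpred (\<lambda>e. \<exists>x. x \<le> t e \<and> P x e)"
  unfolding less_Suc[symmetric] by (intro dintros)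

theorem dpred_less_induct [case_names dpred less]:
  fixes x :: "'a::rca"
  assumes P: "dpred (\<lambda>e. P (e 0))" and step: "\<And>x. (\<And>y. y < x \<Longrightarrow> P y) \<Longrightarrow> P x"
  shows "P x"
proof -
  have "\<forall>y. y < x \<longrightarrow> P y"
  proof (induction x rule: dpred_induct)
    case dpred
    have "dpred (\<lambda>e. P (e 0))" by (rule P)
    then show ?case by (intro dpred_all_less dintros)
  next
    case (Suc x)
    then show ?case using step by (auto simp: le_less)
  qed simp
  then show ?thesis using step by blast
qed

theorem dpred_least:
  fixes x :: "'a::rca"
  assumes "dpred (\<lambda>e. P (e 0))" "P x"
  obtains y where "P y" "y \<le> x" "\<And>z. z < y \<Longrightarrow> \<not> P z"
proof -
  have "\<exists>y. P y \<and> (\<forall>z. z < y \<longrightarrow> \<not> P z)"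
  proof (rule ccontr)
    assume n: "\<nexists>y. P y \<and> (\<forall>z. z < y \<longrightarrow> \<not> P z)"
    have "\<not> P x" for x
      using dpred_less_induct[of "\<lambda>x. \<not> P x" x] dpred_not[OF assms(1)] n by blast
    with assms(2) show False by blast
  qed
  then show ?thesis using that assms(2) by (meson not_le)
qed

theorem dpred_greatest:
  fixes x b :: "'a::rca"
  assumes P: "dpred (\<lambda>e. P (e 0))" "P x" and b: "\<And>x. P x \<Longrightarrow> x \<le> b"
  obtains y where "P y" "x \<le> y" "\<And>z. P z \<Longrightarrow> z \<le> y"
proof -
  \<comment> \<open>The least upper bound of \<open>P\<close> satisfies \<open>P\<close>: otherwise
    its predecessor would be an upper bound too.\<close>
  define Q where "Q y \<longleftrightarrow> (\<forall>z. z \<le> b \<longrightarrow> P z \<longrightarrow> z \<le> y)" for y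
  have "dpred (\<lambda>e. P (e 0))" by (rule P)
  then have "dpred (\<lambda>e. Q (e 0))" unfolding Q_def by (intro dpred_imp dintros)
  moreover have "Q b" by (simp add: Q_def)
  ultimately obtain y where y: "Q y" "\<And>z. z < y \<Longrightarrow> \<not> Q z"
    using dpred_least[of Q b] by blast
  have ub: "z \<le> y" if "P z" for z using that y(1) b by (auto simp: Q_def)
  have "P y"
  proof (rule ccontr)
    assume "\<not> P y"
    then have lt: "z < y" if "P z" for z using that ub by (metis le_less)
    then obtain w where w: "y = w + 1" using assms(2) by (metis Suc_cases not_less_zero)
    then have "Q w" using lt by (auto simp: Q_def)
    then show False using y(2)[of w] w by simp
  qed
  then show ?thesis using that ub assms(2) by blast
qed

section \<open>Powers of two and division with remainder\<close>

lemma expo_1 [simp]: "x \<up> 1 = (x :: 'a::rca)"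
  using expo_Suc[of x 0] by (simp add: expo_0)

lemma expo_add: "x \<up> (y + z) = x \<up> y * x \<up> (z :: 'a::rca)"
proof (induction z rule: dpred_induct)
  case (Suc z)
  have "x \<up> (y + (z + 1)) = x \<up> (y + z) * x" by (simp add: expo_Suc flip: add.assoc)
  then show ?case by (simp add: Suc expo_Suc mult.assoc)
qed (intro dintros, simp add: expo_0)

lemma expo_pos [simp]: "0 < x \<Longrightarrow> 0 < x \<up> (y :: 'a::rca)"
  by (induction y rule: dpred_induct) (intro dintros, simp_all add: expo_0 expo_Suc)

lemma one_le_expo [simp]: "0 < x \<Longrightarrow> 1 \<le> x \<up> (y :: 'a::rca)"
  using Suc_le[of 0 "x \<up> y"] by simp

lemma less_two_expo [simp]: "x < 2 \<up> (x :: 'a::rca)"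
proof (induction x rule: dpred_induct)
  case (Suc x)
  then have "x + 1 \<le> 2 \<up> x" by simp
  also have "2 \<up> x < 2 \<up> x + 2 \<up> x" by simp
  finally show ?case by (simp add: expo_Suc mult_2_right)
qed (intro dintros, simp add: expo_0)

lemma two_expo_strict_mono: "x < y \<Longrightarrow> 2 \<up> x < 2 \<up> (y :: 'a::rca)"
proof -
  assume "x < y"
  then obtain z where y: "y = x + (z + 1)" using less_imp_Suc by (metis add.assoc)
  have "1 \<le> 2 \<up> z" by simp
  also have "2 \<up> z < 2 \<up> z + 2 \<up> (z :: 'a)" by simp
  finally have "1 < 2 \<up> (z + 1)" by (simp add: expo_Suc mult_2_right)
  then have "2 \<up> x * 1 < 2 \<up> x * 2 \<up> (z + 1)" by (intro mult_strict_left_mono) simp_all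
  then show ?thesis by (simp only: y expo_add mult_1_right)
qed

lemma two_expo_mono: "x \<le> y \<Longrightarrow> 2 \<up> x \<le> 2 \<up> (y :: 'a::rca)"
  using two_expo_strict_mono by (auto simp: le_less)

lemma ex_div: "0 < b \<Longrightarrow> \<exists>q r. r < b \<and> c = q * b + (r :: 'a::rca)"
proof -
  assume b: "0 < b"
  have "\<exists>q. q \<le> c \<and> (\<exists>r. r < b \<and> c = q * b + r)"
  proof (induction c rule: dpred_induct)
    case (Suc c)
    then obtain q r where qr: "q \<le> c" "r < b" "c = q * b + r" by blast
    show ?case
    proof (cases "r + 1 < b")
      case True
      then show ?thesis using qr
        by (intro exI[of _ q] conjI exI[of _ "r + 1"]) (auto simp: add.assoc intro: order_trans)
    next
      case False
      then have "b = r + 1" using qr(2) by (metis Suc_le antisym not_less)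
      then have "c + 1 = (q + 1) * b + 0" using qr by (simp add: algebra_simps)
      moreover have "q + 1 \<le> c + 1" using qr(1) by (rule add_right_mono)
      ultimately show ?thesis using b by blast
    qed
  qed (intro dintros, use b in auto)
  then show ?thesis by blast
qed

lemma div_unique:
  fixes b :: "'a::rca"
  assumes "r < b" "r' < b" "q * b + r = q' * b + r'"
  shows "q = q' \<and> r = r'"
proof -
  have *: False if "r < b" "q < q'" "q * b + r = q' * b + r'" for q q' r r' :: 'a
  proof -
    obtain z where "q' = q + z + 1" using less_imp_Suc \<open>q < q'\<close> by blast
    then have "q * b + r = q * b + (b + (z * b + r'))" using that(3) by (simp add: algebra_simps)
    then have "r = b + (z * b + r')" by (metis add_left_cancel)
    then have "b \<le> r" by (metis le_iff_add)
    then show False using \<open>r < b\<close> by simp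
  qed
  have "q = q'" using *[OF assms(1) _ assms(3)] *[OF assms(2) _ assms(3)[symmetric]] by (metis neqE)
  then show ?thesis using assms(3) by simp
qed

lemma parity: "(\<exists>p. q = 2 * p) \<or> (\<exists>p. q = 2 * p + (1 :: 'a::rca))"
  using ex_div[of 2 q] by (auto simp: mult.commute)

lemma not_even_odd: "2 * p \<noteq> 2 * q + (1 :: 'a::rca)"
  using div_unique[of 0 2 1 p q] by (auto simp: mult.commute)

section \<open>Pairing\<close>

definition pr :: "'a::rca \<Rightarrow> 'a \<Rightarrow> 'a" where "pr x y = (x + y) * (x + y) + x"

lemma dterm_pr [dintros]: "dterm s \<Longrightarrow> dterm t \<Longrightarrow> dterm (\<lambda>e. pr (s e) (t e))"
  unfolding pr_def by (intro dintros)

lemma le_square: "x \<le> x * (x :: 'a::rca)"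
proof (cases x rule: Suc_cases)
  case (Suc y)
  then have "x * x = x + (y + y * y)" by (simp add: algebra_simps)
  then show ?thesis by (metis le_iff_add)
qed simp

lemma le_pr1 [simp]: "x \<le> pr x y" and le_pr2 [simp]: "y \<le> pr x (y :: 'a::rca)"
proof -
  show "x \<le> pr x y" unfolding pr_def by simp
  have "y \<le> x + y" by simp
  also have "\<dots> \<le> pr x y" unfolding pr_def using le_square[of "x + y"] by (rule order_trans) simp
  finally show "y \<le> pr x y" .
qed

lemma pr_mono: "x \<le> x' \<Longrightarrow> y \<le> y' \<Longrightarrow> pr x y \<le> pr x' (y' :: 'a::rca)"
  unfolding pr_def by (intro add_mono mult_mono) auto

text \<open>With s = x + y the code lies between s^2 and (s + 1)^2, the latter excluded. So the code
  determines s, and then x and y.\<close>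

lemma pr_less: "x + y < x' + y' \<Longrightarrow> pr x y < pr x' (y' :: 'a::rca)"
proof -
  assume "x + y < x' + y'"
  then have "x + y + 1 \<le> x' + y'" by simp
  then have "(x + y + 1) * (x + y + 1) \<le> (x' + y') * (x' + y')" by (intro mult_mono) auto
  also have "\<dots> \<le> pr x' y'" by (simp add: pr_def)
  finally have *: "(x + y + 1) * (x + y + 1) \<le> pr x' y'" .
  have "(x + y + 1) * (x + y + 1) = pr x y + (x + y + y + 1)" by (simp add: pr_def algebra_simps)
  then have "pr x y < (x + y + 1) * (x + y + 1)"
    using rca_less_add[of "pr x y" "x + y + y"] by (simp add: add.assoc)
  with * show ?thesis by simp
qed

lemma pr_inject [simp]: "pr x y = pr x' y' \<longleftrightarrow> x = x' \<and> y = (y' :: 'a::rca)"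
proof
  assume eq: "pr x y = pr x' y'"
  then have "x + y = x' + y'" using pr_less by (metis neqE less_irrefl)
  then show "x = x' \<and> y = y'" using eq by (auto simp: pr_def)
qed simp

section \<open>Codes of finite sets\<close>

definition cmem :: "'a::rca \<Rightarrow> 'a \<Rightarrow> bool" where
  "cmem i c \<longleftrightarrow> (\<exists>q r. r < 2 \<up> i \<and> c = (2 * q + 1) * 2 \<up> i + r)"

text \<open>Quotient and remainder are bounded by the code, so membership in a coded set is
  definable by a bounded formula.\<close>

lemma cmem_bounded:
  "cmem i c \<longleftrightarrow> (\<exists>q. q \<le> c \<and> (\<exists>r. r \<le> c \<and> r < 2 \<up> i \<and> c = (2 * q + 1) * 2 \<up> i + r))"
proof
  assume "cmem i c"
  then obtain q r where qr: "r < 2 \<up> i" "c = (2 * q + 1) * 2 \<up> i + r" by (auto simp: cmem_def)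
  have "q * 1 \<le> (2 * q + 1) * 2 \<up> i"
    by (rule mult_mono) (auto simp: mult_2 add.assoc)
  then have "q \<le> c" "r \<le> c" unfolding qr(2) by (auto intro: order_trans)
  with qr show "\<exists>q. q \<le> c \<and> (\<exists>r. r \<le> c \<and> r < 2 \<up> i \<and> c = (2 * q + 1) * 2 \<up> i + r)" by blast
qed (auto simp: cmem_def)

lemma dpred_cmem [dintros]: "dterm s \<Longrightarrow> dterm t \<Longrightarrow> dpred (\<lambda>e. cmem (s e) (t e))"
  by (rule dpred_subst2) (unfold cmem_bounded, intro dintros)

lemma cmem_le: "cmem i c \<Longrightarrow> 2 \<up> i \<le> c"
proof -
  assume "cmem i c"
  then obtain q r where "c = (2 * q + 1) * 2 \<up> i + r" by (auto simp: cmem_def)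
  then have "c = 2 \<up> i + (2 * q * 2 \<up> i + r)" by (simp add: algebra_simps)
  then show ?thesis by simp
qed

lemma cmem_less: "cmem i c \<Longrightarrow> i < c"
  using cmem_le less_two_expo by (metis order.strict_trans2)

lemma cmem_less_expo: "cmem i c \<Longrightarrow> c < 2 \<up> n \<Longrightarrow> i < n"
  using cmem_le two_expo_mono by (metis not_less order.strict_trans1)

lemma not_cmem_0 [simp]: "\<not> cmem i 0"
  using cmem_less by force

lemma cmem_iff_odd: "r < 2 \<up> i \<Longrightarrow> cmem i (q * 2 \<up> i + r) \<longleftrightarrow> (\<exists>p. q = 2 * p + 1)"
  unfolding cmem_def using div_unique by metis

lemma cmem_add_expo:
  assumes c: "c < 2 \<up> n"
  shows "cmem i (c + 2 \<up> n) \<longleftrightarrow> cmem i c \<or> i = n"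
proof (cases i n rule: linorder_cases)
  case less
  then obtain z where n: "n = z + 1 + i" using less_imp_Suc by (metis add.assoc add.commute)
  obtain q r where qr: "r < 2 \<up> i" "c = q * 2 \<up> i + r" using ex_div[of "2 \<up> i" c] by auto
  \<comment> \<open>Seen from position \<open>i\<close>, adding the higher power changes the
    quotient by an even number and so preserves its parity, which is the digit.\<close>
  have "c + 2 \<up> n = (q + 2 * 2 \<up> z) * 2 \<up> i + r"
    unfolding qr(2) n by (simp add: expo_add algebra_simps)
  then have "cmem i (c + 2 \<up> n) \<longleftrightarrow> (\<exists>p. q + 2 * 2 \<up> z = 2 * p + 1)" using cmem_iff_odd qr(1) by metis
  also have "\<dots> \<longleftrightarrow> (\<exists>p. q = 2 * p + 1)"
  proof
    assume l: "\<exists>p. q + 2 * 2 \<up> z = 2 * p + 1"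
    show "\<exists>p. q = 2 * p + 1"
    proof (rule ccontr)
      assume "\<nexists>p. q = 2 * p + 1"
      then obtain p where "q = 2 * p" using parity by blast
      then have "q + 2 * 2 \<up> z = 2 * (p + 2 \<up> z)" by (simp add: algebra_simps)
      with l show False using not_even_odd by metis
    qed
  next
    assume "\<exists>p. q = 2 * p + 1"
    then obtain p where "q = 2 * p + 1" by blast
    then have "q + 2 * 2 \<up> z = 2 * (p + 2 \<up> z) + 1" by (simp add: algebra_simps)
    then show "\<exists>p. q + 2 * 2 \<up> z = 2 * p + 1" by blast
  qed
  also have "\<dots> \<longleftrightarrow> cmem i c" using cmem_iff_odd qr by metis
  finally show ?thesis using less by auto
next
  case equal
  then show ?thesis using cmem_iff_odd[OF c, of 1] by (auto intro: exI[of _ 0] simp: add.commute)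
next
  case greater
  then have "n + 1 \<le> i" by simp
  then have "2 \<up> (n + 1) \<le> 2 \<up> i" by (rule two_expo_mono)
  moreover have "c + 2 \<up> n < 2 \<up> (n + 1)" using c by (simp add: expo_Suc mult_2_right)
  ultimately have "\<not> cmem i (c + 2 \<up> n)" using cmem_le by (metis not_less order.strict_trans1)
  moreover have "\<not> cmem i c" using cmem_less_expo c greater by (metis not_less_iff_gr_or_eq)
  ultimately show ?thesis using greater by auto
qed

text \<open>Exponentiation enters here: the term \<open>2 \<up> n\<close> bounds the code, which
  makes the existence of a code a bounded statement about \<open>n\<close>. The step adds
  \<open>2 \<up> n\<close> if \<open>n\<close> belongs to the set.\<close>

theorem bounded_comprehension:
  assumes P: "dpred (\<lambda>e. P (e 0))"
  obtains c where "c < 2 \<up> n" "\<And>i. cmem i c \<longleftrightarrow> i < n \<and> P i"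
proof -
  have "\<exists>c. c < 2 \<up> n \<and> (\<forall>i. i < n \<longrightarrow> cmem i c \<longleftrightarrow> P i)"
  proof (induction n rule: dpred_induct)
    case dpred
    have "dpred (\<lambda>e. P (e 0))" by (rule P)
    then show ?case by (intro dintros)
  next
    case zero
    then show ?case by (intro exI[of _ 0]) (simp add: expo_0)
  next
    case (Suc n)
    then obtain c where c: "c < 2 \<up> n" "\<forall>i. i < n \<longrightarrow> cmem i c \<longleftrightarrow> P i" by blast
    have n: "\<not> cmem n c" using cmem_less_expo[OF _ c(1)] by blast
    show ?case
    proof (cases "P n")
      case True
      then have "\<forall>i. i < n + 1 \<longrightarrow> cmem i (c + 2 \<up> n) \<longleftrightarrow> P i"
        using c(2) n by (auto simp: cmem_add_expo[OF c(1)] le_less)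
      moreover have "c + 2 \<up> n < 2 \<up> (n + 1)" using c(1) by (simp add: expo_Suc mult_2_right)
      ultimately show ?thesis by blast
    next
      case False
      then have "\<forall>i. i < n + 1 \<longrightarrow> cmem i c \<longleftrightarrow> P i" using c(2) n by (auto simp: le_less)
      moreover have "c < 2 \<up> (n + 1)"
        using c(1) two_expo_strict_mono[of n "n + 1"] by (metis less_Suc order.refl order.strict_trans)
      ultimately show ?thesis by blast
    qed
  qed
  then show ?thesis using that cmem_less_expo by blast
qed

section \<open>Bounding\<close>

lemma cmem_high_cases:
  assumes "c < 2 \<up> (n + 1 :: 'a::rca)"
  obtains (low) "c < 2 \<up> n" "\<not> cmem n c"
  | (high) d where "d < 2 \<up> n" "c = d + 2 \<up> n" "\<And>i. cmem i c \<longleftrightarrow> cmem i d \<or> i = n"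
proof (cases "c < 2 \<up> n")
  case True
  then show ?thesis using low cmem_less_expo by blast
next
  case False
  then obtain d where d: "c = d + 2 \<up> n" by (metis le_iff_add add.commute not_less)
  then have "d < 2 \<up> n" using assms by (simp add: expo_Suc mult_2_right)
  then show ?thesis using high d cmem_add_expo by blast
qed

text \<open>Induction on the number of digits, splitting off the leading one. This gives
  extensionality of codes, and in \<open>bounding\<close> the monotonicity of codes of growing
  sets.\<close>

lemma cmem_subset_le:
  fixes c d :: "'a::rca"
  assumes "\<And>i. cmem i c \<Longrightarrow> cmem i d"
  shows "c \<le> d"
proof -
  have "\<forall>c. c < 2 \<up> n \<longrightarrow> (\<forall>d. d < 2 \<up> n \<longrightarrow> (\<forall>i. i < n \<longrightarrow> cmem i c \<longrightarrow> cmem i d) \<longrightarrow> c \<le> d)" for n :: 'a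
  proof (induction n rule: dpred_induct)
    case (Suc n)
    show ?case
    proof (intro allI HOL.impI)
      fix c d :: 'a
      assume c: "c < 2 \<up> (n + 1)" and d: "d < 2 \<up> (n + 1)"
        and s: "\<forall>i. i < n + 1 \<longrightarrow> cmem i c \<longrightarrow> cmem i d"
      show "c \<le> d"
        using d
      proof (cases rule: cmem_high_cases)
        case low
        have n: "\<not> cmem n c" using s low(2) by auto
        from c have "c < 2 \<up> n" by (cases rule: cmem_high_cases) (use n in auto)
        then show ?thesis using Suc low(1) s by (simp add: less_imp_le)
      next
        case (high d')
        from c show ?thesis
        proof (cases rule: cmem_high_cases)
          case low
          then show ?thesis using high(2) by (metis add.commute le_iff_add less_imp_le order_trans)
        next
          case (high c')
          have "\<forall>i. i < n \<longrightarrow> cmem i c' \<longrightarrow> cmem i d'"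
            using s high(3) \<open>\<And>i. cmem i d \<longleftrightarrow> cmem i d' \<or> i = n\<close>
            by (metis less_Suc less_imp_le less_irrefl)
          then have "c' \<le> d'" using Suc high(1) \<open>d' < 2 \<up> n\<close> by blast
          then show ?thesis unfolding high(2) \<open>d = d' + 2 \<up> n\<close> by (rule add_right_mono)
        qed
      qed
    qed
  qed (intro dintros, simp add: expo_0)
  moreover have "c < 2 \<up> (c + d)" "d < 2 \<up> (c + d)"
    by (metis less_two_expo le_iff_add add.commute order.strict_trans2 two_expo_mono)+
  ultimately show ?thesis using assms by blast
qed

lemma cmem_ext: "(\<And>i. cmem i c \<longleftrightarrow> cmem i d) \<Longrightarrow> c = (d :: 'a::rca)"
  by (rule antisym) (rule cmem_subset_le, simp)+

lemma not_cmem_mult: "i < m \<Longrightarrow> \<not> cmem i (q * 2 \<up> (m :: 'a::rca))"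
proof
  assume "i < m" and b: "cmem i (q * 2 \<up> m)"
  then obtain z where "m = z + 1 + i" using less_imp_Suc by (metis add.assoc add.commute)
  then have "q * 2 \<up> m = (2 * (q * 2 \<up> z)) * 2 \<up> i + 0" by (simp add: expo_add algebra_simps)
  then show False using b cmem_iff_odd[of 0 i "2 * (q * 2 \<up> z)"] not_even_odd by auto
qed

lemma cmem_mult_add:
  assumes "r < 2 \<up> m" and "m \<le> i"
  shows "cmem i (q * 2 \<up> m + r) \<longleftrightarrow> cmem i (q * 2 \<up> (m :: 'a::rca))"
proof -
  obtain z where i: "i = z + m" using \<open>m \<le> i\<close> by (metis le_iff_add add.commute)
  \<comment> \<open>Splitting \<open>q\<close> at position i - m shows that both numbers have the
    same quotient \<open>p\<close> on division by \<open>2 \<up> i\<close>.\<close>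
  obtain p s where s: "s < 2 \<up> z" "q = p * 2 \<up> z + s" using ex_div[of "2 \<up> z" q] by auto
  have "s + 1 \<le> 2 \<up> z" using s(1) by simp
  then have "(s + 1) * 2 \<up> m \<le> 2 \<up> z * 2 \<up> m" by (rule mult_right_mono) simp
  then have le: "s * 2 \<up> m + 2 \<up> m \<le> 2 \<up> i" by (simp add: i expo_add algebra_simps)
  have "s * 2 \<up> m + r < s * 2 \<up> m + 2 \<up> m" using assms(1) by simp
  then have r: "s * 2 \<up> m + r < 2 \<up> i" using le by (rule order.strict_trans2)
  have "s * 2 \<up> m < s * 2 \<up> m + 2 \<up> m" by simp
  then have r0: "s * 2 \<up> m < 2 \<up> i" using le by (rule order.strict_trans2)
  have "q * 2 \<up> m + r = p * 2 \<up> i + (s * 2 \<up> m + r)" "q * 2 \<up> m = p * 2 \<up> i + s * 2 \<up> m"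
    by (simp_all add: s(2) i expo_add algebra_simps)
  then show ?thesis using cmem_iff_odd[OF r] cmem_iff_odd[OF r0] by metis
qed

text \<open>Without a common point, the points to the left of some interval would form a \<open>\<Delta>\<^sup>0\<^sub>1\<close> cut.\<close>

lemma nested_intervals:
  fixes lo hi :: "'a::rca \<Rightarrow> 'a"
  assumes dlo: "dpred (\<lambda>e. e 0 < lo (e 1))" and dhi: "dpred (\<lambda>e. hi (e 1) \<le> e 0)"
    and lt: "\<And>w w'. lo w < hi w'"
  obtains x where "\<And>w. lo w \<le> x" "\<And>w. x < hi w"
proof (rule ccontr)
  assume "\<not> thesis"
  then have ex: "\<exists>w. x < lo w \<or> hi w \<le> x" for x using that by (meson not_less)
  have disj: "\<not> hi w' \<le> x" if "x < lo w" for x w w' using that lt[of w w'] by simp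
  have "{x. \<exists>w. x < lo w} \<in> Sets"
  proof (rule delta1_comprehension[where Q = "\<lambda>x w. \<not> hi w \<le> x"])
    show "dpred (\<lambda>e. e 0 < lo (e 1))" by (rule dlo)
    show "dpred (\<lambda>e. \<not> hi (e 1) \<le> e 0)" using dhi by (rule dpred_not)
    show "(\<exists>w. x < lo w) \<longleftrightarrow> (\<forall>w. \<not> hi w \<le> x)" for x using ex[of x] disj by blast
  qed
  note S = this
  have "x \<in> {x. \<exists>w. x < lo w}" for x
  proof (induction x rule: dpred_induct)
    case dpred
    show ?case by (rule dpred_mem[OF dterm_var S])
  next
    case zero
    have "\<not> hi w \<le> 0" for w using lt[of w w] by auto
    then show ?case using ex[of 0] by auto
  next
    case (Suc x)
    then obtain w where "x + 1 \<le> lo w" by auto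
    then have "\<not> hi w' \<le> x + 1" for w' using lt[of w w'] by (meson not_less order.strict_trans1)
    then show ?case using ex[of "x + 1"] by auto
  qed
  then obtain w where "hi 0 < lo w" by blast
  then show False using lt[of w 0] by simp
qed

text \<open>Suppose there is no bound. The set of indices below \<open>n\<close> that have a witness
  up to \<open>w\<close> keeps growing with \<open>w\<close>, while its code \<open>A w\<close>
  stays below \<open>2 \<up> n\<close>; so the values of \<open>A\<close> are cofinal in a proper
  cut. The aim is to define this cut by a bounded formula, against induction. What makes this
  possible is a single number \<open>x\<close> that codes the whole range of
  \<open>A\<close>.\<close>

theorem bounding:
  fixes n :: "'a::rca"
  assumes \<phi>: "dpred (\<lambda>e. \<phi> (e 0) (e 1))" and tot: "\<And>i. i < n \<Longrightarrow> \<exists>y. \<phi> i y"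
  obtains b where "\<And>i. i < n \<Longrightarrow> \<exists>y. y \<le> b \<and> \<phi> i y"
proof (rule ccontr)
  assume "\<not> thesis"
  then have unb: "\<exists>i. i < n \<and> (\<forall>y. y \<le> b \<longrightarrow> \<not> \<phi> i y)" for b using that by meson
  have \<phi>': "dpred (\<lambda>e. \<phi> (s e) (t e))" if "dterm s" "dterm t" for s t
    using dpred_subst2[of \<phi>, OF \<phi> that] .
  define N where "N = 2 \<up> n"
  define Co where "Co w a \<longleftrightarrow> a < N \<and> (\<forall>i. i < n \<longrightarrow> (cmem i a \<longleftrightarrow> (\<exists>y. y \<le> w \<and> \<phi> i y)))" for w a
  have dCo: "dpred (\<lambda>e. Co (s e) (t e))" if "dterm s" "dterm t" for s t
    by (rule dpred_subst2[OF _ that]) (unfold Co_def, intro dintros \<phi>')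
  have "\<exists>a. Co w a" for w
  proof -
    have "dpred (\<lambda>e. \<exists>y. y \<le> w \<and> \<phi> (e 0) y)" by (intro dintros \<phi>')
    then obtain a where "a < 2 \<up> n" "\<And>i. cmem i a \<longleftrightarrow> i < n \<and> (\<exists>y. y \<le> w \<and> \<phi> i y)"
      using bounded_comprehension[of "\<lambda>i. \<exists>y. y \<le> w \<and> \<phi> i y" n] by blast
    then show ?thesis unfolding Co_def N_def by blast
  qed
  then obtain A where A: "\<And>w. Co w (A w)" by metis
  have bitA: "cmem i (A w) \<longleftrightarrow> i < n \<and> (\<exists>y. y \<le> w \<and> \<phi> i y)" for i w
    using A[of w] cmem_less_expo unfolding Co_def N_def by blast
  have AN: "A w < N" for w using A[of w] by (simp add: Co_def)
  have Co: "Co w a \<longleftrightarrow> a = A w" for w a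
  proof
    assume "Co w a"
    then show "a = A w"
      using bitA cmem_less_expo[of _ a n] unfolding Co_def N_def by (intro cmem_ext) blast
  qed (simp add: A)
  have A_mono: "A w \<le> A w'" if "w \<le> w'" for w w'
    by (rule cmem_subset_le) (metis that bitA order_trans)
  have A_less: "\<exists>w'. A w < A w'" for w
  proof -
    obtain i where i: "i < n" "\<not> cmem i (A w)" using unb[of w] bitA by blast
    obtain y where "\<phi> i y" using tot i(1) by blast
    then have "cmem i (A (w + y))" using bitA i(1) by (metis le_iff_add add.commute)
    then have "A w \<noteq> A (w + y)" using i(2) by auto
    moreover have "A w \<le> A (w + y)" by (rule A_mono) simp
    ultimately show ?thesis by (auto simp: le_less)
  qed
  \<comment> \<open>\<open>lo w\<close> will code the set of all N - A v with v \<le> w. The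
    reversal puts later, larger values of \<open>A\<close> at lower digits, so that a larger
    \<open>w\<close> only refines the number.\<close>
  define Lo where "Lo w u \<longleftrightarrow> u < 2 \<up> (N + 1) \<and> (\<forall>j. j \<le> N \<longrightarrow>
    (cmem j u \<longleftrightarrow> (\<exists>v. v \<le> w \<and> (\<exists>a. a \<le> N \<and> a + j = N \<and> Co v a))))" for w u
  have dLo: "dpred (\<lambda>e. Lo (s e) (t e))" if "dterm s" "dterm t" for s t
    by (rule dpred_subst2[OF _ that]) (unfold Lo_def, intro dintros dCo)
  have "\<exists>u. Lo w u" for w
  proof -
    have "dpred (\<lambda>e. \<exists>v. v \<le> w \<and> (\<exists>a. a \<le> N \<and> a + e 0 = N \<and> Co v a))" by (intro dintros dCo)
    then obtain u where "u < 2 \<up> (N + 1)"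
      "\<And>j. cmem j u \<longleftrightarrow> j < N + 1 \<and> (\<exists>v. v \<le> w \<and> (\<exists>a. a \<le> N \<and> a + j = N \<and> Co v a))"
      using bounded_comprehension[of "\<lambda>j. \<exists>v. v \<le> w \<and> (\<exists>a. a \<le> N \<and> a + j = N \<and> Co v a)" "N + 1"]
      by blast
    then show ?thesis unfolding Lo_def by auto
  qed
  then obtain lo where lo: "\<And>w. Lo w (lo w)" by metis
  have bitlo: "cmem j (lo w) \<longleftrightarrow> (\<exists>v. v \<le> w \<and> A v + j = N)" for j w
  proof -
    have "cmem j (lo w) \<Longrightarrow> j \<le> N" using lo[of w] cmem_less_expo[of j "lo w" "N + 1"] by (auto simp: Lo_def)
    moreover have "A v + j = N \<Longrightarrow> j \<le> N" for v by (metis add.commute le_iff_add)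
    ultimately show ?thesis using lo[of w] AN by (auto simp: Lo_def Co less_imp_le)
  qed
  have Lo: "Lo w u \<longleftrightarrow> u = lo w" for w u
  proof
    assume u: "Lo w u"
    have "cmem j u \<Longrightarrow> j \<le> N" for j using u cmem_less_expo[of j u "N + 1"] by (auto simp: Lo_def)
    moreover have "cmem j (lo w) \<Longrightarrow> j \<le> N" for j
      using lo[of w] cmem_less_expo[of j "lo w" "N + 1"] by (auto simp: Lo_def)
    moreover have "cmem j u \<longleftrightarrow> cmem j (lo w)" if "j \<le> N" for j
      using u lo[of w] that unfolding Lo_def by simp
    ultimately have "cmem j u \<longleftrightarrow> cmem j (lo w)" for j by metis
    then show "u = lo w" by (rule cmem_ext)
  qed (simp add: lo)
  define M where "M w = N - A w" for w
  have M: "A w + m = N \<longleftrightarrow> m = M w" for w m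
  proof -
    have "A w + M w = N" using AN[of w] by (simp add: M_def less_imp_le)
    then show ?thesis by (metis add_left_cancel)
  qed
  \<comment> \<open>\<open>M w\<close> is the lowest digit set in \<open>lo w\<close>. Later stages
    change only digits below it and thus stay in the interval from \<open>lo w\<close> to
    \<open>hi w\<close>.\<close>
  define hi where "hi w = lo w + 2 \<up> M w" for w
  have high: "cmem j (lo w') \<longleftrightarrow> cmem j (lo w)" if "M w \<le> j" "w \<le> w'" for j w w'
  proof
    assume "cmem j (lo w')"
    then obtain v where v: "v \<le> w'" "A v + j = N" using bitlo by blast
    have "A v \<le> A w"
      using that(1) v(2) M[of w "M w"] by (metis add_le_cancel_right add_left_mono order_trans)
    then have "v \<le> w \<or> A v = A w" using A_mono[of w v] by (metis antisym linear)
    then show "cmem j (lo w)" using bitlo v(2) by (metis order.refl)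
  qed (metis bitlo that(2) order_trans)
  have low: "M w \<le> j" if "cmem j (lo w)" for j w
  proof -
    obtain v where v: "v \<le> w" "A v + j = N" using bitlo \<open>cmem j (lo w)\<close> by blast
    then have "A v \<le> A w" by (intro A_mono)
    then show ?thesis using v(2) M[of w "M w"] by (metis add_le_cancel_left add_right_mono)
  qed
  have mono: "lo w \<le> lo w'" if "w \<le> w'" for w w'
    by (rule cmem_subset_le) (metis that bitlo order_trans)
  have up: "lo w' < hi w" if "w \<le> w'" for w w'
  proof -
    obtain q r where qr: "r < 2 \<up> M w" "lo w' = q * 2 \<up> M w + r" using ex_div[of "2 \<up> M w" "lo w'"] by auto
    have "q * 2 \<up> M w \<le> lo w"
    proof (rule cmem_subset_le)
      fix i assume i: "cmem i (q * 2 \<up> M w)"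
      then have "M w \<le> i" using not_cmem_mult by (metis not_less)
      then show "cmem i (lo w)" using i high that cmem_mult_add[OF qr(1)] qr(2) by metis
    qed
    then show ?thesis unfolding hi_def qr(2) using qr(1) by (rule add_le_less_mono)
  qed
  have pos: "lo w < hi w" for w by (simp add: hi_def)
  have lohi: "lo w < hi w'" for w w'
  proof (cases "w \<le> w'")
    case True
    then show ?thesis using mono pos by (metis order.strict_trans1)
  next
    case False
    then show ?thesis using up by simp
  qed
  have "(x < lo w) \<longleftrightarrow> (\<exists>u. u < 2 \<up> (N + 1) \<and> Lo w u \<and> x < u)" for x w
    unfolding Lo using lo[of w] by (auto simp: Lo_def)
  then have dlo: "dpred (\<lambda>e. e 0 < lo (e 1))" by simp (intro dintros dLo)
  have "hi w \<le> x \<longleftrightarrow> (\<exists>u. u < 2 \<up> (N + 1) \<and> (\<exists>a. a < N \<and> (\<exists>m. m \<le> N \<and>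
      Lo w u \<and> Co w a \<and> a + m = N \<and> u + 2 \<up> m \<le> x)))" for x w
  proof -
    have "A w + M w = N" using M by simp
    moreover from this have "M w \<le> N" by (metis add.commute le_iff_add)
    moreover have "lo w < 2 \<up> (N + 1)" using lo[of w] by (simp add: Lo_def)
    ultimately show ?thesis unfolding Lo Co hi_def using AN[of w] M by metis
  qed
  then have dhi: "dpred (\<lambda>e. hi (e 1) \<le> e 0)" by simp (intro dintros dLo dCo)
  obtain x where x: "\<And>w. lo w \<le> x" "\<And>w. x < hi w" using nested_intervals[OF dlo dhi lohi] by blast
  \<comment> \<open>As \<open>x\<close> lies in the interval of stage \<open>w\<close>, it can
    differ from \<open>lo w\<close> only below digit \<open>M w\<close>.\<close>
  have bitx: "cmem j x \<longleftrightarrow> cmem j (lo w)" if "M w \<le> j" for j w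
  proof -
    obtain q r where qr: "r < 2 \<up> M w" "lo w = q * 2 \<up> M w + r" using ex_div[of "2 \<up> M w" "lo w"] by auto
    have "lo w \<le> q * 2 \<up> M w"
      by (rule cmem_subset_le) (use low cmem_mult_add[OF qr(1)] qr(2) in metis)
    then have q: "lo w = q * 2 \<up> M w" using qr(2) by (metis antisym le_iff_add)
    obtain s where "x = lo w + s" using x(1) le_iff_add by blast
    then have "s < 2 \<up> M w" "x = q * 2 \<up> M w + s" using x(2)[of w] q by (simp_all add: hi_def)
    then show ?thesis using cmem_mult_add that q by metis
  qed
  \<comment> \<open>Some index lies in none of the sets whose code is at most \<open>c\<close> and,
    according to \<open>x\<close>, a value of \<open>A\<close>. All quantifiers are bounded, and
    still this defines the cut: once that index has found its witness, \<open>A\<close> exceeds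
    \<open>c\<close>.\<close>
  define \<Theta> where "\<Theta> c \<longleftrightarrow> (\<exists>i. i < n \<and> (\<forall>a. a \<le> c \<longrightarrow> (\<forall>m. m \<le> N \<longrightarrow> a + m = N \<longrightarrow>
    cmem m x \<longrightarrow> \<not> cmem i a)))" for c
  have \<Theta>: "\<Theta> c \<longleftrightarrow> (\<exists>w. c \<le> A w)" for c
  proof
    assume "\<exists>w. c \<le> A w"
    then obtain w where w: "c \<le> A w" by blast
    obtain i where i: "i < n" "\<not> cmem i (A w)" using unb[of w] bitA by blast
    have "\<not> cmem i a" if a: "a \<le> c" "a + m = N" "cmem m x" for a m
    proof -
      have "a \<le> A w" using a(1) w by simp
      then have "M w \<le> m" using a(2) M[of w "M w"] by (metis add_le_cancel_left add_right_mono)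
      then obtain v where "v \<le> w" "A v + m = N" using bitx bitlo a(3) by blast
      then have "A v = a" using a(2) by (metis add_right_cancel)
      then show ?thesis using i bitA \<open>v \<le> w\<close> by (metis order_trans)
    qed
    then show "\<Theta> c" using i(1) unfolding \<Theta>_def by blast
  next
    assume "\<Theta> c"
    then obtain i where i: "i < n" "\<And>a m. a \<le> c \<Longrightarrow> m \<le> N \<Longrightarrow> a + m = N \<Longrightarrow> cmem m x \<Longrightarrow> \<not> cmem i a"
      unfolding \<Theta>_def by blast
    obtain y where "\<phi> i y" using tot i(1) by blast
    then have "cmem i (A y)" using bitA i(1) by blast
    moreover have "cmem (M y) x" using bitx[of y "M y"] bitlo M by blast
    ultimately have "\<not> A y \<le> c" using i(2)[of "A y" "M y"] M by (metis add.commute le_iff_add)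
    then show "\<exists>w. c \<le> A w" by (meson linear)
  qed
  \<comment> \<open>\<open>A\<close> never becomes constant, so the cut is closed under successor.
    Induction then puts \<open>N\<close> into it, although all values of \<open>A\<close> are below
    \<open>N\<close>.\<close>
  have "\<Theta> c" for c
  proof (induction c rule: dpred_induct)
    case dpred
    show ?case unfolding \<Theta>_def by (intro dintros)
  next
    case zero
    show ?case using \<Theta> by auto
  next
    case (Suc c)
    then obtain w w' where "c \<le> A w" "A w < A w'" using \<Theta> A_less by blast
    then show ?case unfolding \<Theta> by (intro exI[of _ w']) auto
  qed
  then show False using \<Theta>[of N] AN by (meson not_less)
qed

section \<open>Finite sequences and the fast growing functions\<close>

definition nthm :: "'a::rca \<Rightarrow> 'a \<Rightarrow> 'a \<Rightarrow> bool" where "nthm s i a \<longleftrightarrow> cmem (pr i a) s"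

definition seqm :: "'a::rca \<Rightarrow> 'a \<Rightarrow> bool" where
  "seqm s l \<longleftrightarrow> (\<forall>z. cmem z s \<longrightarrow> (\<exists>i a. i < l \<and> z = pr i a)) \<and>
    (\<forall>i. i < l \<longrightarrow> (\<exists>!a. nthm s i a))"

primrec fgm :: "nat \<Rightarrow> 'a::rca \<Rightarrow> 'a \<Rightarrow> bool" where
  "fgm 0 x y \<longleftrightarrow> y = x + 1"
| "fgm (Suc h) x y \<longleftrightarrow> (\<exists>s. seqm s (x + 2) \<and> nthm s 0 x \<and> nthm s (x + 1) y \<and>
    (\<forall>i a b. i < x + 1 \<and> nthm s i a \<and> nthm s (i + 1) b \<longrightarrow> fgm h a b))"

lemma dpred_nthm [dintros]:
  "dterm s \<Longrightarrow> dterm i \<Longrightarrow> dterm a \<Longrightarrow> dpred (\<lambda>e. nthm (s e) (i e) (a e))"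
  unfolding nthm_def by (intro dintros)

lemma nthm_le: "nthm s i a \<Longrightarrow> a \<le> (s :: 'a::rca)"
  unfolding nthm_def using cmem_less le_pr2 by (metis less_imp_le order_trans)

lemma nthm_index_le: "nthm s i a \<Longrightarrow> i \<le> (s :: 'a::rca)"
  unfolding nthm_def using cmem_less le_pr1 by (metis less_imp_le order_trans)

lemma seqm_index: "seqm s l \<Longrightarrow> nthm s i a \<Longrightarrow> i < l"
proof -
  assume "seqm s l" "nthm s i a"
  then obtain j b where "j < l" "pr i a = pr j b" unfolding seqm_def nthm_def by meson
  then show "i < l" by simp
qed

lemma seqm_unique: "seqm s l \<Longrightarrow> nthm s i a \<Longrightarrow> nthm s i b \<Longrightarrow> a = b"
proof -
  assume s: "seqm s l" "nthm s i a" "nthm s i b"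
  then have "\<exists>!a. nthm s i a" using seqm_index[OF s(1,2)] unfolding seqm_def by simp
  then show "a = b" using s(2,3) by blast
qed

lemma seqm_ex: "seqm s l \<Longrightarrow> i < l \<Longrightarrow> \<exists>a. nthm s i a"
  unfolding seqm_def by blast

lemma dpred_seqm [dintros]: "dterm s \<Longrightarrow> dterm l \<Longrightarrow> dpred (\<lambda>e. seqm (s e) (l e))"
proof (rule dpred_subst2)
  have "seqm s l \<longleftrightarrow> (\<forall>z. z \<le> s \<longrightarrow> cmem z s \<longrightarrow> (\<exists>i. i < l \<and> (\<exists>a. a \<le> s \<and> z = pr i a))) \<and>
    (\<forall>i. i < l \<longrightarrow> (\<exists>a. a \<le> s \<and> nthm s i a \<and> (\<forall>b. b \<le> s \<longrightarrow> nthm s i b \<longrightarrow> b = a)))"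
    (is "_ \<longleftrightarrow> ?A \<and> ?B") for s l :: 'a
  proof (intro iffI conjI)
    assume s: "seqm s l"
    show ?A
    proof (intro allI HOL.impI)
      fix z assume "cmem z s"
      then obtain i a where "i < l" "z = pr i a" using s unfolding seqm_def by blast
      moreover have "a \<le> s" using nthm_le[of s i a] \<open>cmem z s\<close> \<open>z = pr i a\<close> by (simp add: nthm_def)
      ultimately show "\<exists>i. i < l \<and> (\<exists>a. a \<le> s \<and> z = pr i a)" by blast
    qed
    show ?B using seqm_ex[OF s] seqm_unique[OF s] nthm_le by metis
  next
    assume *: "?A \<and> ?B"
    then have "\<forall>z. cmem z s \<longrightarrow> (\<exists>i a. i < l \<and> z = pr i a)"
      using cmem_less by (metis less_imp_le)
    moreover have "\<exists>!a. nthm s i a" if "i < l" for i using * that nthm_le by metis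
    ultimately show "seqm s l" by (simp add: seqm_def)
  qed
  then show "dpred (\<lambda>e. seqm (e 0 :: 'a) (e 1))" by (simp only:) (intro dintros)
qed

text \<open>The common bound \<open>b\<close> confines the relevant pairs to numbers up to
  \<open>pr l b\<close>, where bounded comprehension applies. For values of an arbitrary function of
  the model, such a \<open>b\<close> comes from \<open>bounding\<close>. The resulting bound on
  \<open>s\<close> serves to define iteration by a bounded formula.\<close>

lemma ex_seqm:
  assumes \<phi>: "dpred (\<lambda>e. \<phi> (e 0) (e 1))"
    and ex: "\<forall>i. i < l \<longrightarrow> (\<exists>a. a \<le> b \<and> \<phi> i a)"
    and un: "\<forall>i a a'. i < l \<longrightarrow> \<phi> i a \<longrightarrow> \<phi> i a' \<longrightarrow> a = a'"
  obtains s where "s < 2 \<up> (pr l b + 1)" "seqm s l" "\<And>i a. nthm s i a \<longleftrightarrow> i < l \<and> \<phi> i a"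
proof -
  have \<phi>': "dpred (\<lambda>e. \<phi> (s e) (t e))" if "dterm s" "dterm t" for s t
    using dpred_subst2[of \<phi>, OF \<phi> that] .
  have "dpred (\<lambda>e. \<exists>i. i < l \<and> (\<exists>a. a \<le> b \<and> e 0 = pr i a \<and> \<phi> i a))" by (intro dintros \<phi>')
  then obtain s where s: "s < 2 \<up> (pr l b + 1)"
    "\<And>z. cmem z s \<longleftrightarrow> z < pr l b + 1 \<and> (\<exists>i. i < l \<and> (\<exists>a. a \<le> b \<and> z = pr i a \<and> \<phi> i a))"
    using bounded_comprehension[of "\<lambda>z. \<exists>i. i < l \<and> (\<exists>a. a \<le> b \<and> z = pr i a \<and> \<phi> i a)" "pr l b + 1"]
    by blast
  have nth: "nthm s i a \<longleftrightarrow> i < l \<and> \<phi> i a" for i a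
  proof -
    have "a \<le> b" if "i < l" "\<phi> i a" using ex un that by metis
    then show ?thesis unfolding nthm_def s(2) by (auto simp: less_imp_le pr_mono)
  qed
  have "seqm s l"
    unfolding seqm_def
  proof (intro conjI allI HOL.impI)
    show "\<exists>i a. i < l \<and> z = pr i a" if "cmem z s" for z using that s(2) by blast
    show "\<exists>!a. nthm s i a" if "i < l" for i using nth ex un that by metis
  qed
  then show ?thesis using that s(1) nth by blast
qed

lemma seqm_less:
  assumes s: "seqm s l" and step: "\<And>i a b. nthm s i a \<Longrightarrow> nthm s (i + 1) b \<Longrightarrow> a < b"
    and ij: "i < j" "nthm s i a" "nthm s j b"
  shows "a < (b :: 'a::rca)"
proof -
  have "i < j \<longrightarrow> (\<forall>b. b \<le> s \<longrightarrow> nthm s j b \<longrightarrow> a < b)" for j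
  proof (induction j rule: dpred_induct)
    case (Suc j)
    show ?case
    proof (intro HOL.impI allI)
      fix b assume "i < j + 1" and b: "nthm s (j + 1) b"
      then have "j < l" using seqm_index[OF s b] by (metis less_Suc less_imp_le order.strict_trans1 order.refl)
      then obtain c where c: "nthm s j c" using seqm_ex[OF s] by blast
      consider "i < j" | "i = j" using \<open>i < j + 1\<close> by (auto simp: le_less)
      then show "a < b"
      proof cases
        case 1
        then show ?thesis using Suc c nthm_le[OF c] step[OF c b] by (metis order.strict_trans)
      next
        case 2
        then show ?thesis using step ij(2) b by blast
      qed
    qed
  qed (intro dintros, simp)
  then show ?thesis using ij nthm_le by blast
qed

text \<open>Properties that pass from the graph of F_h to that of F_(h+1), so that induction on the
  external number \<open>h\<close> takes place in HOL. Totality is left out because it need not pass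
  to the iterate.\<close>

locale growing =
  fixes G :: "'a::rca \<Rightarrow> 'a \<Rightarrow> bool"
  assumes definable: "dpred (\<lambda>e. G (e 0) (e 1))"
    and unique: "G x y \<Longrightarrow> G x y' \<Longrightarrow> y = y'"
    and inflationary: "G x y \<Longrightarrow> x < y"
    and strict_mono: "G x y \<Longrightarrow> G x' y' \<Longrightarrow> x < x' \<Longrightarrow> y < y'"
begin

definition run :: "'a \<Rightarrow> 'a \<Rightarrow> bool" where
  "run x s \<longleftrightarrow> seqm s (x + 2) \<and> nthm s 0 x \<and>
    (\<forall>i a b. i < x + 1 \<and> nthm s i a \<and> nthm s (i + 1) b \<longrightarrow> G a b)"

definition iter :: "'a \<Rightarrow> 'a \<Rightarrow> bool" where "iter x y \<longleftrightarrow> (\<exists>s. run x s \<and> nthm s (x + 1) y)"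

lemma run_seqm: "run x s \<Longrightarrow> seqm s (x + 2)" and run_zero: "run x s \<Longrightarrow> nthm s 0 x"
  by (simp_all add: run_def)

lemma less_add_two: "i < x + 2 \<longleftrightarrow> i \<le> x + (1 :: 'a)"
  using less_Suc[of i "x + 1"] by (simp add: add.assoc one_add_one)

lemma run_step: "run x s \<Longrightarrow> nthm s i a \<Longrightarrow> nthm s (i + 1) b \<Longrightarrow> G a b"
proof -
  assume *: "run x s" "nthm s i a" "nthm s (i + 1) b"
  have "i + 1 \<le> x + 1" using seqm_index[OF run_seqm[OF *(1)] *(3)] by (simp only: less_add_two)
  then have "i < x + 1" by (simp only: Suc_le)
  then show "G a b" using * unfolding run_def by blast
qed

lemma run_less: "run x s \<Longrightarrow> i < j \<Longrightarrow> nthm s i a \<Longrightarrow> nthm s j b \<Longrightarrow> a < b"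
proof -
  assume r: "run x s"
  show "i < j \<Longrightarrow> nthm s i a \<Longrightarrow> nthm s j b \<Longrightarrow> a < b"
    by (rule seqm_less[OF run_seqm[OF r] inflationary[OF run_step[OF r]]])
qed

lemma run_le: "run x s \<Longrightarrow> i \<le> j \<Longrightarrow> nthm s i a \<Longrightarrow> nthm s j b \<Longrightarrow> a \<le> b"
  using run_less[of x s i j a b] seqm_unique[OF run_seqm, of x s i a b] by (auto simp: le_less)

text \<open>The entries of a run increase up to the final value \<open>y\<close>, so a term in
  \<open>x\<close> and \<open>y\<close> bounds the code of the run. Hence each F_h has a
  bounded-definable graph, however fast it grows.\<close>

lemma iter_bounded:
  "iter x y \<longleftrightarrow> (\<exists>s. s < 2 \<up> (pr (x + 2) y + 1) \<and> seqm s (x + 2) \<and> nthm s 0 x \<and>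
    nthm s (x + 1) y \<and> (\<forall>i. i < x + 1 \<longrightarrow> (\<forall>a. a \<le> s \<longrightarrow> (\<forall>b. b \<le> s \<longrightarrow>
    nthm s i a \<and> nthm s (i + 1) b \<longrightarrow> G a b))))" (is "_ \<longleftrightarrow> (\<exists>s. ?R s)")
proof
  assume "iter x y"
  then obtain s where s: "run x s" "nthm s (x + 1) y" unfolding iter_def by blast
  note sq = run_seqm[OF s(1)]
  have e: "\<forall>i. i < x + 2 \<longrightarrow> (\<exists>a. a \<le> y \<and> nthm s i a)"
    using seqm_ex[OF sq] run_le[OF s(1) _ _ s(2)] unfolding less_add_two by blast
  have d: "dpred (\<lambda>e. nthm s (e 0) (e 1))" by (intro dintros)
  have u: "\<forall>i a a'. i < x + 2 \<longrightarrow> nthm s i a \<longrightarrow> nthm s i a' \<longrightarrow> a = a'"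
    using seqm_unique[OF sq] by blast
  obtain t where t: "t < 2 \<up> (pr (x + 2) y + 1)" "seqm t (x + 2)"
    "\<And>i a. nthm t i a \<longleftrightarrow> i < x + 2 \<and> nthm s i a"
    using ex_seqm[of "nthm s" "x + 2" y, OF d e u] by blast
  have "nthm t i a \<longleftrightarrow> nthm s i a" for i a using t(3) seqm_index[OF sq] by blast
  then have "?R t" using t(1,2) s unfolding run_def by simp
  then show "\<exists>s. ?R s" ..
next
  assume "\<exists>s. ?R s"
  then obtain s where "?R s" ..
  then have "run x s" unfolding run_def using nthm_le by blast
  then show "iter x y" using \<open>?R s\<close> unfolding iter_def by blast
qed

lemma definable_iter: "dpred (\<lambda>e. iter (e 0) (e 1))"
proof -
  have G: "dpred (\<lambda>e. G (s e) (t e))" if "dterm s" "dterm t" for s t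
    using definable that by (rule dpred_subst2)
  show ?thesis unfolding iter_bounded by (intro dintros G)
qed

lemma iter_inflationary: "iter x y \<Longrightarrow> x < y"
proof -
  assume "iter x y"
  then obtain s where s: "run x s" "nthm s (x + 1) y" unfolding iter_def by blast
  have "0 < x + 1" by simp
  then show ?thesis using run_less[OF s(1) _ run_zero[OF s(1)] s(2)] by blast
qed

lemma run_unique:
  assumes s: "run x s" and s': "run x s'"
  shows "nthm s i a \<Longrightarrow> nthm s' i b \<Longrightarrow> a = b"
proof -
  note sq = run_seqm[OF s] run_seqm[OF s']
  have "\<forall>a. a \<le> s \<longrightarrow> (\<forall>b. b \<le> s' \<longrightarrow> nthm s i a \<longrightarrow> nthm s' i b \<longrightarrow> a = b)"
  proof (induction i rule: dpred_induct)
    case zero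
    have "nthm s 0 a \<Longrightarrow> a = x" "nthm s' 0 a \<Longrightarrow> a = x" for a
      using seqm_unique[OF sq(1)] seqm_unique[OF sq(2)] run_zero[OF s] run_zero[OF s'] by blast+
    then show ?case by metis
  next
    case (Suc i)
    show ?case
    proof (intro allI HOL.impI)
      fix a b assume a: "nthm s (i + 1) a" and b: "nthm s' (i + 1) b"
      have i: "i < x + 2"
        using seqm_index[OF sq(1) a] by (rule order.strict_trans[rotated]) simp
      obtain c d where c: "nthm s i c" "nthm s' i d"
        using seqm_ex[OF sq(1) i] seqm_ex[OF sq(2) i] by blast
      then have "c = d" using Suc nthm_le by blast
      then show "a = b" using run_step[OF s c(1) a] run_step[OF s' c(2) b] unique by metis
    qed
  qed (intro dintros)
  then show "nthm s i a \<Longrightarrow> nthm s' i b \<Longrightarrow> a = b" using nthm_le by blast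
qed

lemma run_mono:
  assumes s: "run x s" and s': "run x' s'" and "x < x'"
  shows "nthm s i a \<Longrightarrow> nthm s' i b \<Longrightarrow> a < b"
proof -
  note sq = run_seqm[OF s] run_seqm[OF s']
  have "\<forall>a. a \<le> s \<longrightarrow> (\<forall>b. b \<le> s' \<longrightarrow> nthm s i a \<longrightarrow> nthm s' i b \<longrightarrow> a < b)"
  proof (induction i rule: dpred_induct)
    case zero
    have "a < b" if "nthm s 0 a" "nthm s' 0 b" for a b
      using seqm_unique[OF sq(1) that(1) run_zero[OF s]] seqm_unique[OF sq(2) that(2) run_zero[OF s']]
        \<open>x < x'\<close> by simp
    then show ?case by blast
  next
    case (Suc i)
    show ?case
    proof (intro allI HOL.impI)
      fix a b assume a: "nthm s (i + 1) a" and b: "nthm s' (i + 1) b"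
      have "i < i + 1" by simp
      then have i: "i < x + 2" "i < x' + 2"
        using seqm_index[OF sq(1) a] seqm_index[OF sq(2) b] by (meson order.strict_trans)+
      obtain c d where c: "nthm s i c" "nthm s' i d"
        using seqm_ex[OF sq(1) i(1)] seqm_ex[OF sq(2) i(2)] by blast
      then have "c < d" using Suc nthm_le by blast
      then show "a < b" using run_step[OF s c(1) a] run_step[OF s' c(2) b] strict_mono by blast
    qed
  qed (intro dintros)
  then show "nthm s i a \<Longrightarrow> nthm s' i b \<Longrightarrow> a < b" using nthm_le by blast
qed

text \<open>The run from \<open>x'\<close> lies above the run from \<open>x\<close> entry by entry
  and makes at least one more step. The two strict inequalities together give the gain of 2 on which
  the growth estimates for \<open>h > 0\<close> rest.\<close>

lemma iter_strict_mono:
  assumes "iter x y" "iter x' y'" "x < x'"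
  shows "y + 1 < y'"
proof -
  obtain s where s: "run x s" "nthm s (x + 1) y" using assms(1) unfolding iter_def by blast
  obtain s' where s': "run x' s'" "nthm s' (x' + 1) y'" using assms(2) unfolding iter_def by blast
  have x: "x + 1 < x' + 1" using assms(3) by (rule add_strict_right_mono)
  then have "x + 1 < x' + 2" unfolding less_add_two by (rule less_imp_le)
  then obtain b where b: "nthm s' (x + 1) b" using seqm_ex[OF run_seqm[OF s'(1)]] by blast
  have "y + 1 \<le> b" using run_mono[OF s(1) s'(1) assms(3) s(2) b] by simp
  also have "b < y'" using run_less[OF s'(1) x b s'(2)] .
  finally show ?thesis .
qed

lemma iter_unique: "iter x y \<Longrightarrow> iter x y' \<Longrightarrow> y = y'"
  unfolding iter_def by (elim exE conjE) (rule run_unique)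

lemma iter_strict_mono': "iter x y \<Longrightarrow> iter x' y' \<Longrightarrow> x < x' \<Longrightarrow> y < y'"
  by (drule (2) iter_strict_mono) (erule order.strict_trans[rotated], simp)

lemma growing_iter: "growing iter"
  by unfold_locales
    (fact definable_iter, erule (1) iter_unique, erule iter_inflationary, erule (2) iter_strict_mono')

end

lemma (in growing) fgm_Suc_iter: "fgm h = G \<Longrightarrow> fgm (Suc h) = iter"
  by (intro ext) (simp only: fgm.simps iter_def run_def conj_ac)

lemma growing_fgm_0: "growing (fgm 0 :: 'a::rca \<Rightarrow> 'a \<Rightarrow> bool)"
proof
  have "dpred (\<lambda>e. e 1 = e 0 + (1 :: 'a))" by (intro dintros)
  then show "dpred (\<lambda>e. fgm 0 (e 0) (e 1 :: 'a))" by (simp only: fgm.simps)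
qed (simp_all only: fgm.simps less_Suc order.refl Suc_le)

lemma growing_fgm: "growing (fgm h :: 'a::rca \<Rightarrow> 'a \<Rightarrow> bool)"
proof (induction h)
  case 0
  show ?case by (rule growing_fgm_0)
next
  case (Suc h)
  show ?case
    by (subst growing.fgm_Suc_iter[OF Suc refl]) (rule growing.growing_iter[OF Suc])
qed

lemma fgm_Suc_strict_mono: "fgm (Suc h) x y \<Longrightarrow> fgm (Suc h) x' y' \<Longrightarrow> x < x' \<Longrightarrow> y + 1 < (y' :: 'a::rca)"
  by (simp only: growing.fgm_Suc_iter[OF growing_fgm refl]) (rule growing.iter_strict_mono[OF growing_fgm])

lemmas fgm_unique = growing.unique[OF growing_fgm]
  and fgm_less = growing.inflationary[OF growing_fgm]
  and fgm_strict_mono = growing.strict_mono[OF growing_fgm]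
  and dpred_fgm [dintros] = dpred_subst2[of "fgm h" for h, OF growing.definable[OF growing_fgm]]

section \<open>The three principles in a model\<close>

definition app :: "'a::rca set \<Rightarrow> 'a \<Rightarrow> 'a \<Rightarrow> bool" where "app f x y \<longleftrightarrow> pr x y \<in> f"

definition funcm :: "'a::rca set \<Rightarrow> ('a \<Rightarrow> bool) \<Rightarrow> ('a \<Rightarrow> bool) \<Rightarrow> bool" where
  "funcm f A B \<longleftrightarrow> (\<forall>z. z \<in> f \<longrightarrow> (\<exists>x y. A x \<and> B y \<and> z = pr x y)) \<and> (\<forall>x. A x \<longrightarrow> (\<exists>!y. app f x y))"

definition rngm :: "'a::rca set \<Rightarrow> 'a \<Rightarrow> bool" where "rngm f y \<longleftrightarrow> (\<exists>x. app f x y)"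

definition pairsm :: "('a::rca \<Rightarrow> bool) \<Rightarrow> 'a \<Rightarrow> bool" where
  "pairsm A z \<longleftrightarrow> (\<exists>x y. A x \<and> A y \<and> x < y \<and> z = pr x y)"

definition enumm :: "'a::rca \<Rightarrow> 'a \<Rightarrow> 'a \<Rightarrow> bool" where
  "enumm s l Y \<longleftrightarrow> seqm s l \<and> (\<forall>i j a b. nthm s i a \<and> nthm s j b \<and> i < j \<longrightarrow> a < b) \<and>
    (\<forall>y. cmem y Y \<longleftrightarrow> (\<exists>i. nthm s i y))"

definition one_large :: "'a::rca \<Rightarrow> bool" where
  "one_large Y \<longleftrightarrow> (\<exists>a l. (cmem a Y \<and> (\<forall>y. cmem y Y \<longrightarrow> a \<le> y)) \<and> (\<exists>s. enumm s l Y) \<and> a < l)"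

definition weakly_homogeneous :: "'a::rca set \<Rightarrow> 'a \<Rightarrow> bool" where
  "weakly_homogeneous P Y \<longleftrightarrow> (\<exists>s l. enumm s l Y \<and>
    (\<exists>c. \<forall>n a b. nthm s n a \<and> nthm s (n + 1) b \<longrightarrow> app P (pr a b) c))"

definition less_fg :: "nat \<Rightarrow> 'a::rca \<Rightarrow> 'a \<Rightarrow> bool" where
  "less_fg h y x \<longleftrightarrow> (\<exists>z. fgm h x z \<and> y < z)"

definition growth_below :: "nat \<Rightarrow> 'a::rca set \<Rightarrow> bool" where
  "growth_below h f \<longleftrightarrow> (\<forall>n a b. app f n a \<and> app f (n + 1) b \<longrightarrow> less_fg h b a)"

abbreviation relm :: "'a::rca set \<Rightarrow> 'a \<Rightarrow> 'a \<Rightarrow> bool" where "relm R a b \<equiv> pr a b \<in> R"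

definition rel_on :: "'a::rca set \<Rightarrow> 'a set \<Rightarrow> bool" where
  "rel_on R S \<longleftrightarrow> (\<forall>z. z \<in> R \<longrightarrow> (\<exists>a b. a \<in> S \<and> b \<in> S \<and> z = pr a b))"

definition rel_union :: "'a::rca set list \<Rightarrow> 'a \<Rightarrow> 'a \<Rightarrow> bool" where
  "rel_union Rs a b \<longleftrightarrow> (\<exists>R \<in> set Rs. relm R a b)"

definition dec_seq :: "'a::rca set \<Rightarrow> 'a \<Rightarrow> 'a \<Rightarrow> bool" where
  "dec_seq Q s l \<longleftrightarrow> seqm s l \<and> (\<forall>i a b. nthm s i a \<and> nthm s (i + 1) b \<longrightarrow> relm Q b a)"

definition is_bound :: "'a::rca set \<Rightarrow> 'a set \<Rightarrow> 'a set \<Rightarrow> bool" where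
  "is_bound g Q S \<longleftrightarrow> funcm g (\<lambda>x. x \<in> S) (\<lambda>_. True) \<and>
    (\<forall>s l a u. dec_seq Q s l \<and> (\<forall>i b. nthm s i b \<longrightarrow> b \<in> S) \<and> nthm s 0 a \<and> app g a u \<longrightarrow> l \<le> u)"

definition fbounded :: "nat \<Rightarrow> 'a::rca set \<Rightarrow> 'a set \<Rightarrow> 'a set \<Rightarrow> bool" where
  "fbounded h S R g \<longleftrightarrow> rel_on R S \<and> is_bound g R S \<and>
    (\<forall>n u. n \<in> S \<and> app g n u \<longrightarrow> less_fg h u n)"

definition all_fbounded :: "nat \<Rightarrow> 'a::rca set \<Rightarrow> 'a set list \<Rightarrow> 'a set list \<Rightarrow> bool" where
  "all_fbounded h S Rs gs \<longleftrightarrow> (\<forall>(R, g) \<in> set (zip Rs gs). fbounded h S R g)"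

definition trans_cl :: "'a::rca set \<Rightarrow> 'a \<Rightarrow> 'a \<Rightarrow> bool" where
  "trans_cl R b a \<longleftrightarrow> (\<exists>s j. dec_seq R s (j + 2) \<and> nthm s 0 a \<and> nthm s (j + 1) b)"

definition well_founded :: "'a::rca set \<Rightarrow> bool" where
  "well_founded R \<longleftrightarrow> \<not> (\<exists>g \<in> Sets. funcm g (\<lambda>_. True) (\<lambda>_. True) \<and>
    (\<forall>n a b. app g n a \<and> app g (n + 1) b \<longrightarrow> relm R b a))"

definition deterministic :: "'a::rca set \<Rightarrow> bool" where
  "deterministic R \<longleftrightarrow> (\<forall>a b c. relm R b a \<and> relm R c a \<longrightarrow> b = c)"

definition transition_function :: "'a::rca set \<Rightarrow> 'a set \<Rightarrow> bool" where
  "transition_function f R \<longleftrightarrow> funcm f (\<lambda>_. True) (\<lambda>_. True) \<and>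
    (\<forall>z. z \<in> R \<longleftrightarrow> (\<exists>n a b. app f n a \<and> app f (n + 1) b \<and> z = pr b a))"

definition increasing :: "'a::rca set \<Rightarrow> bool" where
  "increasing f \<longleftrightarrow> (\<forall>n a b. app f n a \<and> app f (n + 1) b \<longrightarrow> a < b)"

definition transitive_decreasing :: "'a::rca set list \<Rightarrow> 'a set \<Rightarrow> bool" where
  "transitive_decreasing Rs f \<longleftrightarrow> (\<forall>n m a b. n < m \<and> app f n a \<and> app f m b \<longrightarrow> rel_union Rs b a)"

definition set_lists :: "nat \<Rightarrow> 'a::rca set list set" where
  "set_lists k = {Xs. length Xs = k \<and> set Xs \<subseteq> Sets}"

definition wph :: "'a::rca itself \<Rightarrow> nat \<Rightarrow> nat \<Rightarrow> bool" where
  "wph _ h k \<longleftrightarrow> (\<forall>f \<in> (Sets :: 'a set set).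
    funcm f (\<lambda>_. True) (\<lambda>_. True) \<and> increasing f \<and> growth_below h f \<longrightarrow>
    (\<forall>P \<in> Sets. funcm P (pairsm (rngm f)) (\<lambda>x. x < of_nat k) \<longrightarrow>
      (\<exists>Y. (\<forall>y. cmem y Y \<longrightarrow> rngm f y) \<and> one_large Y \<and> weakly_homogeneous P Y)))"

definition hct :: "'a::rca itself \<Rightarrow> nat \<Rightarrow> nat \<Rightarrow> bool" where
  "hct _ h k \<longleftrightarrow> (\<forall>S \<in> (Sets :: 'a set set). \<forall>Rs \<in> set_lists k. \<forall>gs \<in> set_lists k.
    all_fbounded h S Rs gs \<longrightarrow>
    \<not> (\<exists>f \<in> Sets. funcm f (\<lambda>_. True) (\<lambda>_. True) \<and> transitive_decreasing Rs f \<and> growth_below h f))"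

definition tt :: "'a::rca itself \<Rightarrow> nat \<Rightarrow> nat \<Rightarrow> bool" where
  "tt _ h k \<longleftrightarrow> (\<forall>R \<in> (Sets :: 'a set set).
    deterministic R \<and> (\<exists>f \<in> Sets. transition_function f R \<and> growth_below h f) \<longrightarrow>
    (\<exists>S \<in> Sets. \<exists>Rs \<in> set_lists k. \<exists>gs \<in> set_lists k.
      all_fbounded h S Rs gs \<and> (\<forall>a b. trans_cl R b a \<longrightarrow> rel_union Rs b a)) \<longrightarrow>
    well_founded R)"

definition tot :: "'a::rca itself \<Rightarrow> nat \<Rightarrow> bool" where
  "tot _ h \<longleftrightarrow> (\<forall>x :: 'a. \<exists>y. fgm h x y)"

section \<open>Functions of a model, and \<open>HCT\<close> implies \<open>TT\<close>\<close>

lemma dpred_app [dintros]: "dterm s \<Longrightarrow> dterm t \<Longrightarrow> f \<in> Sets \<Longrightarrow> dpred (\<lambda>e. app f (s e) (t e))"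
  unfolding app_def by (intro dintros)

lemma funcm_total:
  assumes "funcm f (\<lambda>_. True) (\<lambda>_. True)"
  obtains F where "\<And>n a. app f n a \<longleftrightarrow> a = F n"
proof -
  have "\<forall>n. \<exists>a. \<forall>b. app f n b \<longleftrightarrow> b = a" using assms unfolding funcm_def by metis
  then show ?thesis using that by metis
qed

lemma funcmI:
  assumes "\<And>n a. app f n a \<longleftrightarrow> a = F n" and "\<And>z. z \<in> f \<Longrightarrow> \<exists>x y. z = pr x y"
  shows "funcm f (\<lambda>_. True) (\<lambda>_. True)"
  unfolding funcm_def using assms by auto

text \<open>Below an external number a model has only external numbers, so colours can be matched
  with positions in a list of relations.\<close>

lemma less_of_nat: "x < of_nat k \<Longrightarrow> \<exists>i<k. x = (of_nat i :: 'a::rca)"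
proof (induction k)
  case (Suc k)
  then have "x < of_nat k + 1" by (simp add: add.commute)
  then have "x < of_nat k \<or> x = of_nat k" by (simp only: less_Suc le_less)
  then show ?case using Suc.IH less_Suc_eq by metis
qed simp

lemma ex_seqm':
  assumes "dpred (\<lambda>e. \<phi> (e 0) (e 1))" "\<forall>i. i < l \<longrightarrow> (\<exists>a. a \<le> b \<and> \<phi> i a)"
    and "\<forall>i a a'. i < l \<longrightarrow> \<phi> i a \<longrightarrow> \<phi> i a' \<longrightarrow> a = a'"
  shows "\<exists>s. seqm s l \<and> (\<forall>i a. nthm s i a \<longleftrightarrow> i < l \<and> \<phi> i a)"
  by (rule ex_seqm[of \<phi> l b, OF assms]) blast

lemma hct_imp_tt:
  assumes "hct TYPE('a::rca) h k"
  shows "tt TYPE('a) h k"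
  unfolding tt_def
proof (intro ballI HOL.impI)
  fix R :: "'a set"
  assume "deterministic R \<and> (\<exists>f \<in> Sets. transition_function f R \<and> growth_below h f)"
    and "\<exists>S \<in> Sets. \<exists>Rs \<in> set_lists k. \<exists>gs \<in> set_lists k.
      all_fbounded h S Rs gs \<and> (\<forall>a b. trans_cl R b a \<longrightarrow> rel_union Rs b a)"
  then obtain f S Rs gs where f: "f \<in> Sets" "transition_function f R" "growth_below h f"
    and S: "S \<in> Sets" "Rs \<in> set_lists k" "gs \<in> set_lists k" "all_fbounded h S Rs gs"
    and tc: "\<And>a b. trans_cl R b a \<Longrightarrow> rel_union Rs b a" by (elim conjE bexE) auto
  have fn: "funcm f (\<lambda>_. True) (\<lambda>_. True)" using f(2) by (simp add: transition_function_def)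
  then obtain F where F: "\<And>n a. app f n a \<longleftrightarrow> a = F n" using funcm_total by metis
  have RF: "relm R (F (n + 1)) (F n)" for n
    using f(2) unfolding transition_function_def F by blast
  have "transitive_decreasing Rs f"
    unfolding transitive_decreasing_def
  proof (intro allI HOL.impI)
    fix n m a b assume *: "n < m \<and> app f n a \<and> app f m b"
    then obtain j where j: "m = n + j + 1" using less_imp_Suc by metis
    have d: "dpred (\<lambda>e. app f (n + e 0) (e 1))" by (intro dintros f)
    \<comment> \<open>The stretch from f(n) to f(m) needs bounded values to be coded. It has j + 2
      terms, both ends included.\<close>
    obtain v where v: "\<And>i. i < j + 2 \<Longrightarrow> \<exists>y. y \<le> v \<and> app f (n + i) y"
      using bounding[of "\<lambda>i. app f (n + i)" "j + 2", OF d] F by metis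
    have e: "\<forall>i. i < j + 2 \<longrightarrow> (\<exists>y. y \<le> v \<and> app f (n + i) y)" using v by blast
    have u: "\<forall>i y y'. i < j + 2 \<longrightarrow> app f (n + i) y \<longrightarrow> app f (n + i) y' \<longrightarrow> y = y'" using F by auto
    obtain s where s: "seqm s (j + 2)" "\<And>i a. nthm s i a \<longleftrightarrow> i < j + 2 \<and> app f (n + i) a"
      using ex_seqm'[of "\<lambda>i. app f (n + i)" "j + 2" v, OF d e u] by (elim exE conjE) simp
    have j2: "j + 1 < j + 2" by simp
    have j3: "0 < j + 2" using j2 by (rule order.strict_trans1[rotated]) simp
    have "dec_seq R s (j + 2)"
      unfolding dec_seq_def s(2) F using s(1) RF by (simp add: add.assoc[symmetric])
    moreover have "nthm s 0 a" "nthm s (j + 1) b"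
      using * j2 j3 unfolding s(2) j by (simp_all add: add.assoc)
    ultimately have "trans_cl R b a" unfolding trans_cl_def by blast
    then show "rel_union Rs b a" by (rule tc)
  qed
  then have False using assms S f fn unfolding hct_def by blast
  then show "well_founded R" ..
qed

section \<open>Increasing functions, and \<open>TT\<close> implies \<open>WPH\<close>\<close>

lemma increasing_add:
  assumes f: "f \<in> Sets" and F: "\<And>n a. app f n a \<longleftrightarrow> a = F n" and inc: "increasing f"
  shows "F n + i \<le> F (n + i :: 'a::rca)"
proof -
  define m where "m = n + i"
  \<comment> \<open>The induction descends from \<open>m\<close>: all values met on the way are at
    most \<open>F m\<close>, whereas an ascent from \<open>n\<close> would offer no bound in
    advance.\<close>
  have "i \<le> m \<longrightarrow> (\<exists>j. j \<le> m \<and> (\<exists>y. y \<le> F m \<and> j + i = m \<and> app f j y \<and> y + i \<le> F m))" for i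
  proof (induction i rule: dpred_induct)
    case dpred
    show ?case by (intro dintros f)
  next
    case zero
    show ?case using F by auto
  next
    case (Suc i)
    show ?case
    proof
      assume im: "i + 1 \<le> m"
      then have "i \<le> m" by simp
      then obtain j y where j: "j + i = m" "app f j y" "y + i \<le> F m" using Suc by blast
      have "j \<noteq> 0" using im j(1) by auto
      then obtain j' where j': "j = j' + 1" using Suc_cases by metis
      then have "F j' + 1 \<le> y" using inc j(2) unfolding increasing_def F by simp
      then have "F j' + 1 + i \<le> y + i" by (rule add_right_mono)
      then have "F j' + 1 + i \<le> F m" using j(3) by (rule order_trans)
      then have "F j' + (i + 1) \<le> F m" by (simp only: add_ac)
      moreover from this have "F j' \<le> F m" by (metis le_iff_add add.assoc)
      moreover have "j' + (i + 1) = m" using j(1) j' by (simp only: add_ac)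
      moreover from this have "j' \<le> m" by (metis le_iff_add)
      ultimately show "\<exists>j. j \<le> m \<and> (\<exists>y. y \<le> F m \<and> j + (i + 1) = m \<and> app f j y \<and> y + (i + 1) \<le> F m)"
        using F by blast
    qed
  qed
  then have "i \<le> m \<longrightarrow> (\<exists>j y. j + i = m \<and> app f j y \<and> y + i \<le> F m)" by blast
  moreover have "i \<le> m" by (simp add: m_def)
  ultimately show ?thesis using F by (auto simp: m_def)
qed

lemma increasing_less:
  assumes "f \<in> Sets" "\<And>n a. app f n a \<longleftrightarrow> a = F n" "increasing f" "n < m"
  shows "F n < F (m :: 'a::rca)"
proof -
  obtain z where "m = n + (z + 1)" using less_imp_Suc[OF assms(4)] by (metis add.assoc)
  then have "F n + (z + 1) \<le> F m" using increasing_add[OF assms(1-3)] by metis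
  then have "F n + z + 1 \<le> F m" by (simp only: add.assoc)
  then have "F n + z < F m" by (simp only: Suc_le)
  then show ?thesis by (rule order.strict_trans1[rotated]) simp
qed

lemma increasing_inj:
  assumes "f \<in> Sets" "\<And>n a. app f n a \<longleftrightarrow> a = F n" "increasing f"
  shows "F n < F m \<longleftrightarrow> n < m" and "F n = F m \<longleftrightarrow> n = (m :: 'a::rca)"
  using increasing_less[OF assms, of n m] increasing_less[OF assms, of m n]
  by (cases n m rule: linorder_cases; auto)+

lemma tt_imp_wph:
  assumes tot: "tot TYPE('a::rca) h" and tt: "tt TYPE('a) h k"
  shows "wph TYPE('a) h k"
  unfolding wph_def
proof (intro ballI HOL.impI)
  fix f P :: "'a set"
  assume f: "f \<in> Sets" and P: "P \<in> Sets"
    and "funcm f (\<lambda>_. True) (\<lambda>_. True) \<and> increasing f \<and> growth_below h f"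
    and fP: "funcm P (pairsm (rngm f)) (\<lambda>x. x < of_nat k)"
  then have fn: "funcm f (\<lambda>_. True) (\<lambda>_. True)" and inc: "increasing f" and gr: "growth_below h f"
    by simp_all
  obtain F where F: "\<And>n a. app f n a \<longleftrightarrow> a = F n" using fn funcm_total by metis
  note less = increasing_inj[OF f F inc]
  \<comment> \<open>An argument never exceeds its value, so the range of \<open>f\<close> and the
    relation between successive values are bounded-definable and exist as sets.\<close>
  have le: "n \<le> F n" for n
    using increasing_add[OF f F inc, of 0 n] by (simp, metis add.commute le_iff_add order_trans)
  have rng: "rngm f y \<longleftrightarrow> (\<exists>n. y = F n)" for y unfolding rngm_def F ..
  show "\<exists>Y. (\<forall>y. cmem y Y \<longrightarrow> rngm f y) \<and> one_large Y \<and> weakly_homogeneous P Y"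
  proof (rule ccontr)
    assume nY: "\<nexists>Y. (\<forall>y. cmem y Y \<longrightarrow> rngm f y) \<and> one_large Y \<and> weakly_homogeneous P Y"
    define R where "R = {z. \<exists>a. a \<le> z \<and> (\<exists>b. b \<le> z \<and> (\<exists>n. n \<le> a \<and>
      app f n a \<and> app f (n + 1) b \<and> z = pr b a))}"
    have R: "relm R b a \<longleftrightarrow> (\<exists>n. a = F n \<and> b = F (n + 1))" for a b
      unfolding R_def F mem_Collect_eq pr_inject using le by (metis le_pr1 le_pr2)
    have Rz: "z \<in> R \<Longrightarrow> \<exists>a b. z = pr b a" for z unfolding R_def by blast
    have "R \<in> Sets" unfolding R_def by (rule dpred_comprehension) (intro dintros f)
    define S where "S = {y. \<exists>n. n \<le> y \<and> app f n y}"
    have S: "y \<in> S \<longleftrightarrow> (\<exists>n. y = F n)" for y unfolding S_def F using le by auto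
    have "S \<in> Sets" unfolding S_def by (rule dpred_comprehension) (intro dintros f)
    \<comment> \<open>The later, larger number is placed below the earlier one, so that
      \<open>Q i\<close>-decreasing sequences are increasing and enumerate weakly homogeneous
      sets.\<close>
    define Q where "Q i = {z. \<exists>a. a \<le> z \<and> (\<exists>b. b \<le> z \<and> z = pr b a \<and> app P (pr a b) (of_nat i))}" for i
    have Q: "relm (Q i) b a \<longleftrightarrow> app P (pr a b) (of_nat i)" for i a b
      unfolding Q_def mem_Collect_eq pr_inject by (metis le_pr1 le_pr2)
    have Qz: "z \<in> Q i \<Longrightarrow> \<exists>a b. z = pr b a" for i z unfolding Q_def by blast
    have Qs: "Q i \<in> Sets" for i unfolding Q_def by (rule dpred_comprehension) (intro dintros P)
    have PF: "a < b \<and> a \<in> S \<and> b \<in> S" if "app P (pr a b) c" for a b c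
      using that fP unfolding funcm_def app_def pairsm_def by (metis pr_inject rng S)
    define g where "g = {z. \<exists>a. a \<le> z \<and> z = pr a a \<and> a \<in> S}"
    have g: "app g a u \<longleftrightarrow> u = a \<and> a \<in> S" for a u
      unfolding g_def app_def mem_Collect_eq pr_inject by (metis le_pr1)
    have gz: "z \<in> g \<Longrightarrow> \<exists>a. a \<in> S \<and> z = pr a a" for z unfolding g_def by blast
    have "g \<in> Sets" unfolding g_def by (rule dpred_comprehension) (intro dintros \<open>S \<in> Sets\<close>)
    \<comment> \<open>A \<open>Q i\<close>-decreasing sequence from \<open>a\<close> with more than
      \<open>a\<close> terms would enumerate a weakly homogeneous set with minimum \<open>a\<close>;
      such a set is 1-large and excluded by \<open>nY\<close>.\<close>
    have bound: "l \<le> a" if s: "dec_seq (Q i) s l" "\<forall>j b. nthm s j b \<longrightarrow> b \<in> S" "nthm s 0 a" for i s l a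
    proof (rule ccontr)
      assume "\<not> l \<le> a"
      have sq: "seqm s l" and dec: "\<And>j a b. nthm s j a \<Longrightarrow> nthm s (j + 1) b \<Longrightarrow> app P (pr a b) (of_nat i)"
        using s(1) unfolding dec_seq_def Q by blast+
      have mono: "a < b" if "nthm s j a" "nthm s j' b" "j < j'" for j j' a b
        using seqm_less[OF sq _ that(3,1,2)] dec PF by metis
      have "dpred (\<lambda>e. \<exists>j. j \<le> s \<and> nthm s j (e 0))" by (intro dintros)
      then obtain Y where "\<And>y. cmem y Y \<longleftrightarrow> y < s + 1 \<and> (\<exists>j. j \<le> s \<and> nthm s j y)"
        using bounded_comprehension[of "\<lambda>y. \<exists>j. j \<le> s \<and> nthm s j y" "s + 1"] by metis
      then have Y: "cmem y Y \<longleftrightarrow> (\<exists>j. nthm s j y)" for y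
        using nthm_le nthm_index_le by (metis less_Suc)
      have en: "enumm s l Y" unfolding enumm_def using sq mono Y by metis
      have "a \<le> y" if "cmem y Y" for y
      proof -
        obtain j where j: "nthm s j y" using Y \<open>cmem y Y\<close> by metis
        show ?thesis
        proof (cases "j = 0")
          case True
          then show ?thesis using seqm_unique[OF sq s(3)] j by simp
        next
          case False
          then show ?thesis using mono[OF s(3) j] by (simp add: less_imp_le zero_less_iff_neq_zero)
        qed
      qed
      then have "one_large Y"
        unfolding one_large_def using Y s(3) en \<open>\<not> l \<le> a\<close> by (metis not_le)
      moreover have "weakly_homogeneous P Y"
        unfolding weakly_homogeneous_def using en dec by metis
      moreover have "\<forall>y. cmem y Y \<longrightarrow> rngm f y" using Y s(2) S rng by metis
      ultimately show False using nY by metis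
    qed
    have gfun: "funcm g (\<lambda>x. x \<in> S) (\<lambda>_. True)" unfolding funcm_def g using gz by (intro conjI; metis)
    have "fbounded h S (Q i) g" for i
      unfolding fbounded_def
    proof (intro conjI allI HOL.impI)
      show "rel_on (Q i) S" unfolding rel_on_def using Qz Q PF by metis
      show "is_bound g (Q i) S"
        unfolding is_bound_def using gfun g bound by (intro conjI allI HOL.impI) (auto simp: g)
      fix n u assume "n \<in> S \<and> app g n u"
      then show "less_fg h u n"
        unfolding less_fg_def g using tot fgm_less unfolding tot_def by metis
    qed
    then have "all_fbounded h S (map Q [0..<k]) (replicate k g)"
      unfolding all_fbounded_def by (auto simp: set_zip)
    moreover have "map Q [0..<k] \<in> set_lists k" "replicate k g \<in> set_lists k"
      using Qs \<open>g \<in> Sets\<close> by (auto simp: set_lists_def)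
    moreover have "rel_union (map Q [0..<k]) b a" if tc: "trans_cl R b a" for a b
    proof -
      obtain s j where s: "seqm s (j + 2)" "nthm s 0 a" "nthm s (j + 1) b"
        and st: "\<And>i a b. nthm s i a \<Longrightarrow> nthm s (i + 1) b \<Longrightarrow> relm R b a"
        using tc unfolding trans_cl_def dec_seq_def by blast
      have Rl: "relm R b a \<Longrightarrow> a < b" for a b unfolding R using less(1) by auto
      have "a < b" using seqm_less[OF s(1) _ _ s(2,3)] st Rl by (metis zero_less_one add_nonneg_pos zero_le)
      \<comment> \<open>The entries next to both ends show that \<open>a\<close> begins and
        \<open>b\<close> completes a step of \<open>R\<close>, so that both are values of
        \<open>f\<close>.\<close>
      have "0 + 1 < j + 2" "j < j + 2"
        using less_Suc[of 1 "j + 1"] by (simp_all add: add.assoc one_add_one)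
      then obtain v w where "nthm s (0 + 1) v" "nthm s j w" using seqm_ex[OF s(1)] by metis
      then have "relm R v a" "relm R b w" using st s(2,3) by blast+
      then have ab: "rngm f a" "rngm f b" unfolding R rng by auto
      then have "pairsm (rngm f) (pr a b)" using \<open>a < b\<close> unfolding pairsm_def by blast
      then obtain c where c: "app P (pr a b) c" using fP unfolding funcm_def by blast
      then have "c < of_nat k" using fP unfolding funcm_def app_def by (metis pr_inject)
      then obtain i where "i < k" "c = of_nat i" using less_of_nat by blast
      then show ?thesis using c unfolding rel_union_def by (auto simp: Q)
    qed
    moreover have "transition_function f R"
      unfolding transition_function_def using fn Rz R F by (metis (full_types))
    moreover have "deterministic R" unfolding deterministic_def R using less(2) by auto
    ultimately have "well_founded R"
      using tt \<open>R \<in> Sets\<close> \<open>S \<in> Sets\<close> f gr unfolding tt_def by blast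
    then show False unfolding well_founded_def using f fn R F by blast
  qed
qed

section \<open>\<open>WPH\<close> implies \<open>HCT\<close>\<close>

lemma dpred_ex_nat: "(\<And>i. i < k \<Longrightarrow> dpred (P i)) \<Longrightarrow> dpred (\<lambda>e. \<exists>i<k. P (i :: nat) e)"
proof (induction k)
  case 0
  show ?case by simp (rule dpred_const)
next
  case (Suc k)
  have "dpred (\<lambda>e. (\<exists>i<k. P i e) \<or> P k e)" using Suc by (intro dpred_or) simp_all
  then show ?case by (simp add: less_Suc_eq disj_commute ex_disj_distrib conj_disj_distribR)
qed

lemma dpred_all_nat: "(\<And>i. i < k \<Longrightarrow> dpred (P i)) \<Longrightarrow> dpred (\<lambda>e. \<forall>i<k. P (i :: nat) e)"
  using dpred_not[OF dpred_ex_nat[of k "\<lambda>i e. \<not> P i e"]] dpred_not by auto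

text \<open>Largeness and weak homogeneity each bring their own enumeration of \<open>Y\<close>.
  Strong induction shows that the two agree: the i-th entry of one cannot occur in the other before
  position i, since the earlier entries coincide, and vice versa.\<close>

lemma enumm_length_le:
  assumes e: "enumm s l Y" and e0: "enumm s\<^sub>0 l\<^sub>0 Y"
  shows "l\<^sub>0 \<le> (l :: 'a::rca)"
proof -
  have sq: "seqm s l" "seqm s\<^sub>0 l\<^sub>0" using e e0 by (simp_all add: enumm_def)
  have mono: "a < b" if "nthm s i a" "nthm s j b" "i < j" for i j a b
    using e that unfolding enumm_def by blast
  have mono0: "a < b" if "nthm s\<^sub>0 i a" "nthm s\<^sub>0 j b" "i < j" for i j a b
    using e0 that unfolding enumm_def by blast
  have Y: "cmem y Y \<longleftrightarrow> (\<exists>i. nthm s i y)" "cmem y Y \<longleftrightarrow> (\<exists>i. nthm s\<^sub>0 i y)" for y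
    using e e0 unfolding enumm_def by blast+
  have "i < l\<^sub>0 \<longrightarrow> (\<exists>a. a \<le> s \<and> nthm s i a \<and> nthm s\<^sub>0 i a)" for i
  proof (induction i rule: dpred_less_induct)
    case (less i)
    show ?case
    proof
      assume i: "i < l\<^sub>0"
      have eq: "\<exists>b. nthm s p b \<and> nthm s\<^sub>0 p b" if "p < i" for p
        using less that i by (meson order.strict_trans)
      obtain a where a: "nthm s\<^sub>0 i a" using seqm_ex[OF sq(2) i] by blast
      then obtain j where j: "nthm s j a" using Y by blast
      have ij: "i \<le> j"
      proof (rule ccontr)
        assume "\<not> i \<le> j"
        then have "j < i" by simp
        then obtain b where b: "nthm s j b" "nthm s\<^sub>0 j b" using eq by blast
        have "a = b" using seqm_unique[OF sq(1) j b(1)] .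
        moreover have "b < a" using mono0[OF b(2) a \<open>j < i\<close>] .
        ultimately show False by simp
      qed
      have "i < l" using ij seqm_index[OF sq(1) j] by (rule order.strict_trans1)
      then obtain c where c: "nthm s i c" using seqm_ex[OF sq(1)] by blast
      then obtain p where p: "nthm s\<^sub>0 p c" using Y by blast
      have ip: "i \<le> p"
      proof (rule ccontr)
        assume "\<not> i \<le> p"
        then have "p < i" by simp
        then obtain b where b: "nthm s p b" "nthm s\<^sub>0 p b" using eq by blast
        have "c = b" using seqm_unique[OF sq(2) p b(2)] .
        moreover have "b < c" using mono[OF b(1) c \<open>p < i\<close>] .
        ultimately show False by simp
      qed
      have "a \<le> c"
        using ip mono0[OF a p] seqm_unique[OF sq(2) a, of c] p by (auto simp: le_less)
      moreover have "c \<le> a"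
        using ij mono[OF c j] seqm_unique[OF sq(1) c, of a] j by (auto simp: le_less)
      ultimately have "c = a" by simp
      then show "\<exists>a. a \<le> s \<and> nthm s i a \<and> nthm s\<^sub>0 i a" using a c nthm_le[OF c] by blast
    qed
  qed (intro dintros)
  then have "i < l\<^sub>0 \<Longrightarrow> i < l" for i using seqm_index[OF sq(1)] by blast
  then show ?thesis by (meson less_irrefl not_le)
qed

text \<open>Since F_0(x) = x + 1, growth only says that \<open>f\<close> does not increase. A
  repeated value would be a loop of one of the relations, along which there are decreasing sequences
  of any length, against the bound. So \<open>f\<close> would descend strictly forever.\<close>

lemma hct_zero:
  fixes f :: "'a::rca set"
  assumes f: "f \<in> Sets" and F: "\<And>n a. app f n a \<longleftrightarrow> a = F n"
    and td: "transitive_decreasing Rs f" and gr: "growth_below 0 f"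
    and len: "length Rs = length gs" and fb: "all_fbounded 0 S Rs gs"
  shows False
proof -
  have le: "F (n + 1) \<le> F n" for n
    using gr unfolding growth_below_def less_fg_def F by simp
  have "F (n + 1) \<noteq> F n" for n
  proof
    assume eq: "F (n + 1) = F n"
    define a where "a = F n"
    have "n < n + 1" by simp
    then have "rel_union Rs a a" using td eq unfolding transitive_decreasing_def F a_def by metis
    then obtain R where R: "R \<in> set Rs" "relm R a a" unfolding rel_union_def by blast
    obtain g where g: "(R, g) \<in> set (zip Rs gs)"
      using R(1) len by (metis in_set_conv_nth length_zip min.idem nth_zip)
    then have b: "fbounded 0 S R g" using fb unfolding all_fbounded_def by blast
    have aS: "a \<in> S" using b R(2) unfolding fbounded_def rel_on_def by (metis pr_inject)
    then obtain u where u: "app g a u" using b unfolding fbounded_def is_bound_def funcm_def by blast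
    have "u < a + 1" using b aS u unfolding fbounded_def less_fg_def by auto
    have d: "dpred (\<lambda>e. e 1 = a)" by (intro dintros)
    \<comment> \<open>The bound \<open>u\<close> is at most \<open>a\<close>, so the constant
      sequence with a + 1 terms already violates it.\<close>
    have "\<exists>s. seqm s (a + 1) \<and> (\<forall>i v. nthm s i v \<longleftrightarrow> i < a + 1 \<and> v = a)"
      using ex_seqm'[of "\<lambda>i v. v = a" "a + 1" a] d by simp
    then obtain s where s: "seqm s (a + 1)" "\<And>i v. nthm s i v \<longleftrightarrow> i < a + 1 \<and> v = a" by blast
    have "dec_seq R s (a + 1)" unfolding dec_seq_def s(2) using s(1) R(2) by auto
    moreover have "\<forall>i v. nthm s i v \<longrightarrow> v \<in> S" unfolding s(2) using aS by simp
    moreover have "nthm s 0 a" unfolding s(2) by simp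
    ultimately have "a + 1 \<le> u" using b u unfolding fbounded_def is_bound_def by blast
    with \<open>u < a + 1\<close> show False by simp
  qed
  then have less: "F (n + 1) < F n" for n using le by (simp add: less_le)
  have "\<exists>y. y \<le> F 0 \<and> app f i y \<and> y + i \<le> F 0" for i
  proof (induction i rule: dpred_induct)
    case dpred
    show ?case by (intro dintros f)
  next
    case zero
    show ?case unfolding F by simp
  next
    case (Suc i)
    then have i: "F i + i \<le> F 0" unfolding F by blast
    have "F (i + 1) + 1 \<le> F i" using less by simp
    then have "F (i + 1) + 1 + i \<le> F i + i" by (rule add_right_mono)
    then have "F (i + 1) + 1 + i \<le> F 0" using i by (rule order_trans)
    then have "F (i + 1) + (i + 1) \<le> F 0" by (simp only: add_ac)
    moreover have "F (i + 1) \<le> F (i + 1) + (i + 1)" by simp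
    ultimately show ?case unfolding F by (meson order_trans)
  qed
  then obtain y where "y + (F 0 + 1) \<le> F 0" by blast
  then have "y + F 0 < F 0" by (simp only: add.assoc[symmetric] Suc_le)
  then show False by (simp add: not_less)
qed

text \<open>Each of the \<open>n\<close> steps from \<open>z\<close> to \<open>z + n\<close> increases the value by at least \<open>2\<close>.\<close>

lemma fgm_add:
  assumes tot: "tot TYPE('a::rca) (Suc h)" and m: "fgm (Suc h) m z'" and w: "fgm (Suc h) (z + n) w"
    and "m < (z :: 'a)"
  shows "z' + n + 1 < w"
proof -
  let ?G = "fgm (Suc h) :: 'a \<Rightarrow> 'a \<Rightarrow> bool"
  have ex: "\<exists>y. ?G x y" for x using tot unfolding tot_def by blast
  \<comment> \<open>The guard \<open>i \<le> n\<close> gives access to the final value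
    \<open>w\<close> as a bound for \<open>v\<close>, which keeps the statement bounded.\<close>
  have *: "i \<le> n \<longrightarrow> (\<exists>v. v \<le> w \<and> ?G (z + i) v \<and> z' + i + 1 < v)" for i
  proof (induction i rule: dpred_induct)
    case dpred
    show ?case by (intro dintros)
  next
    case zero
    obtain v where v: "?G z v" using ex by blast
    have "z' + 1 < v" by (rule fgm_Suc_strict_mono[OF m v \<open>m < z\<close>])
    moreover have "v \<le> w"
    proof (cases "n = 0")
      case True
      then show ?thesis using fgm_unique[OF v] w by auto
    next
      case False
      then have "z < z + n" by (simp add: zero_less_iff_neq_zero)
      then show ?thesis using fgm_strict_mono[OF v w] by simp
    qed
    ultimately show ?case using v by auto
  next
    case (Suc i)
    show ?case
    proof
      assume i: "i + 1 \<le> n"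
      then have "i \<le> n" by simp
      then obtain v where v: "?G (z + i) v" "z' + i + 1 < v" using Suc by blast
      obtain u where u: "?G (z + (i + 1)) u" using ex by blast
      have "z + i < z + (i + 1)" by simp
      then have "v + 1 < u" by (rule fgm_Suc_strict_mono[OF v(1) u])
      moreover have "z' + (i + 1) + 1 \<le> v"
        using v(2) by (simp only: Suc_le add.assoc[symmetric])
      ultimately have "z' + (i + 1) + 1 < u"
        by (meson less_Suc less_imp_le order.strict_trans1)
      moreover have "u \<le> w"
      proof (cases "i + 1 = n")
        case True
        then show ?thesis using fgm_unique[OF u] w by auto
      next
        case False
        then have "i + 1 < n" by (rule le_neq_trans[OF i])
        then have "z + (i + 1) < z + n" by (simp only: add_less_cancel_left)
        then show ?thesis using fgm_strict_mono[OF u w] by simp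
      qed
      ultimately show "\<exists>v. v \<le> w \<and> ?G (z + (i + 1)) v \<and> z' + (i + 1) + 1 < v" using u by blast
    qed
  qed
  obtain v where "?G (z + n) v" "z' + n + 1 < v" using *[of n] by blast
  then show ?thesis using fgm_unique w by blast
qed

lemma wph_imp_hct:
  assumes tot: "tot TYPE('a::rca) h" and wph: "wph TYPE('a) h k"
  shows "hct TYPE('a) h k"
  unfolding hct_def
proof (intro ballI HOL.impI notI)
  fix S :: "'a set" and Rs gs :: "'a set list"
  assume S: "S \<in> Sets" and Rs: "Rs \<in> set_lists k" and gs: "gs \<in> set_lists k"
    and fb: "all_fbounded h S Rs gs"
    and "\<exists>f \<in> Sets. funcm f (\<lambda>_. True) (\<lambda>_. True) \<and> transitive_decreasing Rs f \<and> growth_below h f"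
  then obtain f where f: "f \<in> Sets" and fn: "funcm f (\<lambda>_. True) (\<lambda>_. True)"
    and td: "transitive_decreasing Rs f" and gr: "growth_below h f" by blast
  obtain F where F: "\<And>n a. app f n a \<longleftrightarrow> a = F n" using fn funcm_total by metis
  have len: "length Rs = k" "length gs = k" and Rset: "set Rs \<subseteq> Sets"
    using Rs gs by (auto simp: set_lists_def)
  show False
  proof (cases h)
    case 0
    then show False using hct_zero[OF f F td _ _ ] gr fb len by metis
  next
    case (Suc h')
    have fbi: "fbounded h S (Rs ! i) (gs ! i)" if "i < k" for i
      using fb that len unfolding all_fbounded_def set_zip by auto
    obtain H :: "'a \<Rightarrow> 'a" where H: "\<And>x. fgm h x (H x)" using tot unfolding tot_def by metis
    have HH: "fgm h x y \<longleftrightarrow> y = H x" for x y using H fgm_unique by blast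
    have H_less: "x < H x" for x using H fgm_less by blast
    have H_mono: "x < y \<Longrightarrow> H x < H y" for x y using H fgm_strict_mono by blast
    have H_jump: "x < y \<Longrightarrow> H x + 1 < H y" for x y using H fgm_Suc_strict_mono unfolding Suc by blast
    have H_le: "x \<le> y \<Longrightarrow> H x \<le> H y" for x y using H_mono by (auto simp: le_less)
    have H_add: "m < z \<Longrightarrow> H m + n + 1 < H (z + n)" for m n z
      using fgm_add[of h' m "H m" z n "H (z + n)"] tot H unfolding Suc by blast
    have F_growth: "F (n + 1) < H (F n)" for n
      using gr unfolding growth_below_def less_fg_def F HH by blast
    \<comment> \<open>The graph of the running maximum of \<open>f\<close>. The second clause makes
      \<open>m\<close> an upper bound by a search below \<open>m\<close>, so that the definition is
      bounded.\<close>
    define Mx where "Mx n m \<longleftrightarrow> (\<exists>i. i \<le> n \<and> app f i m) \<and> (\<forall>i. i \<le> n \<longrightarrow> (\<exists>v. v \<le> m \<and> app f i v))" for n m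
    have dMx: "dpred (\<lambda>e. Mx (s e) (t e))" if "dterm s" "dterm t" for s t
      by (rule dpred_subst2[OF _ that]) (unfold Mx_def, intro dintros f)
    have "\<exists>m. Mx n m" for n
    proof -
      have "dpred (\<lambda>e. app f (e 0) (e 1))" by (intro dintros f)
      then obtain b where b: "\<And>i. i < n + 1 \<Longrightarrow> \<exists>y. y \<le> b \<and> app f i y"
        using bounding[of "app f" "n + 1"] F by metis
      have d: "dpred (\<lambda>e. \<exists>i. i \<le> n \<and> app f i (e 0))" by (intro dintros f)
      have ex: "\<exists>i. i \<le> n \<and> app f i (F 0)" unfolding F by (rule exI[of _ 0]) simp
      have bd: "x \<le> b" if "\<exists>i. i \<le> n \<and> app f i x" for x
        using that b unfolding F by (metis less_Suc)
      show ?thesis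
      proof (rule dpred_greatest[of "\<lambda>x. \<exists>i. i \<le> n \<and> app f i x" "F 0" b, OF d ex bd])
        fix m assume m: "\<exists>i. i \<le> n \<and> app f i m" "\<And>z. \<exists>i. i \<le> n \<and> app f i z \<Longrightarrow> z \<le> m"
        then have "Mx n m" unfolding Mx_def F by blast
        then show ?thesis ..
      qed
    qed
    then obtain M where M: "\<And>n. Mx n (M n)" by metis
    have M_ex: "\<exists>i. i \<le> n \<and> M n = F i" and M_ge: "i \<le> n \<Longrightarrow> F i \<le> M n" for i n
      using M[of n] unfolding Mx_def F by auto
    have MM: "Mx n m \<longleftrightarrow> m = M n" for n m
    proof
      assume "Mx n m"
      then have "\<exists>i. i \<le> n \<and> m = F i" "\<And>i. i \<le> n \<Longrightarrow> F i \<le> m" unfolding Mx_def F by auto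
      then show "m = M n" using M_ex M_ge by (metis antisym)
    qed (simp add: M)
    \<comment> \<open>A new maximum can only be f(n + 1), which is below F_h(f(n)) and hence below
      F_h of the old maximum.\<close>
    have M_Suc: "M (n + 1) = M n \<or> M n < M (n + 1) \<and> M (n + 1) < H (M n)" for n
    proof -
      have "M n \<le> M (n + 1)"
      proof -
        obtain i where i: "i \<le> n" "M n = F i" using M_ex by blast
        then have "i \<le> n + 1" by (meson less_Suc less_imp_le)
        then show ?thesis using M_ge i(2) by simp
      qed
      moreover have "M (n + 1) < H (M n)" if "M n < M (n + 1)"
      proof -
        obtain i where i: "i \<le> n + 1" "M (n + 1) = F i" using M_ex by blast
        have "\<not> i \<le> n" using M_ge[of i n] i(2) that by auto
        then have "i = n + 1" using i(1) by (metis less_Suc le_less)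
        then have "M (n + 1) < H (F n)" using i(2) F_growth by simp
        also have "\<dots> \<le> H (M n)" using M_ge[of n n] by (simp add: H_le)
        finally show ?thesis .
      qed
      ultimately show ?thesis by (auto simp: le_less)
    qed
    define G where "G n = H (M n) + n" for n
    define Gs where "Gs = {z. \<exists>n. n \<le> z \<and> (\<exists>y. y \<le> z \<and> z = pr n y \<and>
      (\<exists>m. m \<le> y \<and> (\<exists>w. w \<le> y \<and> Mx n m \<and> fgm h m w \<and> y = w + n)))}"
    have Gs: "Gs \<in> Sets" unfolding Gs_def by (rule dpred_comprehension) (intro dintros dMx)
    have G_ge: "H (M n) \<le> G n" "M n \<le> G n" "F n \<le> G n" "n \<le> G n" for n
    proof -
      show 1: "H (M n) \<le> G n" by (simp add: G_def)
      then show 2: "M n \<le> G n" using H_less by (meson less_imp_le order_trans)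
      show "F n \<le> G n" using M_ge[of n n] 2 by (meson order_refl order_trans)
      show "n \<le> G n" by (simp add: G_def)
    qed
    have GsG: "app Gs n a \<longleftrightarrow> a = G n" for n a
    proof -
      have "app Gs n a \<longleftrightarrow> (\<exists>m. m \<le> a \<and> (\<exists>w. w \<le> a \<and> Mx n m \<and> fgm h m w \<and> a = w + n))"
        unfolding Gs_def app_def mem_Collect_eq pr_inject by (metis le_pr1 le_pr2)
      also have "\<dots> \<longleftrightarrow> a = G n"
        unfolding MM HH G_def using G_ge[of n] unfolding G_def by blast
      finally show ?thesis .
    qed
    have Gfun: "funcm Gs (\<lambda>_. True) (\<lambda>_. True)"
      by (rule funcmI[OF GsG]) (auto simp: Gs_def)
    have inc: "increasing Gs"
      unfolding increasing_def GsG
    proof (intro allI HOL.impI)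
      fix n a b assume ab: "a = G n \<and> b = G (n + 1)"
      have "M n \<le> M (n + 1)" using M_Suc[of n] by auto
      then have "H (M n) + n \<le> H (M (n + 1)) + n" by (intro add_right_mono H_le)
      then show "a < b" using ab by (simp add: G_def add.assoc[symmetric])
    qed
    have growth: "growth_below h Gs"
      unfolding growth_below_def GsG less_fg_def HH
    proof (intro allI HOL.impI)
      fix n a b assume ab: "a = G n \<and> b = G (n + 1)"
      have "b < H a"
        using M_Suc[of n]
      proof
        assume "M (n + 1) = M n"
        then have b: "b = a + 1" using ab by (simp add: G_def add.assoc)
        \<comment> \<open>Here g gains just 1. With a predecessor \<open>x\<close> of
          \<open>a\<close> we have H x \<ge> a, and passing from \<open>x\<close> to
          \<open>a\<close> raises \<open>H\<close> by at least 2.\<close>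
        have "0 < a" using H_less[of "M n"] G_ge(1)[of n] ab
          by (metis not_less_zero order.strict_trans1 zero_less_iff_neq_zero le_less)
        then obtain x where x: "a = x + 1" using pos_Suc by blast
        have "a \<le> H x" using H_less[of x] x by simp
        then have "a + 1 \<le> H x + 1" by (rule add_right_mono)
        also have "H x + 1 < H a" using x by (intro H_jump) simp
        finally show ?thesis using b by simp
      next
        assume "M n < M (n + 1) \<and> M (n + 1) < H (M n)"
        \<comment> \<open>\<open>H_add\<close> with z = H (M n): the new maximum is smaller than z,
          and passing from H z to H (z + n) pays for the summand n.\<close>
        then have "H (M (n + 1)) + n + 1 < H (H (M n) + n)" using H_add by blast
        then show ?thesis using ab by (simp add: G_def add.assoc)
      qed
      then show "\<exists>z. z = H a \<and> b < z" by blast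
    qed
    note G_inj = increasing_inj[OF Gs GsG inc]
    have rng: "rngm Gs y \<longleftrightarrow> (\<exists>n. y = G n)" for y unfolding rngm_def GsG ..
    \<comment> \<open>Several relations may hold between two values; taking the least index turns
      the colouring into a function.\<close>
    define col where "col v u c \<longleftrightarrow> (\<exists>i<k. c = of_nat i \<and> relm (Rs ! i) v u \<and>
      (\<forall>j<i. \<not> relm (Rs ! j) v u))" for v u c :: 'a
    have dcol: "dpred (\<lambda>e. col (p e) (q e) (r e))" if "dterm p" "dterm q" "dterm r" for p q r
      unfolding col_def
      by (intro dpred_ex_nat dpred_all_nat dintros that) (use Rset len in \<open>auto simp: subset_iff\<close>)
    have col_ex: "\<exists>c. col v u c" if "rel_union Rs v u" for v u
    proof -
      let ?P = "\<lambda>i. i < k \<and> relm (Rs ! i) v u"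
      have "\<exists>i. ?P i" using that len(1) unfolding rel_union_def by (metis in_set_conv_nth)
      then have "?P (LEAST i. ?P i)" by (rule LeastI_ex)
      moreover have "\<forall>j<(LEAST i. ?P i). \<not> relm (Rs ! j) v u"
        using not_less_Least[of _ ?P] \<open>?P (LEAST i. ?P i)\<close> by (meson order.strict_trans)
      ultimately show ?thesis unfolding col_def by blast
    qed
    have col_unique: "c = c'" if c: "col v u c" and c': "col v u c'" for v u c c'
    proof -
      obtain i where i: "c = of_nat i" "relm (Rs ! i) v u" "\<forall>j<i. \<not> relm (Rs ! j) v u"
        using c unfolding col_def by blast
      obtain i' where i': "c' = of_nat i'" "relm (Rs ! i') v u" "\<forall>j<i'. \<not> relm (Rs ! j) v u"
        using c' unfolding col_def by blast
      have "i = i'" using i i' by (metis nat_neq_iff)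
      then show ?thesis using i i' by simp
    qed
    define P where "P = {z. \<exists>a. a \<le> z \<and> (\<exists>b. b \<le> z \<and> (\<exists>c. c \<le> z \<and> z = pr (pr a b) c \<and>
      (\<exists>n. n \<le> b \<and> (\<exists>m. m \<le> b \<and> n < m \<and> app Gs n a \<and> app Gs m b \<and>
      (\<exists>u. u \<le> a \<and> (\<exists>v. v \<le> b \<and> app f n u \<and> app f m v \<and> col v u c))))))}"
    have Ps: "P \<in> Sets" unfolding P_def by (rule dpred_comprehension) (intro dintros f Gs dcol)
    have Pz: "z \<in> P \<Longrightarrow> \<exists>n m c. n < m \<and> z = pr (pr (G n) (G m)) c \<and> col (F m) (F n) c" for z
      unfolding P_def F GsG by blast
    have PI: "app P (pr (G n) (G m)) c" if "n < m" "col (F m) (F n) c" for n m c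
    proof -
      have le: "G n \<le> pr (pr (G n) (G m)) c" "G m \<le> pr (pr (G n) (G m)) c"
        "c \<le> pr (pr (G n) (G m)) c"
        by (meson le_pr1 le_pr2 order_trans)+
      have nm: "n \<le> G m" using that(1) G_ge(4)[of m] by (meson less_imp_le order_trans)
      have "pr (pr (G n) (G m)) c \<in> P"
        unfolding P_def mem_Collect_eq F GsG
        by (rule exI[of _ "G n"], rule conjI[OF le(1)], rule exI[of _ "G m"], rule conjI[OF le(2)],
            rule exI[of _ c], rule conjI[OF le(3)], rule conjI[OF refl],
            rule exI[of _ n], rule conjI[OF nm], rule exI[of _ m], rule conjI[OF G_ge(4)], rule conjI[OF that(1)],
            rule conjI[OF refl], rule conjI[OF refl], rule exI[of _ "F n"], rule conjI[OF G_ge(3)],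
            rule exI[of _ "F m"], rule conjI[OF G_ge(3)]) (simp add: that(2))
      then show ?thesis by (simp add: app_def)
    qed
    have PE: "n < m \<and> col (F m) (F n) c" if "app P (pr (G n) (G m)) c" for n m c
      using Pz[OF that[unfolded app_def]] G_inj(2) by auto
    have "funcm P (pairsm (rngm Gs)) (\<lambda>x. x < of_nat k)"
      unfolding funcm_def
    proof (intro conjI allI HOL.impI)
      fix z assume "z \<in> P"
      then obtain n m c where z: "n < m" "z = pr (pr (G n) (G m)) c" "col (F m) (F n) c"
        using Pz by blast
      have "pairsm (rngm Gs) (pr (G n) (G m))"
        unfolding pairsm_def rng using z(1) G_inj(1) by blast
      moreover have "c < of_nat k" using z(3) unfolding col_def by auto
      ultimately show "\<exists>x y. pairsm (rngm Gs) x \<and> y < of_nat k \<and> z = pr x y" using z(2) by blast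
    next
      fix x assume "pairsm (rngm Gs) x"
      then obtain n m where x: "x = pr (G n) (G m)" "G n < G m" unfolding pairsm_def rng by blast
      then have nm: "n < m" using G_inj(1) by blast
      then have "rel_union Rs (F m) (F n)" using td unfolding transitive_decreasing_def F by blast
      then obtain c where c: "col (F m) (F n) c" using col_ex by blast
      show "\<exists>!y. app P x y"
      proof (rule ex1I)
        show "app P x c" unfolding x(1) using PI[OF nm c] .
        show "y = c" if "app P x y" for y using PE that c col_unique unfolding x(1) by blast
      qed
    qed
    then obtain Y where Y: "\<forall>y. cmem y Y \<longrightarrow> rngm Gs y" "one_large Y" "weakly_homogeneous P Y"
      using wph Gs Gfun inc growth Ps unfolding wph_def by blast
    obtain a l\<^sub>0 s\<^sub>0 where a: "cmem a Y" "\<And>y. cmem y Y \<Longrightarrow> a \<le> y" "enumm s\<^sub>0 l\<^sub>0 Y" "a < l\<^sub>0"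
      using Y(2) unfolding one_large_def by blast
    obtain s l c where s: "enumm s l Y"
      and hom: "\<And>j a b. nthm s j a \<Longrightarrow> nthm s (j + 1) b \<Longrightarrow> app P (pr a b) c"
      using Y(3) unfolding weakly_homogeneous_def by blast
    have al: "a < l" using a(4) enumm_length_le[OF s a(3)] by (rule order.strict_trans2)
    have sq: "seqm s l" and sY: "\<And>y. cmem y Y \<longleftrightarrow> (\<exists>i. nthm s i y)"
      and smono: "\<And>i j a b. nthm s i a \<Longrightarrow> nthm s j b \<Longrightarrow> i < j \<Longrightarrow> a < b"
      using s unfolding enumm_def by blast+
    have sG: "\<exists>n. a = G n" if "nthm s i a" for i a using that sY Y(1) rng by blast
    have s0: "nthm s 0 a"
    proof -
      obtain j where j: "nthm s j a" using a(1) sY by blast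
      have "0 < l" using al by (rule order.strict_trans1[rotated]) simp
      then obtain b where b: "nthm s 0 b" using seqm_ex[OF sq] by blast
      have "a \<le> b" using a(2) sY b by blast
      then have "\<not> 0 < j" using smono[OF b j] by (meson not_less)
      then show ?thesis using j by (simp add: zero_less_iff_neq_zero)
    qed
    then obtain n\<^sub>0 where n0: "a = G n\<^sub>0" using sG by blast
    \<comment> \<open>On a one-element set, weak homogeneity says nothing about \<open>c\<close>.
      Since the minimum of \<open>Y\<close> is positive, \<open>Y\<close> has at least two elements,
      and the first pair shows that \<open>c\<close> is an actual colour.\<close>
    have "0 < a" using H_less[of "M n\<^sub>0"] G_ge(1)[of n\<^sub>0] n0
      by (metis not_less_zero order.strict_trans1 zero_less_iff_neq_zero le_less)
    then have "1 < l" using al by (metis Suc_le add_0 order.strict_trans1)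
    then obtain b where b: "nthm s (0 + 1) b" using seqm_ex[OF sq, of 1] by auto
    obtain n\<^sub>1 where "b = G n\<^sub>1" using sG b by blast
    then have "col (F n\<^sub>1) (F n\<^sub>0) c" using hom[OF s0 b] PE n0 by blast
    then obtain i where i: "i < k" "c = of_nat i" unfolding col_def by blast
    have colR: "relm (Rs ! i) v u" if "col v u c" for v u
      using that i(2) unfolding col_def by auto
    \<comment> \<open>Replaces an entry g(n) of the homogeneous sequence by f(n). As g(n) dominates
      both n and f(n), the new sequence is bounded-definable with values at most
      \<open>s\<close>.\<close>
    define \<phi> where "\<phi> j v \<longleftrightarrow> (\<exists>a. a \<le> s \<and> (\<exists>n. n \<le> a \<and> nthm s j a \<and> app Gs n a \<and> app f n v))" for j v
    have \<phi>: "\<phi> j v \<longleftrightarrow> (\<exists>n. nthm s j (G n) \<and> v = F n)" for j v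
      unfolding \<phi>_def F GsG using nthm_le G_ge(4) by blast
    have d: "dpred (\<lambda>e. \<phi> (e 0) (e 1))" unfolding \<phi>_def by (intro dintros f Gs)
    have e: "\<forall>j. j < l \<longrightarrow> (\<exists>v. v \<le> s \<and> \<phi> j v)"
    proof (intro allI HOL.impI)
      fix j assume "j < l"
      then obtain a where a: "nthm s j a" using seqm_ex[OF sq] by blast
      then obtain n where n: "a = G n" using sG by blast
      have "F n \<le> s" using G_ge(3)[of n] nthm_le[OF a] unfolding n by (rule order_trans)
      then show "\<exists>v. v \<le> s \<and> \<phi> j v" unfolding \<phi> using a n by blast
    qed
    have u: "\<forall>j v v'. j < l \<longrightarrow> \<phi> j v \<longrightarrow> \<phi> j v' \<longrightarrow> v = v'"
    proof (intro allI HOL.impI)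
      fix j v v' assume "\<phi> j v" "\<phi> j v'"
      then obtain n m where "nthm s j (G n)" "v = F n" "nthm s j (G m)" "v' = F m" unfolding \<phi> by blast
      then show "v = v'" using seqm_unique[OF sq, of j "G n" "G m"] G_inj(2) by simp
    qed
    obtain t where t: "seqm t l" "\<And>j v. nthm t j v \<longleftrightarrow> j < l \<and> \<phi> j v"
      using ex_seqm'[of \<phi> l s, OF d e u] by blast
    have dec: "dec_seq (Rs ! i) t l"
      unfolding dec_seq_def t(2) \<phi>
    proof (intro conjI t(1) allI HOL.impI)
      fix j v v'
      assume "(j < l \<and> (\<exists>n. nthm s j (G n) \<and> v = F n)) \<and> j + 1 < l \<and> (\<exists>n. nthm s (j + 1) (G n) \<and> v' = F n)"
      then obtain n m where "nthm s j (G n)" "v = F n" "nthm s (j + 1) (G m)" "v' = F m" by blast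
      then show "relm (Rs ! i) v' v" using hom PE colR by blast
    qed
    have FS: "F n \<in> S" for n
    proof -
      have "n < n + 1" by simp
      then have "rel_union Rs (F (n + 1)) (F n)" using td unfolding transitive_decreasing_def F by blast
      then obtain j where "j < k" "relm (Rs ! j) (F (n + 1)) (F n)"
        unfolding rel_union_def using len(1) by (metis in_set_conv_nth)
      then show ?thesis using fbi[of j] unfolding fbounded_def rel_on_def by (metis pr_inject)
    qed
    have tS: "\<forall>j v. nthm t j v \<longrightarrow> v \<in> S" unfolding t(2) \<phi> using FS by auto
    have t0: "nthm t 0 (F n\<^sub>0)" unfolding t(2) \<phi> using s0 n0 seqm_index[OF sq s0] by blast
    note fb = fbi[OF i(1), unfolded fbounded_def is_bound_def]
    obtain u where u: "app (gs ! i) (F n\<^sub>0) u" using fb FS unfolding funcm_def by blast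
    \<comment> \<open>The bound at the first term is below \<open>H (F n\<^sub>0)\<close>, hence
      below the minimum \<open>a\<close> of \<open>Y\<close>, which has the summand
      \<open>H (M n\<^sub>0)\<close>; but largeness gave \<open>a < l\<close>.\<close>
    have "l \<le> u" using fb dec tS t0 u by blast
    also have "u < H (F n\<^sub>0)" using fb FS u unfolding less_fg_def HH by blast
    also have "\<dots> \<le> H (M n\<^sub>0)" using M_ge[of n\<^sub>0 n\<^sub>0] by (simp add: H_le)
    also have "\<dots> \<le> a" using G_ge(1) n0 by simp
    finally show False using al by simp
  qed
qed

theorem principles_equivalent:
  assumes "tot TYPE('a::rca) h"
  shows "wph TYPE('a) h k \<longleftrightarrow> hct TYPE('a) h k" "hct TYPE('a) h k \<longleftrightarrow> tt TYPE('a) h k"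
    "wph TYPE('a) h k \<longleftrightarrow> tt TYPE('a) h k"
  using wph_imp_hct[OF assms] hct_imp_tt tt_imp_wph[OF assms] by blast+

section \<open>Meaning of the named notation\<close>

text \<open>A context \<open>(n, L, m, K)\<close> assigns values to the number variables bound at levels below \<open>n\<close> and
  to the set variables bound at levels below \<open>m\<close>; contexts are extended under quantifiers. A term
  denotes a value in a context if it has this value in all extensions, at whatever depth it is
  used there.\<close>

type_synonym 'a ctx = "nat \<times> (nat \<Rightarrow> 'a) \<times> nat \<times> (nat \<Rightarrow> 'a set)"

fun ext :: "'a ctx \<Rightarrow> 'a ctx \<Rightarrow> bool" where
  "ext (n, L, m, K) (n', L', m', K') \<longleftrightarrow>
    n \<le> n' \<and> m \<le> m' \<and> (\<forall>i<n. L' i = L i) \<and> (\<forall>i<m. K' i = K i)"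

text \<open>Levels count quantifiers from the outside and de Bruijn indices from the inside, hence
  the reversal \<open>n - Suc i\<close>.\<close>

fun ok :: "'a::rca ctx \<Rightarrow> (nat \<Rightarrow> 'a) \<Rightarrow> (nat \<Rightarrow> 'a set) \<Rightarrow> bool" where
  "ok (n, L, m, K) e E \<longleftrightarrow>
    (\<forall>i<n. e i = L (n - Suc i)) \<and> (\<forall>i<m. E i = K (m - Suc i)) \<and> (\<forall>X. E X \<in> Sets)"

definition den :: "'a::rca ctx \<Rightarrow> ntm \<Rightarrow> 'a \<Rightarrow> bool" where
  "den C t a \<longleftrightarrow> (\<forall>C' e E. ext C C' \<longrightarrow> ok C' e E \<longrightarrow> evalT e (t (fst C')) = a)"

definition denS :: "'a::rca ctx \<Rightarrow> svar \<Rightarrow> 'a set \<Rightarrow> bool" where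
  "denS C X A \<longleftrightarrow> (\<forall>C' e E. ext C C' \<longrightarrow> ok C' e E \<longrightarrow> E (X (fst (snd (snd C')))) = A)"

text \<open>In contrast to \<open>den\<close>, a single context suffices: where a formula depends on
  parameters, rules such as \<open>holds_Func\<close> assume its instances to hold in all
  extensions.\<close>

definition holds :: "'a::rca ctx \<Rightarrow> frm \<Rightarrow> bool \<Rightarrow> bool" where
  "holds C F Q \<longleftrightarrow> (\<forall>e E. ok C e E \<longrightarrow> sat e E (F (fst C) (fst (snd (snd C)))) = Q)"

lemma ext_refl: "ext C C"
  by (cases C) simp

lemma ext_trans: "ext C C' \<Longrightarrow> ext C' C'' \<Longrightarrow> ext C C''"
  by (cases C; cases C'; cases C'') auto

lemma den_mono: "den C t a \<Longrightarrow> ext C C' \<Longrightarrow> den C' t a"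
  unfolding den_def using ext_trans by metis

lemma denS_mono: "denS C X A \<Longrightarrow> ext C C' \<Longrightarrow> denS C' X A"
  unfolding denS_def using ext_trans by metis

lemma denS_list_mono: "list_all2 (denS C) Xs As \<Longrightarrow> ext C C' \<Longrightarrow> list_all2 (denS C') Xs As"
  by (erule list_all2_mono) (rule denS_mono)

text \<open>Used as introduction rules, these compute the meaning of a formula along its syntax;
  what remains is monotonicity of denotations in the context.\<close>

named_theorems sem

lemma den_terms [sem]:
  "den C \<^bold>0 0" "den C \<^bold>1 1"
  "den C s a \<Longrightarrow> den C t b \<Longrightarrow> den C (s \<^bold>+ t) (a + b)"
  "den C s a \<Longrightarrow> den C t b \<Longrightarrow> den C (s \<^bold>* t) (a * b)"
  "den C s a \<Longrightarrow> den C t b \<Longrightarrow> den C (s \<^bold>^ t) (a \<up> b)"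
  by (simp_all add: den_def nZero_def nOne_def nAdd_def nMul_def nPow_def)

lemma den_num: "den C (num k) (of_nat k)"
proof (induction k)
  case (Suc k)
  then have "den C (num k \<^bold>+ \<^bold>1) (of_nat k + 1)" by (intro sem)
  then show ?case by (simp add: add.commute)
qed (simp add: sem)

lemma den_two [sem]: "den C (num 2) 2"
  using den_num[of C 2] by simp

lemma den_pair [sem]: "den C s a \<Longrightarrow> den C t b \<Longrightarrow> den C \<^bold>\<langle>s, t\<^bold>\<rangle> (pr a b)"
  unfolding pair_def pr_def by (intro sem)

lemma denD: "den C t a \<Longrightarrow> ok C e E \<Longrightarrow> evalT e (t (fst C)) = a"
  unfolding den_def using ext_refl by blast

lemma denSD: "denS C X A \<Longrightarrow> ok C e E \<Longrightarrow> E (X (fst (snd (snd C)))) = A"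
  unfolding denS_def using ext_refl by blast

lemma holds_atoms [sem]:
  "den C s a \<Longrightarrow> den C t b \<Longrightarrow> holds C (s \<^bold>= t) (a = b)"
  "den C s a \<Longrightarrow> den C t b \<Longrightarrow> holds C (s \<^bold>< t) (a < b)"
  "den C s a \<Longrightarrow> denS C X A \<Longrightarrow> holds C (s \<^bold>\<in> X) (a \<in> A)"
  "holds C \<^bold>\<bottom> False"
  by (simp_all add: holds_def fEq_def fLess_def fMem_def fBot_def denD denSD)

lemma holds_connectives [sem]:
  "holds C F P \<Longrightarrow> holds C (\<^bold>\<not> F) (\<not> P)"
  "holds C F P \<Longrightarrow> holds C G Q \<Longrightarrow> holds C (F \<^bold>\<and> G) (P \<and> Q)"
  "holds C F P \<Longrightarrow> holds C G Q \<Longrightarrow> holds C (F \<^bold>\<or> G) (P \<or> Q)"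
  "holds C F P \<Longrightarrow> holds C G Q \<Longrightarrow> holds C (F \<^bold>\<longrightarrow> G) (P \<longrightarrow> Q)"
  "holds C F P \<Longrightarrow> holds C G Q \<Longrightarrow> holds C (F \<^bold>\<longleftrightarrow> G) (P \<longleftrightarrow> Q)"
  by (simp_all add: holds_def fNeg_def fAnd_def fOr_def fImp_def fIff_def)

lemma holds_top [sem]: "holds C \<^bold>\<top> True"
  using holds_connectives(1)[OF holds_atoms(4)] by simp

lemma holds_le [sem]: "den C s a \<Longrightarrow> den C t b \<Longrightarrow> holds C (s \<^bold>\<le> t) (a \<le> b)"
  unfolding le_less by (intro holds_connectives holds_atoms)

text \<open>A number quantifier at depth \<open>n\<close> extends the context at level
  \<open>n\<close>. The index \<open>n' - Suc n\<close> then points to that level from every depth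
  \<open>n'\<close> below the quantifier, so the denotation of the variable is stable.\<close>

lemma level_var:
  assumes "ok (n, L, m, K) e E"
  shows "ext (n, L, m, K) (Suc n, L(n := x), m, K)" "ok (Suc n, L(n := x), m, K) (case_nat x e) E"
    "den (Suc n, L(n := x), m, K) (\<lambda>n'. Var (n' - Suc n)) x"
  using assms by (auto simp: den_def split: nat.split)

lemma level_set_var:
  assumes "ok (n, L, m, K) e E" "X \<in> Sets"
  shows "ext (n, L, m, K) (n, L, Suc m, K(m := X))" "ok (n, L, Suc m, K(m := X)) e (case_nat X E)"
    "denS (n, L, Suc m, K(m := X)) (\<lambda>m'. m' - Suc m) X"
  using assms by (auto simp: denS_def split: nat.split)

lemma holds_AllN [sem]:
  assumes F: "\<And>C' t v. ext C C' \<Longrightarrow> den C' t v \<Longrightarrow> holds C' (F t) (P v)"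
  shows "holds C (fAllN F) (\<forall>v. P v)"
  unfolding holds_def
proof (intro allI HOL.impI)
  fix e E assume ok: "ok C e E"
  obtain n L m K where C: "C = (n, L, m, K)" by (cases C)
  note ok' = ok[unfolded C]
  have "sat (case_nat x e) E (F (\<lambda>n'. Var (n' - Suc n)) (Suc n) m) \<longleftrightarrow> P x" for x
    using F[unfolded C holds_def, OF level_var(1,3)[OF ok', of x]] level_var(2)[OF ok', of x]
    by simp
  then show "sat e E (fAllN F (fst C) (fst (snd (snd C)))) \<longleftrightarrow> (\<forall>v. P v)" by (simp add: C fAllN_def)
qed

lemma holds_ExN [sem]:
  assumes "\<And>C' t v. ext C C' \<Longrightarrow> den C' t v \<Longrightarrow> holds C' (F t) (P v)"
  shows "holds C (fExN F) (\<exists>v. P v)"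
proof -
  have "fExN F = (\<^bold>\<not> fAllN (\<lambda>t. \<^bold>\<not> F t))" by (simp add: fExN_def fAllN_def fNeg_def ExN_def)
  moreover have "holds C (\<^bold>\<not> fAllN (\<lambda>t. \<^bold>\<not> F t)) (\<not> (\<forall>v. \<not> P v))" using assms by (intro sem)
  ultimately show ?thesis by simp
qed

lemma holds_AllS [sem]:
  assumes F: "\<And>C' X A. ext C C' \<Longrightarrow> denS C' X A \<Longrightarrow> A \<in> Sets \<Longrightarrow> holds C' (F X) (P A)"
  shows "holds C (fAllS F) (\<forall>A \<in> Sets. P A)"
  unfolding holds_def
proof (intro allI HOL.impI)
  fix e E assume ok: "ok C e E"
  obtain n L m K where C: "C = (n, L, m, K)" by (cases C)
  note ok' = ok[unfolded C]
  have "sat e (case_nat X E) (F (\<lambda>m'. m' - Suc m) n (Suc m)) \<longleftrightarrow> P X" if X: "X \<in> Sets" for X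
    using F[unfolded C holds_def, OF level_set_var(1,3)[OF ok' X] X] level_set_var(2)[OF ok' X]
    by simp
  then show "sat e E (fAllS F (fst C) (fst (snd (snd C)))) \<longleftrightarrow> (\<forall>A \<in> Sets. P A)"
    by (simp add: C fAllS_def)
qed

lemma holds_ExS [sem]:
  assumes "\<And>C' X A. ext C C' \<Longrightarrow> denS C' X A \<Longrightarrow> A \<in> Sets \<Longrightarrow> holds C' (F X) (P A)"
  shows "holds C (fExS F) (\<exists>A \<in> Sets. P A)"
proof -
  have "fExS F = (\<^bold>\<not> fAllS (\<lambda>X. \<^bold>\<not> F X))" by (simp add: fExS_def fAllS_def fNeg_def ExS_def)
  moreover have "holds C (\<^bold>\<not> fAllS (\<lambda>X. \<^bold>\<not> F X)) (\<not> (\<forall>A \<in> Sets. \<not> P A))" using assms by (intro sem)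
  ultimately show ?thesis by simp
qed

lemma set_lists_Suc: "(\<forall>As \<in> set_lists (Suc k). P As) \<longleftrightarrow> (\<forall>A \<in> Sets. \<forall>As \<in> set_lists k. P (A # As))"
  "(\<exists>As \<in> set_lists (Suc k). P As) \<longleftrightarrow> (\<exists>A \<in> Sets. \<exists>As \<in> set_lists k. P (A # As))"
  unfolding set_lists_def by (auto simp: length_Suc_conv) (metis length_Cons insert_subset list.simps(15))+

lemma set_lists_0: "set_lists 0 = {[]}"
  by (auto simp: set_lists_def)

lemma holds_AllSs [sem]:
  "(\<And>C' Xs As. ext C C' \<Longrightarrow> list_all2 (denS C') Xs As \<Longrightarrow> holds C' (F Xs) (P As)) \<Longrightarrow>
    holds C (AllSs k F) (\<forall>As \<in> set_lists k. P As)"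
proof (induction k arbitrary: C F P)
  case 0
  have "holds C (F []) (P [])" by (rule 0[OF ext_refl]) simp
  then show ?case by (simp add: set_lists_0)
next
  case (Suc k)
  have "holds C' (AllSs k (\<lambda>Xs. F (X # Xs))) (\<forall>As \<in> set_lists k. P (A # As))"
    if "ext C C'" "denS C' X A" for C' X A
  proof (rule Suc.IH)
    fix C'' Xs As assume "ext C' C''" "list_all2 (denS C'') Xs As"
    then show "holds C'' (F (X # Xs)) (P (A # As))"
      using that by (intro Suc.prems) (auto intro: ext_trans denS_mono)
  qed
  then show ?case unfolding AllSs.simps set_lists_Suc by (intro holds_AllS)
qed

lemma holds_ExSs [sem]:
  "(\<And>C' Xs As. ext C C' \<Longrightarrow> list_all2 (denS C') Xs As \<Longrightarrow> holds C' (F Xs) (P As)) \<Longrightarrow>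
    holds C (ExSs k F) (\<exists>As \<in> set_lists k. P As)"
proof (induction k arbitrary: C F P)
  case 0
  have "holds C (F []) (P [])" by (rule 0[OF ext_refl]) simp
  then show ?case by (simp add: set_lists_0)
next
  case (Suc k)
  have "holds C' (ExSs k (\<lambda>Xs. F (X # Xs))) (\<exists>As \<in> set_lists k. P (A # As))"
    if "ext C C'" "denS C' X A" for C' X A
  proof (rule Suc.IH)
    fix C'' Xs As assume "ext C' C''" "list_all2 (denS C'') Xs As"
    then show "holds C'' (F (X # Xs)) (P (A # As))"
      using that by (intro Suc.prems) (auto intro: ext_trans denS_mono)
  qed
  then show ?case unfolding ExSs.simps set_lists_Suc by (intro holds_ExS)
qed

lemma holds_ExUnique [sem]:
  assumes F: "\<And>C' t v. ext C C' \<Longrightarrow> den C' t v \<Longrightarrow> holds C' (F t) (P v)"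
  shows "holds C (ExUnique F) (\<exists>!v. P v)"
  unfolding ExUnique_def Ex1_def
  by (intro sem F; blast intro: den_mono ext_trans)

lemma holds_App [sem]:
  "denS C f A \<Longrightarrow> den C x a \<Longrightarrow> den C y b \<Longrightarrow> holds C (App f x y) (app A a b)"
  unfolding App_def app_def by (intro sem)

lemma holds_CMem [sem]: "den C i a \<Longrightarrow> den C c b \<Longrightarrow> holds C (i \<^bold>\<in>\<^sub>c c) (cmem a b)"
  unfolding CMem_def cmem_def by (intro sem; blast intro: den_mono ext_trans)

lemmas sem_mono = den_mono denS_mono denS_list_mono ext_trans

lemma holds_Nth [sem]:
  "den C s a \<Longrightarrow> den C i b \<Longrightarrow> den C t c \<Longrightarrow> holds C (Nth s i t) (nthm a b c)"
  unfolding Nth_def nthm_def by (intro sem)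

lemma holds_FinSeq [sem]: "den C s a \<Longrightarrow> den C l b \<Longrightarrow> holds C (FinSeq s l) (seqm a b)"
  unfolding FinSeq_def seqm_def by (intro sem; blast intro: sem_mono)

lemma holds_FG [sem]: "den C x a \<Longrightarrow> den C y b \<Longrightarrow> holds C (FG h x y) (fgm h a b)"
proof (induction h arbitrary: C x y a b)
  case 0
  then show ?case unfolding FG.simps fgm.simps by (intro sem)
next
  case (Suc h)
  from Suc.prems show ?case
    unfolding FG.simps fgm.simps by (intro sem Suc.IH; blast intro: sem_mono)
qed

lemma holds_Func [sem]:
  assumes "denS C f S"
    and "\<And>C' t v. ext C C' \<Longrightarrow> den C' t v \<Longrightarrow> holds C' (A t) (P v)"
    and "\<And>C' t v. ext C C' \<Longrightarrow> den C' t v \<Longrightarrow> holds C' (B t) (Q v)"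
  shows "holds C (Func f A B) (funcm S P Q)"
  unfolding Func_def funcm_def using assms(1) by (intro sem assms(2,3); blast intro: sem_mono)

lemma holds_Nats [sem]: "holds C (Nats t) True"
  unfolding Nats_def by (intro sem)

lemma holds_Elem [sem]: "denS C S A \<Longrightarrow> den C t v \<Longrightarrow> holds C (Elem S t) (v \<in> A)"
  unfolding Elem_def by (intro sem)

lemma holds_Below [sem]: "den C t v \<Longrightarrow> holds C (Below k t) (v < of_nat k)"
  unfolding Below_def by (intro sem den_num)

lemma holds_Rng [sem]: "denS C f A \<Longrightarrow> den C t v \<Longrightarrow> holds C (Rng f t) (rngm A v)"
  unfolding Rng_def rngm_def by (intro sem; blast intro: sem_mono)

lemma holds_Pairs [sem]:
  assumes "den C t v" and "\<And>C' t v. ext C C' \<Longrightarrow> den C' t v \<Longrightarrow> holds C' (A t) (P v)"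
  shows "holds C (Pairs A t) (pairsm P v)"
  unfolding Pairs_def pairsm_def using assms(1) by (intro sem assms(2); blast intro: sem_mono)

lemma holds_Enumerates [sem]:
  "den C s a \<Longrightarrow> den C l b \<Longrightarrow> den C Y c \<Longrightarrow> holds C (Enumerates s l Y) (enumm a b c)"
  unfolding Enumerates_def enumm_def by (intro sem; blast intro: sem_mono)

lemma holds_OneLarge [sem]: "den C Y a \<Longrightarrow> holds C (OneLarge Y) (one_large a)"
  unfolding OneLarge_def IsMin_def IsCard_def one_large_def by (intro sem; blast intro: sem_mono)

lemma holds_WeaklyHomogeneous [sem]:
  "denS C P A \<Longrightarrow> den C Y a \<Longrightarrow> holds C (WeaklyHomogeneous P Y) (weakly_homogeneous A a)"
  unfolding WeaklyHomogeneous_def weakly_homogeneous_def by (intro sem; blast intro: sem_mono)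

lemma holds_LessF [sem]: "den C y b \<Longrightarrow> den C x a \<Longrightarrow> holds C (LessF h y x) (less_fg h b a)"
  unfolding LessF_def less_fg_def by (intro sem; blast intro: sem_mono)

lemma holds_GrowthBelow [sem]: "denS C f A \<Longrightarrow> holds C (GrowthBelow h f) (growth_below h A)"
  unfolding GrowthBelow_def growth_below_def by (intro sem; blast intro: sem_mono)

lemma holds_Rel [sem]:
  "denS C R A \<Longrightarrow> den C x a \<Longrightarrow> den C y b \<Longrightarrow> holds C (Rel R x y) (relm A a b)"
  unfolding Rel_def by (intro sem)

lemma holds_RelOn [sem]: "denS C R A \<Longrightarrow> denS C S B \<Longrightarrow> holds C (RelOn R S) (rel_on A B)"
  unfolding RelOn_def rel_on_def by (intro sem; blast intro: sem_mono)

lemma holds_RelUnion [sem]: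
  assumes "list_all2 (denS C) Rs As" "den C x a" "den C y b"
  shows "holds C (RelUnion Rs x y) (rel_union As a b)"
  using assms(1)
proof (induction rule: list_all2_induct)
  case Nil
  then show ?case unfolding RelUnion_def rel_union_def Disj_def by (simp add: sem)
next
  case (Cons R Rs A As)
  have "holds C (Rel R x y \<^bold>\<or> RelUnion Rs x y) (relm A a b \<or> rel_union As a b)"
    using Cons assms(2,3) by (intro sem)
  then show ?case unfolding RelUnion_def rel_union_def Disj_def by simp
qed

lemma holds_DecSeq [sem]:
  "denS C Q A \<Longrightarrow> den C s a \<Longrightarrow> den C l b \<Longrightarrow> holds C (DecSeq Q s l) (dec_seq A a b)"
  unfolding DecSeq_def dec_seq_def by (intro sem; blast intro: sem_mono)

lemma holds_IsBound [sem]: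
  "denS C g A \<Longrightarrow> denS C Q B \<Longrightarrow> denS C S D \<Longrightarrow> holds C (IsBound g Q S) (is_bound A B D)"
  unfolding IsBound_def is_bound_def by (intro sem; blast intro: sem_mono)

lemma holds_FBounded [sem]:
  "denS C S D \<Longrightarrow> denS C R B \<Longrightarrow> denS C g A \<Longrightarrow> holds C (FBounded h S R g) (fbounded h D B A)"
  unfolding FBounded_def fbounded_def by (intro sem; blast intro: sem_mono)

lemma holds_AllFBounded [sem]:
  assumes "denS C S D" "list_all2 (denS C) Rs As" "list_all2 (denS C) gs Bs"
  shows "holds C (AllFBounded h S Rs gs) (all_fbounded h D As Bs)"
  using assms(2,3)
proof (induction arbitrary: gs Bs rule: list_all2_induct)
  case Nil
  then show ?case by (simp add: AllFBounded_def all_fbounded_def Conj_def sem)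
next
  case (Cons R Rs A As)
  show ?case
  proof (cases gs)
    case Nil
    then show ?thesis using Cons.prems by (simp add: AllFBounded_def all_fbounded_def Conj_def sem)
  next
    case (Cons g gs')
    then obtain B Bs' where B: "Bs = B # Bs'" "denS C g B" "list_all2 (denS C) gs' Bs'"
      using Cons.prems by (auto simp: list_all2_Cons1)
    have "holds C (FBounded h S R g \<^bold>\<and> AllFBounded h S Rs gs') (fbounded h D A B \<and> all_fbounded h D As Bs')"
      using Cons.hyps Cons.IH assms(1) B by (intro sem)
    then show ?thesis
      by (simp add: AllFBounded_def all_fbounded_def Conj_def \<open>gs = g # gs'\<close> B(1))
  qed
qed

lemma holds_TransCl [sem]:
  "denS C R A \<Longrightarrow> den C x a \<Longrightarrow> den C y b \<Longrightarrow> holds C (TransCl R x y) (trans_cl A a b)"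
  unfolding TransCl_def trans_cl_def by (intro sem; blast intro: sem_mono)

lemma holds_WellFounded [sem]: "denS C R A \<Longrightarrow> holds C (WellFounded R) (well_founded A)"
  unfolding WellFounded_def well_founded_def by (intro sem; blast intro: sem_mono)

lemma holds_Deterministic [sem]: "denS C R A \<Longrightarrow> holds C (Deterministic R) (deterministic A)"
  unfolding Deterministic_def deterministic_def by (intro sem; blast intro: sem_mono)

lemma holds_TransitionFunction [sem]:
  "denS C f B \<Longrightarrow> denS C R A \<Longrightarrow> holds C (TransitionFunction f R) (transition_function B A)"
  unfolding TransitionFunction_def transition_function_def by (intro sem; blast intro: sem_mono)

lemma holds_Increasing [sem]: "denS C f A \<Longrightarrow> holds C (Increasing f) (increasing A)"
  unfolding Increasing_def increasing_def by (intro sem; blast intro: sem_mono)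

lemma holds_TransitiveDecreasing [sem]:
  "list_all2 (denS C) Rs As \<Longrightarrow> denS C f A \<Longrightarrow>
    holds C (TransitiveDecreasing Rs f) (transitive_decreasing As A)"
  unfolding TransitiveDecreasing_def transitive_decreasing_def by (intro sem; blast intro: sem_mono)

lemma holds_WPH [sem]: "holds (C :: 'a::rca ctx) (WPH h k) (wph TYPE('a) h k)"
  unfolding WPH_def wph_def by (intro sem; blast intro: sem_mono)

lemma holds_HCT [sem]: "holds (C :: 'a::rca ctx) (HCT h k) (hct TYPE('a) h k)"
  unfolding HCT_def hct_def by (intro sem; blast intro: sem_mono)

lemma holds_TT [sem]: "holds (C :: 'a::rca ctx) (TT h k) (tt TYPE('a) h k)"
  unfolding TT_def tt_def by (intro sem; blast intro: sem_mono)

lemma holds_Tot [sem]: "holds (C :: 'a::rca ctx) (Tot h) (tot TYPE('a) h)"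
  unfolding Tot_def tot_def by (intro sem; blast intro: sem_mono)

section \<open>From truth in the term model to derivability\<close>

lemma sat_sentence:
  fixes e :: "nat \<Rightarrow> 'a::rca"
  assumes "\<And>C :: 'a ctx. holds C F Q" and "\<forall>X. E X \<in> Sets"
  shows "sat e E (sentence F) \<longleftrightarrow> Q"
  using assms(1)[of "(0, e, 0, E)"] assms(2) by (simp add: holds_def sentence_def)

text \<open>Totality is an antecedent of the goals rather than an axiom of \<open>rca\<close>, since
  one term model serves all \<open>h\<close>.\<close>

lemma derives_goal:
  assumes "Imp (sentence (Tot h)) q \<in> goals"
  shows "RCA0_star \<union> {sentence (Tot h)} \<turnstile> q"
proof -
  have "RCA0_star \<turnstile> Imp (sentence (Tot h)) q"
  proof (rule goals_derivable[OF _ assms])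
    fix p and e :: "nat \<Rightarrow> term_model" and E :: "nat \<Rightarrow> term_model set"
    assume p: "p \<in> goals" and E: "\<forall>X. E X \<in> Sets"
    have iff: "sat e E (sentence (F \<^bold>\<longleftrightarrow> G)) \<longleftrightarrow> (P \<longleftrightarrow> Q)"
      if "\<And>C :: term_model ctx. holds C F P" "\<And>C :: term_model ctx. holds C G Q" for F G P Q
      using that by (intro sat_sentence[OF _ E] sem)
    show "sat e E p"
      using p principles_equivalent[where 'a = term_model]
      by (auto simp: goals_def sat_sentence[OF holds_Tot E] iff[OF holds_WPH holds_HCT]
          iff[OF holds_HCT holds_TT] iff[OF holds_WPH holds_TT])
  qed
  then have "RCA0_star \<union> {sentence (Tot h)} \<turnstile> Imp (sentence (Tot h)) q"
    by (rule derives_mono) (rule Un_upper1)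
  then show ?thesis by (rule impE) (simp add: assm)
qed

theorem theorem7p5:
  fixes h k :: nat
  shows "(RCA0_star \<union> {sentence (Tot h)} \<turnstile> sentence (WPH h k \<^bold>\<longleftrightarrow> HCT h k)) \<and>
         (RCA0_star \<union> {sentence (Tot h)} \<turnstile> sentence (HCT h k \<^bold>\<longleftrightarrow> TT h k)) \<and>
         (RCA0_star \<union> {sentence (Tot h)} \<turnstile> sentence (WPH h k \<^bold>\<longleftrightarrow> TT h k))"
  by (intro conjI derives_goal) (auto simp: goals_def)

end
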